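(* The subset sum problem with digraph constraint (SSG), restricted to instances whose digraph $G$ is a minimal series-parallel digraph with $n$ vertices and $m$ arcs, can be solved in $\mathcal{O}(n\cdot c^2+m)$ time and $\mathcal{O}(n\cdot c)$ space, where $c$ is the capacity.
   Context: An instance consists of a set $A=\{a_1,\ldots,a_n\}$ of items, each $a_j$ with a positive integer size $s_j$, a positive integer capacity $c$, and a digraph $G=(A,E)$ without loops on the items. For $A'\subseteq A$ let $s(A')=\sum_{a_j\in A'}s_j$, and for $y\in A$ let $N^-(y)=\{u\in A : (u,y)\in E\}$. The capacity constraint is $s(A')\le c$. The digraph constraint is: for every $y\in A$, if $N^-(y)\cap A'\neq\emptyset$ then $y\in A'$. SSG asks for $A'\subseteq A$ maximizing $s(A')$ subject to both constraints. Minimal series-parallel digraphs: for vertex-disjoint digraphs $G_1=(V_1,E_1)$, $G_2=(V_2,E_2)$, let $O_1$ be the set of sinks (outdegree $0$ vertices) of $G_1$ and $I_2$ the set of sources (indegree $0$ vertices) of $G_2$; the parallel composition $G_1\cup G_2$ has vertex set $V_1\cup V_2$ and arc set $E_1\cup E_2$; the series composition $G_1\times G_2$ has vertex set $V_1\cup V_2$ and arc set $E_1\cup E_2\cup(O_1\times I_2)$. The minimal series-parallel digraphs form the smallest class containing every single-vertex digraph and closed under parallel and series composition of vertex-disjoint members. *)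

theory Defs
  imports "Graph_Theory.Pair_Digraph"
begin

section \<open>Minimal series-parallel digraphs\<close>

definition sources :: "'a pair_pre_digraph \<Rightarrow> 'a set" where
  "sources G = {v \<in> pverts G. in_degree (with_proj G) v = 0}"

definition sinks :: "'a pair_pre_digraph \<Rightarrow> 'a set" where
  "sinks G = {v \<in> pverts G. out_degree (with_proj G) v = 0}"

definition parallel_comp ::
  "'a pair_pre_digraph \<Rightarrow> 'a pair_pre_digraph \<Rightarrow> 'a pair_pre_digraph" where
  "parallel_comp G H = \<lparr>pverts = pverts G \<union> pverts H, parcs = parcs G \<union> parcs H\<rparr>"

definition series_comp ::
  "'a pair_pre_digraph \<Rightarrow> 'a pair_pre_digraph \<Rightarrow> 'a pair_pre_digraph" where
  "series_comp G H =
    \<lparr>pverts = pverts G \<union> pverts H, parcs = parcs G \<union> parcs H \<union> sinks G \<times> sources H\<rparr>"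

inductive msp_digraph :: "'a pair_pre_digraph \<Rightarrow> bool" where
  single: "msp_digraph \<lparr>pverts = {v}, parcs = {}\<rparr>"
| parallel: "\<lbrakk>msp_digraph G; msp_digraph H; pverts G \<inter> pverts H = {}\<rbrakk>
    \<Longrightarrow> msp_digraph (parallel_comp G H)"
| series: "\<lbrakk>msp_digraph G; msp_digraph H; pverts G \<inter> pverts H = {}\<rbrakk>
    \<Longrightarrow> msp_digraph (series_comp G H)"


section \<open>Subset sum with digraph constraint\<close>

text \<open>Items are numbered from 0. The arcs are listed once each, in no particular order, so that
  the length of the list is the number of arcs.\<close>

record ssg =
  capacity :: nat
  sizes :: "nat list"
  arc_list :: "(nat \<times> nat) list"

definition num_items :: "ssg \<Rightarrow> nat" where
  "num_items I = length (sizes I)"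

definition num_arcs :: "ssg \<Rightarrow> nat" where
  "num_arcs I = length (arc_list I)"

definition ssg_graph :: "ssg \<Rightarrow> nat pair_pre_digraph" where
  "ssg_graph I = \<lparr>pverts = {..<num_items I}, parcs = set (arc_list I)\<rparr>"

definition ssg_instance :: "ssg \<Rightarrow> bool" where
  "ssg_instance I \<longleftrightarrow> 0 < capacity I \<and> (\<forall>s \<in> set (sizes I). 0 < s) \<and>
     distinct (arc_list I) \<and> pair_digraph (ssg_graph I)"

definition total_size :: "ssg \<Rightarrow> nat set \<Rightarrow> nat" where
  "total_size I X = (\<Sum>j\<in>X. sizes I ! j)"

definition in_nbrs :: "'a pair_pre_digraph \<Rightarrow> 'a \<Rightarrow> 'a set" where
  "in_nbrs G y = {u \<in> pverts G. (u, y) \<in> parcs G}"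

definition ssg_feasible :: "ssg \<Rightarrow> nat set \<Rightarrow> bool" where
  "ssg_feasible I X \<longleftrightarrow> X \<subseteq> {..<num_items I} \<and> total_size I X \<le> capacity I \<and>
     (\<forall>y < num_items I. in_nbrs (ssg_graph I) y \<inter> X \<noteq> {} \<longrightarrow> y \<in> X)"

definition ssg_optimal :: "ssg \<Rightarrow> nat set \<Rightarrow> bool" where
  "ssg_optimal I X \<longleftrightarrow>
     ssg_feasible I X \<and> (\<forall>Y. ssg_feasible I Y \<longrightarrow> total_size I Y \<le> total_size I X)"


section \<open>A word RAM\<close>

text \<open>
  Programs run on a unit-cost random access machine with a read-only input (a list of words),
  and, for each program, a fixed finite number of registers and of random access arrays, all of
  them initially 0. There is no recursion, so registers and arrays are the only working storage.
  Every expression node, test node and statement costs one time unit.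

  The machine has two limits: \<open>W\<close> is the largest value that fits into a word and \<open>S\<close> is the
  number of cells of each array. A program that produces a larger value, or accesses an
  array or the input out of bounds, gets stuck and has no execution. Programs
  cannot inspect \<open>W\<close> or \<open>S\<close>.
\<close>

datatype aexp =
    Const nat
  | Reg nat
  | Input aexp
  | Cell nat aexp
  | Add aexp aexp
  | Sub aexp aexp
  | Mul aexp aexp

datatype bexp =
    Less aexp aexp
  | Equal aexp aexp
  | Not bexp
  | And bexp bexp

datatype com =
    Skip
  | Assign nat aexp
  | Store nat aexp aexp
  | Seq com com
  | If bexp com com
  | While bexp com

text \<open>Register contents and array contents.\<close>

type_synonym state = "(nat \<Rightarrow> nat) \<times> (nat \<Rightarrow> nat \<Rightarrow> nat)"

definition fit :: "nat \<Rightarrow> nat \<Rightarrow> nat option" where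
  "fit W v = (if v \<le> W then Some v else None)"

fun binop :: "nat \<Rightarrow> (nat \<Rightarrow> nat \<Rightarrow> nat) \<Rightarrow> nat option \<Rightarrow> nat option \<Rightarrow> nat option" where
  "binop W f (Some a) (Some b) = fit W (f a b)"
| "binop W f _ _ = None"

primrec aval :: "nat \<Rightarrow> nat \<Rightarrow> nat list \<Rightarrow> state \<Rightarrow> aexp \<Rightarrow> nat option" where
  "aval W S x \<sigma> (Const k) = fit W k"
| "aval W S x \<sigma> (Reg r) = fit W (fst \<sigma> r)"
| "aval W S x \<sigma> (Input e) = (case aval W S x \<sigma> e of
      None \<Rightarrow> None | Some i \<Rightarrow> if i < length x then fit W (x ! i) else None)"
| "aval W S x \<sigma> (Cell a e) = (case aval W S x \<sigma> e of
      None \<Rightarrow> None | Some i \<Rightarrow> if i < S then fit W (snd \<sigma> a i) else None)"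
| "aval W S x \<sigma> (Add e f) = binop W (+) (aval W S x \<sigma> e) (aval W S x \<sigma> f)"
| "aval W S x \<sigma> (Sub e f) = binop W (-) (aval W S x \<sigma> e) (aval W S x \<sigma> f)"
| "aval W S x \<sigma> (Mul e f) = binop W (*) (aval W S x \<sigma> e) (aval W S x \<sigma> f)"

text \<open>Conjunction is short-circuiting: the second conjunct may be out of bounds if the first one
  is false.\<close>

primrec bval :: "nat \<Rightarrow> nat \<Rightarrow> nat list \<Rightarrow> state \<Rightarrow> bexp \<Rightarrow> bool option" where
  "bval W S x \<sigma> (Less e f) = (case (aval W S x \<sigma> e, aval W S x \<sigma> f) of
      (Some a, Some b) \<Rightarrow> Some (a < b) | _ \<Rightarrow> None)"
| "bval W S x \<sigma> (Equal e f) = (case (aval W S x \<sigma> e, aval W S x \<sigma> f) of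
      (Some a, Some b) \<Rightarrow> Some (a = b) | _ \<Rightarrow> None)"
| "bval W S x \<sigma> (Not b) = map_option HOL.Not (bval W S x \<sigma> b)"
| "bval W S x \<sigma> (And b b') = (case bval W S x \<sigma> b of
      None \<Rightarrow> None | Some False \<Rightarrow> Some False | Some True \<Rightarrow> bval W S x \<sigma> b')"

primrec acost :: "aexp \<Rightarrow> nat" where
  "acost (Const k) = 1"
| "acost (Reg r) = 1"
| "acost (Input e) = acost e + 1"
| "acost (Cell a e) = acost e + 1"
| "acost (Add e f) = acost e + acost f + 1"
| "acost (Sub e f) = acost e + acost f + 1"
| "acost (Mul e f) = acost e + acost f + 1"

primrec bcost :: "bexp \<Rightarrow> nat" where
  "bcost (Less e f) = acost e + acost f + 1"
| "bcost (Equal e f) = acost e + acost f + 1"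
| "bcost (Not b) = bcost b + 1"
| "bcost (And b b') = bcost b + bcost b' + 1"

text \<open>\<open>exec W S x p \<sigma> t \<tau>\<close>: on input \<open>x\<close>, started in \<open>\<sigma>\<close>, the program \<open>p\<close> halts in \<open>\<tau>\<close> after
  \<open>t\<close> time units.\<close>

inductive exec :: "nat \<Rightarrow> nat \<Rightarrow> nat list \<Rightarrow> com \<Rightarrow> state \<Rightarrow> nat \<Rightarrow> state \<Rightarrow> bool"
  for W S x where
  Skip: "exec W S x Skip \<sigma> 1 \<sigma>"
| Assign: "aval W S x (R, M) e = Some v \<Longrightarrow>
    exec W S x (Assign r e) (R, M) (acost e + 1) (R(r := v), M)"
| Store: "\<lbrakk>aval W S x (R, M) e = Some i; i < S; aval W S x (R, M) f = Some v\<rbrakk> \<Longrightarrow>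
    exec W S x (Store a e f) (R, M) (acost e + acost f + 1) (R, M(a := (M a)(i := v)))"
| Seq: "\<lbrakk>exec W S x p \<sigma> t \<tau>; exec W S x q \<tau> u \<rho>\<rbrakk> \<Longrightarrow>
    exec W S x (Seq p q) \<sigma> (t + u + 1) \<rho>"
| IfTrue: "\<lbrakk>bval W S x \<sigma> b = Some True; exec W S x p \<sigma> t \<tau>\<rbrakk> \<Longrightarrow>
    exec W S x (If b p q) \<sigma> (bcost b + t + 1) \<tau>"
| IfFalse: "\<lbrakk>bval W S x \<sigma> b = Some False; exec W S x q \<sigma> t \<tau>\<rbrakk> \<Longrightarrow>
    exec W S x (If b p q) \<sigma> (bcost b + t + 1) \<tau>"
| WhileFalse: "bval W S x \<sigma> b = Some False \<Longrightarrow>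
    exec W S x (While b p) \<sigma> (bcost b + 1) \<sigma>"
| WhileTrue: "\<lbrakk>bval W S x \<sigma> b = Some True; exec W S x p \<sigma> t \<tau>;
     exec W S x (While b p) \<tau> u \<rho>\<rbrakk> \<Longrightarrow>
    exec W S x (While b p) \<sigma> (bcost b + t + u + 1) \<rho>"

inductive_cases exec_SkipE: "exec W S x Skip \<sigma> t \<tau>"
inductive_cases exec_AssignE: "exec W S x (Assign r e) \<sigma> t \<tau>"
inductive_cases exec_StoreE: "exec W S x (Store a e f) \<sigma> t \<tau>"
inductive_cases exec_SeqE: "exec W S x (Seq p q) \<sigma> t \<tau>"
inductive_cases exec_IfE: "exec W S x (If b p q) \<sigma> t \<tau>"
inductive_cases exec_WhileE: "exec W S x (While b p) \<sigma> t \<tau>"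

lemma exec_deterministic:
  "exec W S x p \<sigma> t \<tau> \<Longrightarrow> exec W S x p \<sigma> t' \<tau>' \<Longrightarrow> t' = t \<and> \<tau>' = \<tau>"
proof (induction arbitrary: t' \<tau>' rule: exec.induct)
  case (Skip \<sigma>)
  from Skip.prems show ?case by (rule exec_SkipE) simp
next
  case (Assign R M e v r)
  from Assign.prems show ?case by (rule exec_AssignE) (use Assign.hyps in simp)
next
  case (Store R M e i f v a)
  from Store.prems show ?case by (rule exec_StoreE) (use Store.hyps in simp)
next
  case (Seq p \<sigma> t \<tau> q u \<rho>)
  from Seq.prems show ?case
  proof (rule exec_SeqE)
    fix t1 \<tau>1 u1
    assume *: "t' = Suc (t1 + u1)" "exec W S x p \<sigma> t1 \<tau>1" "exec W S x q \<tau>1 u1 \<tau>'"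
    from Seq.IH(1)[OF *(2)] have "t1 = t" "\<tau>1 = \<tau>" by simp_all
    with *(1) Seq.IH(2) *(3) show ?thesis by simp
  qed
next
  case (IfTrue \<sigma> b p t \<tau> q)
  from IfTrue.prems show ?case
  proof (rule exec_IfE)
    assume "bval W S x \<sigma> b = Some False"
    with IfTrue.hyps show ?thesis by simp
  next
    fix t1
    assume *: "t' = Suc (bcost b + t1)" "exec W S x p \<sigma> t1 \<tau>'"
    from *(1) IfTrue.IH[OF *(2)] show ?thesis by simp
  qed
next
  case (IfFalse \<sigma> b q t \<tau> p)
  from IfFalse.prems show ?case
  proof (rule exec_IfE)
    assume "bval W S x \<sigma> b = Some True"
    with IfFalse.hyps show ?thesis by simp
  next
    fix t1
    assume *: "t' = Suc (bcost b + t1)" "exec W S x q \<sigma> t1 \<tau>'"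
    from *(1) IfFalse.IH[OF *(2)] show ?thesis by simp
  qed
next
  case (WhileFalse \<sigma> b p)
  from WhileFalse.prems show ?case by (rule exec_WhileE) (use WhileFalse.hyps in simp_all)
next
  case (WhileTrue \<sigma> b p t \<tau> u \<rho>)
  from WhileTrue.prems show ?case
  proof (rule exec_WhileE)
    assume "bval W S x \<sigma> b = Some False"
    with WhileTrue.hyps show ?thesis by simp
  next
    fix t1 \<tau>1 u1
    assume *: "t' = Suc (bcost b + t1 + u1)"
      "exec W S x p \<sigma> t1 \<tau>1" "exec W S x (While b p) \<tau>1 u1 \<tau>'"
    from WhileTrue.IH(1)[OF *(2)] have "t1 = t" "\<tau>1 = \<tau>" by simp_all
    with *(1) WhileTrue.IH(2) *(3) show ?thesis by simp
  qed
qed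

primrec aexp_regs :: "aexp \<Rightarrow> nat set" where
  "aexp_regs (Const k) = {}"
| "aexp_regs (Reg r) = {r}"
| "aexp_regs (Input e) = aexp_regs e"
| "aexp_regs (Cell a e) = aexp_regs e"
| "aexp_regs (Add e f) = aexp_regs e \<union> aexp_regs f"
| "aexp_regs (Sub e f) = aexp_regs e \<union> aexp_regs f"
| "aexp_regs (Mul e f) = aexp_regs e \<union> aexp_regs f"

primrec aexp_arrays :: "aexp \<Rightarrow> nat set" where
  "aexp_arrays (Const k) = {}"
| "aexp_arrays (Reg r) = {}"
| "aexp_arrays (Input e) = aexp_arrays e"
| "aexp_arrays (Cell a e) = insert a (aexp_arrays e)"
| "aexp_arrays (Add e f) = aexp_arrays e \<union> aexp_arrays f"
| "aexp_arrays (Sub e f) = aexp_arrays e \<union> aexp_arrays f"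
| "aexp_arrays (Mul e f) = aexp_arrays e \<union> aexp_arrays f"

primrec bexp_aexps :: "bexp \<Rightarrow> aexp set" where
  "bexp_aexps (Less e f) = {e, f}"
| "bexp_aexps (Equal e f) = {e, f}"
| "bexp_aexps (Not b) = bexp_aexps b"
| "bexp_aexps (And b b') = bexp_aexps b \<union> bexp_aexps b'"

primrec com_regs :: "com \<Rightarrow> nat set" where
  "com_regs Skip = {}"
| "com_regs (Assign r e) = insert r (aexp_regs e)"
| "com_regs (Store a e f) = aexp_regs e \<union> aexp_regs f"
| "com_regs (Seq p q) = com_regs p \<union> com_regs q"
| "com_regs (If b p q) = \<Union> (aexp_regs ` bexp_aexps b) \<union> com_regs p \<union> com_regs q"
| "com_regs (While b p) = \<Union> (aexp_regs ` bexp_aexps b) \<union> com_regs p"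

primrec com_arrays :: "com \<Rightarrow> nat set" where
  "com_arrays Skip = {}"
| "com_arrays (Assign r e) = aexp_arrays e"
| "com_arrays (Store a e f) = insert a (aexp_arrays e \<union> aexp_arrays f)"
| "com_arrays (Seq p q) = com_arrays p \<union> com_arrays q"
| "com_arrays (If b p q) = \<Union> (aexp_arrays ` bexp_aexps b) \<union> com_arrays p \<union> com_arrays q"
| "com_arrays (While b p) = \<Union> (aexp_arrays ` bexp_aexps b) \<union> com_arrays p"

text \<open>Number of words of working storage of a program whose arrays have \<open>S\<close> cells. The read-only
  input is not counted; the array holding the output is.\<close>

definition work_space :: "com \<Rightarrow> nat \<Rightarrow> nat" where
  "work_space p S = card (com_regs p) + card (com_arrays p) * S"

definition init_state :: state where
  "init_state = ((\<lambda>_. 0), (\<lambda>_ _. 0))"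

text \<open>The words have \<open>O(log N)\<close> bits, where \<open>N\<close> is the number of input words plus the largest
  input word.\<close>

definition word_bound :: "nat \<Rightarrow> nat list \<Rightarrow> nat" where
  "word_bound k x = (length x + Max (set x)) ^ k"

definition encode :: "ssg \<Rightarrow> nat list" where
  "encode I = [num_items I, num_arcs I, capacity I] @ sizes I @
     concat (map (\<lambda>(u, v). [u, v]) (arc_list I))"

text \<open>The output is the 0/1 indicator of a set of items, in the first cells of array 0.\<close>

definition outputs :: "ssg \<Rightarrow> state \<Rightarrow> nat set \<Rightarrow> bool" where
  "outputs I \<tau> X \<longleftrightarrow> X \<subseteq> {..<num_items I} \<and>
     (\<forall>j < num_items I. snd \<tau> 0 j = (if j \<in> X then 1 else 0))"

end

theory Submission
  imports Defs
begin

text \<open>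
  In a minimal series-parallel digraph the arcs fall into complete bipartite blocks, so it is the line
  digraph of a two-terminal series-parallel multigraph whose nodes are the blocks and whose edges are
  the \<open>n\<close> items. The block of an item is found in \<open>O(n + m)\<close> time as the least of its out-neighbours.
  The nodes of the multigraph are then processed in topological order. The edges entering a node \<open>d\<close>
  are merged whenever they are parallel, and a predecessor of \<open>d\<close> is bypassed by a series reduction as
  soon as it has only one edge left. Both reductions preserve the class of two-terminal
  series-parallel multigraphs, and in that class a node with several incoming edges all of whose
  predecessors have in-degree at most one always admits a reduction; hence each node ends up with a
  single incoming edge, and the sink leaves a single edge. The at most \<open>n - 1\<close> reductions form a
  decomposition tree. A set is feasible for a series composition iff its part in the first component
  is empty or its part in the second one is complete, and since sizes are positive both conditions
  can be read off the sizes of the parts. So the attainable sizes of a component are found by trying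
  the \<open>O(c\<^sup>2)\<close> pairs of attainable sizes of its parts. Each attainable size is stored with one such
  pair, from which an optimal set is recovered top-down.
\<close>

section \<open>Two-terminal series-parallel multigraphs\<close>

text \<open>The input is a bare arc list without a decomposition, so the tree has to be found within
  the same bounds. As \<open>m\<close> may be of order \<open>n * n\<close> while only O(n * c)
  cells are available, the arcs are never copied: the read-only input is scanned twice, and from
  then on only a multigraph with \<open>n\<close> edges is kept.

  Searching the whole multigraph for reductions is avoided by the topological order. When a node
  \<open>d\<close> is reached, the surviving earlier nodes form an out-tree rooted at the source, so
  it suffices to look at the edges entering \<open>d\<close>, and testing an out-degree counter for
  zero detects a series reduction in constant time. One edge may still trigger a long chain of
  reductions, which is why time is amortized: a reduction replaces two edges by one and creates one
  component, so the number of edges plus the number of components is always \<open>2 * n\<close>.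
  This one equation bounds the number of tables, the range of the labels and the running
  time.\<close>

definition nodes :: "('v \<times> 'e \<times> 'v) set \<Rightarrow> 'v set" where
  "nodes G = {x. (\<exists>e b. (x, e, b) \<in> G) \<or> (\<exists>a e. (a, e, x) \<in> G)}"

text \<open>Edges are triples of tail, label and head; the label tells parallel edges apart. Only
  \<open>par\<close> has to demand disjoint edge sets: in \<open>ser\<close> a common edge would
  start at \<open>m\<close>, which has no outgoing edge in \<open>G\<close>.\<close>

inductive ttsp :: "('v \<times> 'e \<times> 'v) set \<Rightarrow> 'v \<Rightarrow> 'v \<Rightarrow> bool" where
  edge: "s \<noteq> t \<Longrightarrow> ttsp {(s, e, t)} s t"
| ser: "ttsp G s m \<Longrightarrow> ttsp H m t \<Longrightarrow> nodes G \<inter> nodes H = {m} \<Longrightarrow> ttsp (G \<union> H) s t"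
| par: "ttsp G s t \<Longrightarrow> ttsp H s t \<Longrightarrow> nodes G \<inter> nodes H = {s, t} \<Longrightarrow> G \<inter> H = {} \<Longrightarrow> ttsp (G \<union> H) s t"

lemma nodesI: "(a, e, b) \<in> G \<Longrightarrow> a \<in> nodes G" "(a, e, b) \<in> G \<Longrightarrow> b \<in> nodes G"
  by (auto simp: nodes_def)

lemma nodes_Un: "nodes (G \<union> H) = nodes G \<union> nodes H"
  by (auto simp: nodes_def)

lemma nodes_insert: "nodes (insert (a, e, b) G) = {a, b} \<union> nodes G"
  by (auto simp: nodes_def)

lemma nodes_empty [simp]: "nodes {} = {}"
  by (auto simp: nodes_def)

lemma nodes_mono: "G \<subseteq> H \<Longrightarrow> nodes G \<subseteq> nodes H"
  by (auto simp: nodes_def)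

lemma ttsp_terminals: "ttsp G s t \<Longrightarrow> s \<noteq> t \<and> s \<in> nodes G \<and> t \<in> nodes G"
proof (induction rule: ttsp.induct)
  case (ser G s m H t)
  then show ?case by (auto simp: nodes_Un)
qed (auto simp: nodes_Un nodes_insert)

lemma ttsp_finite: "ttsp G s t \<Longrightarrow> finite G \<and> G \<noteq> {}"
  by (induction rule: ttsp.induct) auto

lemma ttsp_no_in_source: "ttsp G s t \<Longrightarrow> (a, e, s) \<notin> G"
proof (induction arbitrary: a e rule: ttsp.induct)
  case (ser G s m H t)
  have "s \<notin> nodes H" using ser.hyps ttsp_terminals[OF ser.hyps(1)] by auto
  then show ?case using ser.IH nodesI(2)[of a e s H] by auto
qed auto

lemma ttsp_no_out_sink: "ttsp G s t \<Longrightarrow> (t, e, b) \<notin> G"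
proof (induction arbitrary: b e rule: ttsp.induct)
  case (ser G s m H t)
  have "t \<notin> nodes G" using ser.hyps ttsp_terminals[OF ser.hyps(2)] by auto
  then show ?case using ser.IH nodesI(1)[of t e b G] by auto
qed auto

lemma ttsp_ser_terminals:
  assumes "ttsp G s m" "ttsp H m t" "nodes G \<inter> nodes H = {m}"
  shows "s \<notin> nodes H" "t \<notin> nodes G"
proof -
  have *: "x = m" if "x \<in> nodes G" "x \<in> nodes H" for x using that assms(3) by blast
  show "s \<notin> nodes H" "t \<notin> nodes G"
    using *[of s] *[of t] ttsp_terminals[OF assms(1)] ttsp_terminals[OF assms(2)] by metis+
qed

text \<open>A common tail could only be \<open>m\<close>, the sink of \<open>G\<close>. Hence all
  edges leaving a node lie in one factor of a series composition, which localizes arguments about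
  parallel edges and out-degrees.\<close>

lemma ttsp_ser_disjoint:
  assumes "ttsp G s m" "nodes G \<inter> nodes H = {m}" "(x, e, y) \<in> G" "(x, e', y') \<in> H"
  shows False
proof -
  have "x = m" using nodesI(1)[OF assms(3)] nodesI(1)[OF assms(4)] assms(2) by blast
  then show False using ttsp_no_out_sink[OF assms(1)] assms(3) by blast
qed

lemma ttsp_ser_subset:
  assumes "ttsp G' s m" "ttsp H' m t" "nodes G' \<subseteq> nodes G" "nodes H' \<subseteq> nodes H" "nodes G \<inter> nodes H = {m}"
  shows "ttsp (G' \<union> H') s t"
proof -
  have "nodes G' \<inter> nodes H' = {m}"
    using assms(3-5) ttsp_terminals[OF assms(1)] ttsp_terminals[OF assms(2)] by blast
  then show ?thesis by (rule ttsp.ser[OF assms(1,2)])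
qed

lemma ttsp_par_subset:
  assumes "ttsp G' s t" "ttsp H s t" "nodes G' \<subseteq> nodes G" "nodes G \<inter> nodes H = {s, t}" "G' \<inter> H = {}"
  shows "ttsp (G' \<union> H) s t"
proof -
  have "nodes G' \<inter> nodes H = {s, t}"
    using assms(3,4) ttsp_terminals[OF assms(1)] ttsp_terminals[OF assms(2)] by blast
  then show ?thesis by (rule ttsp.par[OF assms(1,2) _ assms(5)])
qed

lemma nodes_Diff: "nodes (G - X) \<subseteq> nodes G"
  by (rule nodes_mono) auto

lemma ttsp_ex_in: "ttsp G s t \<Longrightarrow> d \<in> nodes G \<Longrightarrow> d \<noteq> s \<Longrightarrow> \<exists>a e. (a, e, d) \<in> G"
proof (induction rule: ttsp.induct)
  case (ser G s m H t)
  then show ?case using ttsp_terminals[of G s m] by (cases "d = m") (auto simp: nodes_Un)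
qed (auto simp: nodes_Un nodes_insert)

lemma ttsp_ex_out: "ttsp G s t \<Longrightarrow> d \<in> nodes G \<Longrightarrow> d \<noteq> t \<Longrightarrow> \<exists>e b. (d, e, b) \<in> G"
proof (induction rule: ttsp.induct)
  case (ser G s m H t)
  then show ?case using ttsp_terminals[of H m t] by (cases "d = m") (auto simp: nodes_Un)
qed (auto simp: nodes_Un nodes_insert)

text \<open>A potential witnessing acyclicity. The bound by the value at the sink is part of the
  induction: a series composition puts the potential of \<open>H\<close> on top of
  \<open>f m\<close>, and a parallel one needs a common top value.\<close>

lemma ttsp_rank: "ttsp G s t \<Longrightarrow> \<exists>r :: 'v \<Rightarrow> nat. \<forall>(a, e, b) \<in> G. r a < r b \<and> r b \<le> r t"
  for G :: "('v \<times> 'e \<times> 'v) set"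
proof (induction rule: ttsp.induct)
  case (edge s t e)
  then show ?case by (intro exI[of _ "\<lambda>x. if x = s then 0 else 1"]) auto
next
  case (ser G s m H t)
  from ser.IH obtain f g :: "'v \<Rightarrow> nat" where f: "\<forall>(a, e, b) \<in> G. f a < f b \<and> f b \<le> f m"
    and g: "\<forall>(a, e, b) \<in> H. g a < g b \<and> g b \<le> g t"
    by (elim exE)
  define r where "r = (\<lambda>x. if x \<in> nodes G then (f x :: nat) else f m + g x)"
  have t: "t \<notin> nodes G" using ser.hyps ttsp_terminals[OF ser.hyps(2)] by auto
  have "r a < r b \<and> r b \<le> r t" if e: "(a, e, b) \<in> G \<union> H" for a e b
  proof (cases "(a, e, b) \<in> G")
    case True
    then show ?thesis using f nodesI[OF True] t by (fastforce simp: r_def)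
  next
    case False
    then have H: "(a, e, b) \<in> H" using e by simp
    have "b = m" if "b \<in> nodes G" using that nodesI(2)[OF H] ser.hyps(3) by blast
    then have b: "b \<notin> nodes G" using ttsp_no_in_source[OF ser.hyps(2)] H by blast
    have gb: "g a < g b" "g b \<le> g t" using g H by auto
    show ?thesis
    proof (cases "a \<in> nodes G")
      case True
      then have "a = m" using nodesI[OF H] ser.hyps(3) by auto
      with True b gb t show ?thesis by (auto simp: r_def)
    next
      case False
      with b gb t show ?thesis by (auto simp: r_def)
    qed
  qed
  then show ?case by blast
next
  case (par G s t H)
  from par.IH obtain f g :: "'v \<Rightarrow> nat" where f: "\<forall>(a, e, b) \<in> G. f a < f b \<and> f b \<le> f t"
    and g: "\<forall>(a, e, b) \<in> H. g a < g b \<and> g b \<le> g t"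
    by (elim exE)
  \<comment> \<open>The terminals belong to both parts, so they get common values below and above
    all others; the \<open>+ 1\<close> keeps inner nodes above the value 0 of the source.\<close>
  define r where "r = (\<lambda>x. if x = s then (0::nat) else if x = t then f t + g t + 1
    else if x \<in> nodes G then f x + 1 else g x + 1)"
  have st: "s \<noteq> t" using ttsp_terminals[OF par.hyps(1)] by simp
  have "r a < r b \<and> r b \<le> r t" if e: "(a, e, b) \<in> G" for a e b
  proof -
    have "b \<noteq> s" "a \<noteq> t" using e ttsp_no_in_source[OF par.hyps(1)] ttsp_no_out_sink[OF par.hyps(1)] by auto
    with st f e nodesI[OF e] show ?thesis by (fastforce simp: r_def)
  qed
  moreover have "r a < r b \<and> r b \<le> r t" if e: "(a, e, b) \<in> H" for a e b
  proof -
    have "b \<noteq> s" "a \<noteq> t" using e ttsp_no_in_source[OF par.hyps(2)] ttsp_no_out_sink[OF par.hyps(2)] by auto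
    moreover have "x \<notin> nodes G" if "x \<in> {a, b}" "x \<noteq> s" "x \<noteq> t" for x
      using that nodesI[OF e] par.hyps(3) by auto
    ultimately show ?thesis using st g e nodesI[OF e] by (fastforce simp: r_def)
  qed
  ultimately show ?case by blast
qed

lemma nodes_image:
  assumes "\<And>a e b. (a, e, b) \<in> G \<Longrightarrow> \<exists>e'. f (a, e, b) = (h a, e', h b)"
  shows "nodes (f ` G) = h ` nodes G"
proof
  show "nodes (f ` G) \<subseteq> h ` nodes G"
  proof
    fix x assume "x \<in> nodes (f ` G)"
    then obtain g where "g \<in> G" "fst (f g) = x \<or> snd (snd (f g)) = x"
      by (auto simp: nodes_def image_iff) (metis fst_conv snd_conv)+
    moreover obtain a e b where "g = (a, e, b)" by (cases g)
    ultimately have "(a, e, b) \<in> G" "fst (f (a, e, b)) = x \<or> snd (snd (f (a, e, b))) = x" by auto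
    then show "x \<in> h ` nodes G" using assms[of a e b] nodesI[of a e b G] by auto
  qed
  show "h ` nodes G \<subseteq> nodes (f ` G)"
  proof
    fix x assume "x \<in> h ` nodes G"
    then obtain a e b where "(a, e, b) \<in> G" "h a = x \<or> h b = x" by (auto simp: nodes_def)
    then show "x \<in> nodes (f ` G)" using assms[of a e b] nodesI[of "h a" _ "h b" "f ` G"]
      by (metis imageI)
  qed
qed

text \<open>Nodes are renamed by \<open>h\<close>, while \<open>f\<close> may also change labels
  edge by edge. One statement thus covers relabelling an edge and moving the sink to a new
  node.\<close>

lemma ttsp_image:
  assumes "ttsp G s t" "inj_on h (nodes G)" "inj_on f G"
    and "\<And>a e b. (a, e, b) \<in> G \<Longrightarrow> \<exists>e'. f (a, e, b) = (h a, e', h b)"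
  shows "ttsp (f ` G) (h s) (h t)"
  using assms
proof (induction rule: ttsp.induct)
  case (edge s t e)
  then obtain e' where "f (s, e, t) = (h s, e', h t)" by blast
  moreover have "h s \<noteq> h t" using edge by (auto simp: nodes_insert)
  ultimately show ?case by (auto intro: ttsp.edge)
next
  case (ser G s m H t)
  have i: "inj_on h (nodes G)" "inj_on h (nodes H)" "inj_on f G" "inj_on f H"
    using ser.prems by (auto simp: nodes_Un intro: inj_on_subset)
  have "nodes (f ` G) \<inter> nodes (f ` H) = h ` nodes G \<inter> h ` nodes H"
    using ser.prems by (simp add: nodes_image[where h = h])
  also have "\<dots> = h ` (nodes G \<inter> nodes H)"
    using ser.prems(1) by (intro inj_on_image_Int[symmetric, of h "nodes G \<union> nodes H"]) (auto simp: nodes_Un)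
  finally have n: "nodes (f ` G) \<inter> nodes (f ` H) = {h m}" using ser.hyps by simp
  show ?case unfolding image_Un
    by (rule ttsp.ser[OF ser.IH(1)[OF i(1,3)] ser.IH(2)[OF i(2,4)] n]) (use ser.prems in blast)+
next
  case (par G s t H)
  have i: "inj_on h (nodes G)" "inj_on h (nodes H)" "inj_on f G" "inj_on f H"
    using par.prems by (auto simp: nodes_Un intro: inj_on_subset)
  have "nodes (f ` G) \<inter> nodes (f ` H) = h ` nodes G \<inter> h ` nodes H"
    using par.prems by (simp add: nodes_image[where h = h])
  also have "\<dots> = h ` (nodes G \<inter> nodes H)"
    using par.prems(1) by (intro inj_on_image_Int[symmetric, of h "nodes G \<union> nodes H"]) (auto simp: nodes_Un)
  finally have n: "nodes (f ` G) \<inter> nodes (f ` H) = {h s, h t}" using par.hyps by simp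
  have d: "f ` G \<inter> f ` H = {}"
    using par.prems(2) par.hyps by (metis inj_on_image_Int image_empty Un_upper1 Un_upper2)
  show ?case unfolding image_Un
    by (rule ttsp.par[OF par.IH(1)[OF i(1,3)] par.IH(2)[OF i(2,4)] n d]) (use par.prems in blast)+
qed

section \<open>Reductions that preserve the series-parallel class\<close>

lemma ttsp_relabel_edge:
  assumes "ttsp G s t" "(a, v, b) \<in> G" "(a, z, b) \<notin> G"
  shows "ttsp (insert (a, z, b) (G - {(a, v, b)})) s t"
proof -
  define f where "f = (\<lambda>g. if g = (a, v, b) then (a, z, b) else g)"
  have "f ` G = insert (a, z, b) (G - {(a, v, b)})" using assms by (auto simp: f_def)
  moreover have "ttsp (f ` G) (id s) (id t)"
    by (rule ttsp_image[OF assms(1)]) (use assms in \<open>auto simp: f_def inj_on_def\<close>)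
  ultimately show ?thesis by simp
qed

text \<open>Needed when a series reduction falls on the joint of a series composition: the last edge
  of the first factor is then prolonged to the node \<open>d\<close> of the second.\<close>

lemma ttsp_relabel_sink:
  assumes G: "ttsp G s m" "(a, u, m) \<in> G" and u: "\<And>a' e. (a', e, m) \<in> G \<Longrightarrow> (a', e) = (a, u)"
    and d: "d \<notin> nodes G"
  shows "ttsp (insert (a, z, d) (G - {(a, u, m)})) s d"
proof -
  define f where "f = (\<lambda>g. if g = (a, u, m) then (a, z, d) else g)"
  have e: "f ` G = insert (a, z, d) (G - {(a, u, m)})" using G(2) by (auto simp: f_def)
  have i: "inj_on f G" using nodesI(2)[of _ _ d G] d by (auto simp: inj_on_def f_def)
  have am: "a \<noteq> m" using ttsp_no_out_sink[OF G(1)] G(2) by auto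
  have "ttsp (f ` G) ((id(m := d)) s) ((id(m := d)) m)"
  proof (rule ttsp_image[OF G(1) _ i])
    show "inj_on (id(m := d)) (nodes G)" using d by (auto simp: inj_on_def)
    show "\<exists>e'. f (a', e, b) = ((id(m := d)) a', e', (id(m := d)) b)" if "(a', e, b) \<in> G" for a' e b
      using that u[of a' e] ttsp_no_out_sink[OF G(1), of e b] am
      by (cases "b = m") (auto simp: f_def)
  qed
  then show ?thesis using e ttsp_terminals[OF G(1)] by simp
qed

text \<open>Neither factor of a series composition contains both \<open>s\<close> and
  \<open>t\<close>, so such an edge sits below parallel compositions only, and removing it leaves
  another branch unless it is the whole graph.\<close>

lemma ttsp_delete_source_sink:
  assumes "ttsp G s t" "(s, u, t) \<in> G"
  shows "G = {(s, u, t)} \<or> ttsp (G - {(s, u, t)}) s t"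
  using assms
proof (induction rule: ttsp.induct)
  case (ser G s m H t)
  have "s \<notin> nodes H" "t \<notin> nodes G" using ttsp_ser_terminals[OF ser.hyps(1-3)] .
  then show ?case using ser.prems nodesI(1)[of s u t H] nodesI(2)[of s u t G] by blast
next
  case (par G s t H)
  have *: "ttsp (A \<union> B - {(s, u, t)}) s t"
    if A: "ttsp A s t" and B: "ttsp B s t" and n: "nodes A \<inter> nodes B = {s, t}" "A \<inter> B = {}"
      and m: "(s, u, t) \<in> A" and IH: "A = {(s, u, t)} \<or> ttsp (A - {(s, u, t)}) s t" for A B
    using IH
  proof
    assume "A = {(s, u, t)}"
    then have "A \<union> B - {(s, u, t)} = B" using n by auto
    then show ?thesis using B by simp
  next
    assume r: "ttsp (A - {(s, u, t)}) s t"
    have "A \<union> B - {(s, u, t)} = (A - {(s, u, t)}) \<union> B" using m n by auto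
    then show ?thesis using ttsp_par_subset[OF r B nodes_Diff n(1)] n(2) by auto
  qed
  show ?case
  proof (cases "(s, u, t) \<in> G")
    case True
    then show ?thesis using *[OF par.hyps(1-4) True par.IH(1)] by simp
  next
    case False
    then have m: "(s, u, t) \<in> H" using par.prems by simp
    show ?thesis using *[OF par.hyps(2,1) _ _ m par.IH(2)[OF m]] par.hyps(3,4)
      by (simp add: Int_commute Un_commute)
  qed
qed auto

text \<open>In a series composition both edges belong to the same factor. In a parallel composition
  they may be on different sides, but then their ends are \<open>s\<close> and \<open>t\<close>, and
  \<open>ttsp_delete_source_sink\<close> applies to the side of the deleted edge.\<close>

lemma ttsp_delete_parallel:
  assumes "ttsp G s t" "(a, u, b) \<in> G" "(a, v, b) \<in> G" "u \<noteq> v"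
  shows "ttsp (G - {(a, u, b)}) s t"
  using assms
proof (induction rule: ttsp.induct)
  case (ser G s m H t)
  show ?case
  proof (cases "(a, u, b) \<in> G")
    case True
    have nh: "(a, e, b) \<notin> H" for e
      using ttsp_ser_disjoint[OF ser.hyps(1,3) True] by blast
    then have r: "ttsp (G - {(a, u, b)}) s m" using ser True by auto
    have "G \<union> H - {(a, u, b)} = (G - {(a, u, b)}) \<union> H" using nh by auto
    then show ?thesis using ttsp_ser_subset[OF r ser.hyps(2) nodes_Diff order_refl ser.hyps(3)] by simp
  next
    case False
    then have h: "(a, u, b) \<in> H" using ser.prems by auto
    have "(a, v, b) \<notin> G"
      using ttsp_ser_disjoint[OF ser.hyps(1,3) _ h] by blast
    then have r: "ttsp (H - {(a, u, b)}) m t" using ser h by auto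
    have "G \<union> H - {(a, u, b)} = G \<union> (H - {(a, u, b)})" using False by auto
    then show ?thesis using ttsp_ser_subset[OF ser.hyps(1) r order_refl nodes_Diff ser.hyps(3)] by simp
  qed
next
  case (par G s t H)
  have *: "ttsp (A \<union> B - {(a, u, b)}) s t"
    if A: "ttsp A s t" and B: "ttsp B s t" and n: "nodes A \<inter> nodes B = {s, t}" "A \<inter> B = {}"
      and m: "(a, u, b) \<in> A" and m2: "(a, v, b) \<in> A \<union> B"
      and IH: "(a, v, b) \<in> A \<Longrightarrow> ttsp (A - {(a, u, b)}) s t" for A B
  proof -
    have split: "A \<union> B - {(a, u, b)} = (A - {(a, u, b)}) \<union> B" using m n by auto
    have glue: ?thesis if r: "ttsp (A - {(a, u, b)}) s t"
      using ttsp_par_subset[OF r B nodes_Diff n(1)] n(2) split by auto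
    show ?thesis
    proof (cases "(a, v, b) \<in> A")
      case True
      then show ?thesis using glue IH by simp
    next
      case False
      then have vB: "(a, v, b) \<in> B" using m2 by simp
      have "a \<in> {s, t}" "b \<in> {s, t}" using nodesI[OF m] nodesI[OF vB] n by auto
      then have ab: "a = s" "b = t"
        using ttsp_no_out_sink[OF A, of u b] ttsp_no_in_source[OF A, of a u] m by auto
      from ttsp_delete_source_sink[OF A] m ab have "A = {(a, u, b)} \<or> ttsp (A - {(a, u, b)}) s t" by simp
      then show ?thesis
      proof
        assume "A = {(a, u, b)}"
        then show ?thesis using split B by simp
      qed (rule glue)
    qed
  qed
  show ?case
  proof (cases "(a, u, b) \<in> G")
    case True
    show ?thesis using *[OF par.hyps(1-4) True par.prems(2)] par.IH(1) True par.prems(3) by blast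
  next
    case False
    then have m: "(a, u, b) \<in> H" using par.prems by simp
    show ?thesis using *[OF par.hyps(2,1) _ _ m] par.IH(2) m par.hyps(3,4) par.prems
      by (simp add: Int_commute Un_commute)
  qed
qed auto

lemma ttsp_reduce_parallel:
  assumes "ttsp G s t" "(a, u, b) \<in> G" "(a, v, b) \<in> G" "u \<noteq> v" "(a, z, b) \<notin> G"
  shows "ttsp (insert (a, z, b) (G - {(a, u, b), (a, v, b)})) s t"
proof -
  have "G - {(a, u, b), (a, v, b)} = G - {(a, u, b)} - {(a, v, b)}" by auto
  then show ?thesis
    using ttsp_relabel_edge[OF ttsp_delete_parallel[OF assms(1-4)], of a v b z] assms by simp
qed

text \<open>A parallel composition would have two edges leaving its source, so the induction
  descends through first factors of series compositions only. That \<open>s\<close> disappears from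
  the rest is needed to glue the rest to another factor.\<close>

lemma ttsp_split_first:
  assumes "ttsp G s t" "(s, v, d) \<in> G" "\<And>e b. (s, e, b) \<in> G \<Longrightarrow> (e, b) = (v, d)"
  shows "(d = t \<and> G = {(s, v, d)}) \<or> (ttsp (G - {(s, v, d)}) d t \<and> s \<notin> nodes (G - {(s, v, d)}))"
  using assms
proof (induction rule: ttsp.induct)
  case (ser G s m H t)
  have sH: "s \<notin> nodes H" using ttsp_ser_terminals(1)[OF ser.hyps(1-3)] .
  then have g: "(s, v, d) \<in> G" "(s, v, d) \<notin> H" using ser.prems(1) nodesI[of s v d H] by auto
  have "(d = m \<and> G = {(s, v, d)}) \<or> (ttsp (G - {(s, v, d)}) d m \<and> s \<notin> nodes (G - {(s, v, d)}))"
    by (rule ser.IH(1)[OF g(1)]) (use ser.prems in blast)+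
  then show ?case
  proof
    assume *: "d = m \<and> G = {(s, v, d)}"
    then have "G \<union> H - {(s, v, d)} = H" using g by auto
    then show ?thesis using * ser.hyps sH by simp
  next
    assume *: "ttsp (G - {(s, v, d)}) d m \<and> s \<notin> nodes (G - {(s, v, d)})"
    have e: "G \<union> H - {(s, v, d)} = (G - {(s, v, d)}) \<union> H" using g by auto
    have "ttsp ((G - {(s, v, d)}) \<union> H) d t"
      by (rule ttsp_ser_subset[OF conjunct1[OF *] ser.hyps(2) nodes_Diff order_refl ser.hyps(3)])
    then show ?thesis using e * sH by (simp add: nodes_Un)
  qed
next
  case (par G s t H)
  obtain e1 b1 where 1: "(s, e1, b1) \<in> G"
    using ttsp_ex_out[OF par.hyps(1)] ttsp_terminals[OF par.hyps(1)] by blast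
  obtain e2 b2 where 2: "(s, e2, b2) \<in> H"
    using ttsp_ex_out[OF par.hyps(2)] ttsp_terminals[OF par.hyps(2)] by blast
  from 1 2 par.prems(2)[of e1 b1] par.prems(2)[of e2 b2] par.hyps(4) show ?case by auto
qed auto

text \<open>An inner node of a parallel composition lies on one side, together with all its edges,
  so only a series composition can separate the pair. Freshness of \<open>z\<close> keeps the sides
  of a parallel composition edge-disjoint.\<close>

lemma ttsp_reduce_series:
  assumes "ttsp G s t" "(a, u, b) \<in> G" "(b, v, d) \<in> G"
    and "\<And>a' e. (a', e, b) \<in> G \<Longrightarrow> (a', e) = (a, u)" "\<And>e b'. (b, e, b') \<in> G \<Longrightarrow> (e, b') = (v, d)"
    and "\<And>x y. (x, z, y) \<notin> G"
  shows "ttsp (insert (a, z, d) (G - {(a, u, b), (b, v, d)})) s t"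
  using assms
proof (induction rule: ttsp.induct)
  case (ser G s m H t)
  note G = ser.hyps(1) and H = ser.hyps(2) and n = ser.hyps(3)
  have dj: "G \<inter> H = {}" using ttsp_ser_disjoint[OF G n] by auto
  consider (GG) "(a, u, b) \<in> G" "(b, v, d) \<in> G" | (HH) "(a, u, b) \<in> H" "(b, v, d) \<in> H"
    | (GH) "(a, u, b) \<in> G" "(b, v, d) \<in> H" | (HG) "(a, u, b) \<in> H" "(b, v, d) \<in> G"
    using ser.prems(1,2) by auto
  then show ?case
  proof cases
    case GG
    let ?G = "insert (a, z, d) (G - {(a, u, b), (b, v, d)})"
    have r: "ttsp ?G s m" by (rule ser.IH(1)[OF GG]) (use ser.prems in blast)+
    have ns: "nodes ?G \<subseteq> nodes G" using nodesI[OF GG(1)] nodesI[OF GG(2)] by (auto simp: nodes_insert dest: subsetD[OF nodes_Diff])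
    have "ttsp (?G \<union> H) s t" by (rule ttsp_ser_subset[OF r H ns order_refl n])
    moreover have "?G \<union> H = insert (a, z, d) (G \<union> H - {(a, u, b), (b, v, d)})" using GG dj by blast
    ultimately show ?thesis by simp
  next
    case HH
    let ?G = "insert (a, z, d) (H - {(a, u, b), (b, v, d)})"
    have r: "ttsp ?G m t" by (rule ser.IH(2)[OF HH]) (use ser.prems in blast)+
    have ns: "nodes ?G \<subseteq> nodes H" using nodesI[OF HH(1)] nodesI[OF HH(2)] by (auto simp: nodes_insert dest: subsetD[OF nodes_Diff])
    have "ttsp (G \<union> ?G) s t" by (rule ttsp_ser_subset[OF G r order_refl ns n])
    moreover have "G \<union> ?G = insert (a, z, d) (G \<union> H - {(a, u, b), (b, v, d)})" using HH dj by blast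
    ultimately show ?thesis by simp
  next
    \<comment> \<open>The pair straddles the joint \<open>b = m\<close>: the sink of
      \<open>G\<close> moves along the second edge to \<open>d\<close>, and that edge is peeled off
      the front of \<open>H\<close>.\<close>
    case GH
    then have b: "b = m" using nodesI[OF GH(1)] nodesI[OF GH(2)] n by auto
    let ?G = "insert (a, z, d) (G - {(a, u, b)})"
    have "d \<noteq> m" using ttsp_no_in_source[OF H] GH by auto
    then have dG: "d \<notin> nodes G" using nodesI[OF GH(2)] n by auto
    have r: "ttsp ?G s d" unfolding b
      by (rule ttsp_relabel_sink[OF G]) (use GH b dG ser.prems(3) in auto)
    have nG: "nodes ?G \<subseteq> insert d (nodes G)" using nodesI[OF GH(1)]
        nodes_mono[of "G - {(a, u, b)}" G] by (auto simp: nodes_insert)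
    have "(d = t \<and> H = {(m, v, d)}) \<or> (ttsp (H - {(m, v, d)}) d t \<and> m \<notin> nodes (H - {(m, v, d)}))"
      by (rule ttsp_split_first[OF H]) (use GH b ser.prems(4) in auto)
    then show ?thesis
    proof
      assume *: "d = t \<and> H = {(m, v, d)}"
      then have "insert (a, z, d) (G \<union> H - {(a, u, b), (b, v, d)}) = ?G"
        using b dj GH by auto
      then show ?thesis using r * by simp
    next
      assume *: "ttsp (H - {(m, v, d)}) d t \<and> m \<notin> nodes (H - {(m, v, d)})"
      have "x = d" if x: "x \<in> nodes ?G" "x \<in> nodes (H - {(m, v, d)})" for x
      proof (rule ccontr)
        assume "x \<noteq> d"
        then have "x \<in> nodes G" using x(1) nG by auto
        moreover have "x \<in> nodes H" using x(2) nodes_mono[of "H - {(m, v, d)}" H] by auto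
        ultimately have "x = m" using n by blast
        then show False using x(2) * by simp
      qed
      then have "nodes ?G \<inter> nodes (H - {(m, v, d)}) = {d}"
        using ttsp_terminals[OF r] ttsp_terminals[OF conjunct1[OF *]] by blast
      from ttsp.ser[OF r _ this] * have "ttsp (?G \<union> (H - {(m, v, d)})) s t" by simp
      moreover have "?G \<union> (H - {(m, v, d)}) = insert (a, z, d) (G \<union> H - {(a, u, b), (b, v, d)})"
        using b dj GH by auto
      ultimately show ?thesis by simp
    qed
  next
    case HG
    then have "b = m" using nodesI[OF HG(1)] nodesI[OF HG(2)] n by auto
    then show ?thesis using HG ttsp_no_out_sink[OF G] by simp
  qed
next
  case (par G s t H)
  note G = par.hyps(1) and H = par.hyps(2) and n = par.hyps(3) and dj = par.hyps(4)
  have "b \<noteq> s" "b \<noteq> t"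
    using par.prems(1,2) ttsp_no_in_source[OF G] ttsp_no_in_source[OF H]
      ttsp_no_out_sink[OF G] ttsp_no_out_sink[OF H] by auto
  then have "b \<notin> nodes G \<or> b \<notin> nodes H" using n by auto
  then consider (GG) "(a, u, b) \<in> G" "(b, v, d) \<in> G" | (HH) "(a, u, b) \<in> H" "(b, v, d) \<in> H"
    using par.prems(1,2) nodesI[of a u b] nodesI[of b v d] by blast
  then show ?case
  proof cases
    case GG
    let ?G = "insert (a, z, d) (G - {(a, u, b), (b, v, d)})"
    have r: "ttsp ?G s t" by (rule par.IH(1)[OF GG]) (use par.prems in blast)+
    have ns: "nodes ?G \<subseteq> nodes G" using nodesI[OF GG(1)] nodesI[OF GG(2)] by (auto simp: nodes_insert dest: subsetD[OF nodes_Diff])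
    have "?G \<inter> H = {}" using dj par.prems(5) by auto
    from ttsp_par_subset[OF r H ns n this] have "ttsp (?G \<union> H) s t" .
    moreover have "?G \<union> H = insert (a, z, d) (G \<union> H - {(a, u, b), (b, v, d)})" using GG dj by blast
    ultimately show ?thesis by simp
  next
    case HH
    let ?G = "insert (a, z, d) (H - {(a, u, b), (b, v, d)})"
    have r: "ttsp ?G s t" by (rule par.IH(2)[OF HH]) (use par.prems in blast)+
    have ns: "nodes ?G \<subseteq> nodes H" using nodesI[OF HH(1)] nodesI[OF HH(2)] by (auto simp: nodes_insert dest: subsetD[OF nodes_Diff])
    have "?G \<inter> G = {}" using dj par.prems(5) by auto
    from ttsp_par_subset[OF r G ns _ this] n have "ttsp (?G \<union> G) s t" by (simp add: Int_commute)
    moreover have "?G \<union> G = insert (a, z, d) (G \<union> H - {(a, u, b), (b, v, d)})" using HH dj by blast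
    ultimately show ?thesis by simp
  qed
qed auto

section \<open>Configurations in which no reduction applies\<close>

text \<open>Holds because every node has a path to the sink. It turns in-degree conditions on the
  ancestors of a node into conditions on a whole graph.\<close>

lemma ttsp_ancestors:
  assumes "ttsp G s t" "t \<in> Q" "\<And>a e b. (a, e, b) \<in> G \<Longrightarrow> b \<in> Q \<Longrightarrow> a \<in> Q"
  shows "nodes G \<subseteq> Q"
  using assms
proof (induction rule: ttsp.induct)
  case (ser G s m H t)
  then have "nodes H \<subseteq> Q" by blast
  moreover have "m \<in> nodes H" using ttsp_terminals[OF ser.hyps(2)] by simp
  moreover have "nodes G \<subseteq> Q" by (rule ser.IH(1)) (use calculation ser.prems(2) in blast)+
  ultimately show ?case by (simp add: nodes_Un)
next
  case (par G s t H)
  then show ?case by (metis Un_iff Un_least nodes_Un)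
qed (simp add: nodes_insert)

text \<open>In-degree at most one rules out parallel compositions, whose sink would be entered from
  both sides. Only series compositions remain, so \<open>G\<close> is a path.\<close>

lemma ttsp_path:
  assumes "ttsp G s t"
    and "\<And>a e a' e' b. (a, e, b) \<in> G \<Longrightarrow> (a', e', b) \<in> G \<Longrightarrow> (a, e) = (a', e')"
    and "(x, e, b) \<in> G" "(x, e', b') \<in> G"
  shows "(e, b) = (e', b')"
  using assms
proof (induction rule: ttsp.induct)
  case (ser G s m H t)
  have "\<not> ((x, f, c) \<in> G \<and> (x, f', c') \<in> H)" for f c f' c'
    using ttsp_ser_disjoint[OF ser.hyps(1,3)] by blast
  then consider "(x, e, b) \<in> G" "(x, e', b') \<in> G" | "(x, e, b) \<in> H" "(x, e', b') \<in> H"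
    using ser.prems(2,3) by blast
  then show ?case
  proof cases
    case 1
    then show ?thesis using ser.IH(1) ser.prems(1) by blast
  next
    case 2
    then show ?thesis using ser.IH(2) ser.prems(1) by blast
  qed
next
  case (par G s t H)
  obtain a1 e1 where 1: "(a1, e1, t) \<in> G"
    using ttsp_ex_in[OF par.hyps(1)] ttsp_terminals[OF par.hyps(1)] by blast
  obtain a2 e2 where 2: "(a2, e2, t) \<in> H"
    using ttsp_ex_in[OF par.hyps(2)] ttsp_terminals[OF par.hyps(2)] by blast
  from 1 2 par.prems(1)[of a1 e1 t a2 e2] par.hyps(4) show ?case by auto
qed auto

text \<open>The reason why the reduction never gets stuck.\<close>

lemma ttsp_reducible:
  assumes "ttsp G s t" "(a1, u1, d) \<in> G" "(a2, u2, d) \<in> G" "(a1, u1) \<noteq> (a2, u2)"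
    and "\<And>a e b. (a, e, b) \<in> G \<Longrightarrow> b \<in> insert d P \<Longrightarrow> a \<in> P"
    and "\<And>a e a' e' b. b \<in> P \<Longrightarrow> (a, e, b) \<in> G \<Longrightarrow> (a', e', b) \<in> G \<Longrightarrow> (a, e) = (a', e')"
  shows "(\<exists>a u v. u \<noteq> v \<and> (a, u, d) \<in> G \<and> (a, v, d) \<in> G) \<or>
    (\<exists>a u. a \<noteq> s \<and> (a, u, d) \<in> G \<and> (\<forall>e b. (a, e, b) \<in> G \<longrightarrow> (e, b) = (u, d)))"
  using assms
proof (induction arbitrary: a1 u1 a2 u2 rule: ttsp.induct)
  case (ser G s m H t)
  note G = ser.hyps(1) and H = ser.hyps(2) and n = ser.hyps(3)
  \<comment> \<open>If both factors had edges into \<open>d\<close>, it would be \<open>m\<close>,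
    which no edge of \<open>H\<close> enters.\<close>
  have "\<not> ((a, f, d) \<in> G \<and> (a', f', d) \<in> H)" for a f a' f'
    using nodesI[of a f d G] nodesI[of a' f' d H] n ttsp_no_in_source[OF H, of a' f'] by auto
  then consider (G) "(a1, u1, d) \<in> G" "(a2, u2, d) \<in> G" | (H) "(a1, u1, d) \<in> H" "(a2, u2, d) \<in> H"
    using ser.prems(1,2) by blast
  then show ?case
  proof cases
    case G
    have "(\<exists>a u v. u \<noteq> v \<and> (a, u, d) \<in> G \<and> (a, v, d) \<in> G) \<or>
      (\<exists>a u. a \<noteq> s \<and> (a, u, d) \<in> G \<and> (\<forall>e b. (a, e, b) \<in> G \<longrightarrow> (e, b) = (u, d)))"
      by (rule ser.IH(1)[OF G]) (use ser.prems in blast)+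
    moreover have "a \<notin> nodes H" if "(a, u, d) \<in> G" for a u
      using nodesI[OF that] n ttsp_no_out_sink[OF ser.hyps(1), of u d] that by auto
    ultimately show ?thesis using nodesI(1)[of _ _ _ H] by blast
  next
    case H
    have "(\<exists>a u v. u \<noteq> v \<and> (a, u, d) \<in> H \<and> (a, v, d) \<in> H) \<or>
      (\<exists>a u. a \<noteq> m \<and> (a, u, d) \<in> H \<and> (\<forall>e b. (a, e, b) \<in> H \<longrightarrow> (e, b) = (u, d)))"
      by (rule ser.IH(2)[OF H]) (use ser.prems in blast)+
    moreover have "a \<noteq> s \<and> (a, e, b) \<notin> G" if "(a, u, d) \<in> H" "a \<noteq> m" for a u e b
      using nodesI(1)[OF that(1)] n that(2) ttsp_terminals[OF ser.hyps(1)] nodesI(1)[of a e b G] by blast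
    ultimately show ?thesis by (elim disjE) (blast, metis UnE UnI2)
  qed
next
  case (par G s t H)
  note G = par.hyps(1) and H = par.hyps(2) and n = par.hyps(3) and dj = par.hyps(4)
  \<comment> \<open>A predecessor of \<open>d\<close> other than \<open>s\<close> is an inner node
    of its side, so out-degree one there is out-degree one in the whole graph.\<close>
  have lift: ?case
    if AB: "G \<union> H = A \<union> B" "nodes A \<inter> nodes B = {s, t}" "ttsp A s t"
      and IH: "(\<exists>a u v. u \<noteq> v \<and> (a, u, d) \<in> A \<and> (a, v, d) \<in> A) \<or>
        (\<exists>a u. a \<noteq> s \<and> (a, u, d) \<in> A \<and> (\<forall>e b. (a, e, b) \<in> A \<longrightarrow> (e, b) = (u, d)))" for A B
  proof -
    have "a \<notin> nodes B" if "(a, u, d) \<in> A" "a \<noteq> s" for a u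
      using nodesI[OF that(1)] AB(2) that ttsp_no_out_sink[OF AB(3), of u d] by auto
    then show ?thesis using IH nodesI(1)[of _ _ _ B] unfolding AB(1) by blast
  qed
  have liftG: ?case if "(a, u, d) \<in> G" "(a', u', d) \<in> G" "(a, u) \<noteq> (a', u')" for a u a' u'
  proof (rule lift[OF refl n G])
    show "(\<exists>a u v. u \<noteq> v \<and> (a, u, d) \<in> G \<and> (a, v, d) \<in> G) \<or>
        (\<exists>a u. a \<noteq> s \<and> (a, u, d) \<in> G \<and> (\<forall>e b. (a, e, b) \<in> G \<longrightarrow> (e, b) = (u, d)))"
      by (rule par.IH(1)[OF that]) (use par.prems in blast)+
  qed
  have liftH: ?case if "(a, u, d) \<in> H" "(a', u', d) \<in> H" "(a, u) \<noteq> (a', u')" for a u a' u'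
  proof (rule lift[OF Un_commute _ H])
    show "nodes H \<inter> nodes G = {s, t}" using n by auto
    show "(\<exists>a u v. u \<noteq> v \<and> (a, u, d) \<in> H \<and> (a, v, d) \<in> H) \<or>
        (\<exists>a u. a \<noteq> s \<and> (a, u, d) \<in> H \<and> (\<forall>e b. (a, e, b) \<in> H \<longrightarrow> (e, b) = (u, d)))"
      by (rule par.IH(2)[OF that]) (use par.prems in blast)+
  qed
  \<comment> \<open>Entered from both sides, \<open>d\<close> must be \<open>t\<close>. If each side
    contributes only one edge, all in-degrees there are at most one and each side is a path. Either
    some last edge leaves an inner node, which then has out-degree one, or both last edges leave
    \<open>s\<close> and are parallel.\<close>
  have cross: ?case if g: "(a, u, d) \<in> G" and h: "(a', u', d) \<in> H" for a u a' u'
  proof (cases "(\<exists>a' u'. (a', u', d) \<in> G \<and> (a', u') \<noteq> (a, u)) \<or> (\<exists>a u. (a, u, d) \<in> H \<and> (a, u) \<noteq> (a', u'))")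
    case True
    then show ?thesis using liftG liftH g h by blast
  next
    case False
    then have uG: "\<And>x y. (x, y, d) \<in> G \<Longrightarrow> (x, y) = (a, u)"
      and uH: "\<And>x y. (x, y, d) \<in> H \<Longrightarrow> (x, y) = (a', u')" by blast+
    have "d \<in> {s, t}" using nodesI[OF g] nodesI[OF h] n by auto
    then have d: "d = t" using g ttsp_no_in_source[OF G] by auto
    have path: "(e, b) = (e', b')"
      if A: "ttsp A s t" "A \<subseteq> G \<union> H" "(x, e, b) \<in> A" "(x, e', b') \<in> A"
        and u: "\<And>a u a' u'. (a, u, d) \<in> A \<Longrightarrow> (a', u', d) \<in> A \<Longrightarrow> (a, u) = (a', u')" for A x e b e' b'
    proof -
      \<comment> \<open>The premises control in-degrees on \<open>P\<close> only; as all nodes of a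
        side are ancestors of its sink \<open>d\<close>, this covers the whole side.\<close>
      have P: "nodes A \<subseteq> insert d P"
        by (rule ttsp_ancestors[OF A(1)]) (use d par.prems(4) A(2) in blast)+
      show ?thesis
      proof (rule ttsp_path[OF A(1) _ A(3,4)])
        fix a e a' e' b assume *: "(a, e, b) \<in> A" "(a', e', b) \<in> A"
        then have "b = d \<or> b \<in> P" using P nodesI(2)[of a e b A] by auto
        then show "(a, e) = (a', e')" using u * par.prems(5) A(2) by blast
      qed
    qed
    consider "a \<noteq> s" | "a' \<noteq> s" | "a = s" "a' = s" by blast
    then show ?thesis
    proof cases
      case 1
      have "\<forall>e b. (a, e, b) \<in> G \<longrightarrow> (e, b) = (u, d)"
        by (intro allI impI, rule path[OF G _ _ g]) (use uG in auto)
      with 1 g show ?thesis by (intro lift[OF refl n G]) blast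
    next
      case 2
      have "\<forall>e b. (a', e, b) \<in> H \<longrightarrow> (e, b) = (u', d)"
        by (intro allI impI, rule path[OF H _ _ h]) (use uH in auto)
      with 2 h n show ?thesis by (intro lift[OF Un_commute _ H]) blast+
    next
      case 3
      have "u \<noteq> u'" using g h dj 3 by auto
      then show ?thesis using g h 3 by blast
    qed
  qed
  consider "(a1, u1, d) \<in> G" "(a2, u2, d) \<in> G" | "(a1, u1, d) \<in> H" "(a2, u2, d) \<in> H"
    | "(a1, u1, d) \<in> G" "(a2, u2, d) \<in> H" | "(a2, u2, d) \<in> G" "(a1, u1, d) \<in> H"
    using par.prems(1,2) by auto
  then show ?case
  proof cases
    case 1 then show ?thesis using liftG par.prems(3) by simp
  next
    case 2 then show ?thesis using liftH par.prems(3) by simp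
  qed (erule (1) cross)+
qed auto

section \<open>The line digraph inverse of a minimal series-parallel digraph\<close>

lemma msp_wellformed:
  "msp_digraph G \<Longrightarrow> finite (pverts G) \<and> pverts G \<noteq> {} \<and> parcs G \<subseteq> pverts G \<times> pverts G"
  by (induction rule: msp_digraph.induct)
    (auto simp: parallel_comp_def series_comp_def sources_def sinks_def)

lemma msp_finite_arcs: "msp_digraph G \<Longrightarrow> finite (parcs G)"
  using msp_wellformed[of G] by (meson finite_SigmaI finite_subset)

lemma mem_sources_iff:
  "finite (parcs G) \<Longrightarrow> v \<in> sources G \<longleftrightarrow> v \<in> pverts G \<and> (\<forall>u. (u, v) \<notin> parcs G)"
proof -
  assume "finite (parcs G)"
  moreover have "in_arcs (with_proj G) v \<subseteq> parcs G" by (auto simp: in_arcs_def)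
  ultimately have "finite (in_arcs (with_proj G) v)" by (rule rev_finite_subset)
  then show ?thesis by (auto simp: sources_def in_degree_def in_arcs_def)
qed

lemma mem_sinks_iff:
  "finite (parcs G) \<Longrightarrow> u \<in> sinks G \<longleftrightarrow> u \<in> pverts G \<and> (\<forall>v. (u, v) \<notin> parcs G)"
proof -
  assume "finite (parcs G)"
  moreover have "out_arcs (with_proj G) u \<subseteq> parcs G" by (auto simp: out_arcs_def)
  ultimately have "finite (out_arcs (with_proj G) u)" by (rule rev_finite_subset)
  then show ?thesis by (auto simp: sinks_def out_degree_def out_arcs_def)
qed

lemmas msp_sources_iff = mem_sources_iff[OF msp_finite_arcs]
lemmas msp_sinks_iff = mem_sinks_iff[OF msp_finite_arcs]

lemma sources_parallel_comp:
  assumes "msp_digraph G" "msp_digraph H" "pverts G \<inter> pverts H = {}"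
  shows "sources (parallel_comp G H) = sources G \<union> sources H"
    and "sinks (parallel_comp G H) = sinks G \<union> sinks H"
  using assms msp_wellformed[OF assms(1)] msp_wellformed[OF assms(2)]
  by (auto simp: msp_sources_iff msp_sinks_iff msp_digraph.parallel) (auto simp: parallel_comp_def)

lemma sources_sinks_nonempty: "msp_digraph G \<Longrightarrow> sources G \<noteq> {} \<and> sinks G \<noteq> {}"
proof (induction rule: msp_digraph.induct)
  case (single v)
  then show ?case by (auto simp: msp_sources_iff msp_sinks_iff msp_digraph.single)
next
  case (parallel G H)
  then show ?case by (simp add: sources_parallel_comp)
next
  case (series G H)
  obtain u where u: "u \<in> sources G" using series.IH by auto
  obtain v where v: "v \<in> sinks H" using series.IH by auto
  have "u \<in> sources (series_comp G H)"
    using u series.hyps msp_wellformed[OF series.hyps(2)]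
    by (auto simp: msp_sources_iff msp_digraph.series) (auto simp: series_comp_def msp_sources_iff)
  moreover have "v \<in> sinks (series_comp G H)"
    using v series.hyps msp_wellformed[OF series.hyps(1)]
    by (auto simp: msp_sinks_iff msp_digraph.series) (auto simp: series_comp_def msp_sinks_iff)
  ultimately show ?case by blast
qed

lemma series_comp_arc_cases:
  assumes "msp_digraph G" "msp_digraph H" "pverts G \<inter> pverts H = {}"
  shows "u \<in> pverts G \<Longrightarrow> v \<in> pverts G \<Longrightarrow> (u, v) \<in> parcs (series_comp G H) \<longleftrightarrow> (u, v) \<in> parcs G"
    and "u \<in> pverts H \<Longrightarrow> v \<in> pverts H \<Longrightarrow> (u, v) \<in> parcs (series_comp G H) \<longleftrightarrow> (u, v) \<in> parcs H"
    and "u \<in> pverts G \<Longrightarrow> v \<in> pverts H \<Longrightarrow> (u, v) \<in> parcs (series_comp G H) \<longleftrightarrow> u \<in> sinks G \<and> v \<in> sources H"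
    and "u \<in> pverts H \<Longrightarrow> v \<in> pverts G \<Longrightarrow> (u, v) \<notin> parcs (series_comp G H)"
  using assms msp_wellformed[OF assms(1)] msp_wellformed[OF assms(2)]
  by (auto simp: series_comp_def msp_sources_iff msp_sinks_iff)

lemma parallel_comp_arc_cases:
  assumes "msp_digraph G" "msp_digraph H" "pverts G \<inter> pverts H = {}"
  shows "u \<in> pverts G \<Longrightarrow> v \<in> pverts G \<Longrightarrow> (u, v) \<in> parcs (parallel_comp G H) \<longleftrightarrow> (u, v) \<in> parcs G"
    and "u \<in> pverts H \<Longrightarrow> v \<in> pverts H \<Longrightarrow> (u, v) \<in> parcs (parallel_comp G H) \<longleftrightarrow> (u, v) \<in> parcs H"
    and "u \<in> pverts G \<Longrightarrow> v \<in> pverts H \<Longrightarrow> (u, v) \<notin> parcs (parallel_comp G H)"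
    and "u \<in> pverts H \<Longrightarrow> v \<in> pverts G \<Longrightarrow> (u, v) \<notin> parcs (parallel_comp G H)"
  using assms msp_wellformed[OF assms(1)] msp_wellformed[OF assms(2)]
  by (auto simp: parallel_comp_def)

lemma pverts_comp [simp]:
  "pverts (series_comp G H) = pverts G \<union> pverts H"
  "pverts (parallel_comp G H) = pverts G \<union> pverts H"
  by (auto simp: series_comp_def parallel_comp_def)

lemma sinks_series_comp:
  assumes "msp_digraph G" "msp_digraph H" "pverts G \<inter> pverts H = {}"
  shows "sinks (series_comp G H) = sinks H" and "sources (series_comp G H) = sources G"
proof -
  obtain v where v: "v \<in> sources H" using sources_sinks_nonempty[OF assms(2)] by blast
  obtain u where u: "u \<in> sinks G" using sources_sinks_nonempty[OF assms(1)] by blast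
  note s = msp_digraph.series[OF assms] assms(1,2)
  note arcs = series_comp_arc_cases[OF assms]
  note wf = msp_wellformed[OF msp_digraph.series[OF assms]]
  have vH: "v \<in> pverts H" and uG: "u \<in> pverts G" using u v by (auto simp: sources_def sinks_def)
  have "x \<in> sinks (series_comp G H) \<longleftrightarrow> x \<in> sinks H" for x
  proof (cases "x \<in> pverts G")
    case True
    then have "x \<notin> sinks H" using assms(3) by (auto simp: sinks_def)
    moreover have "\<exists>y. (x, y) \<in> parcs (series_comp G H)"
    proof (cases "x \<in> sinks G")
      case True
      then show ?thesis using arcs(3)[of x v] v vH \<open>x \<in> pverts G\<close> by blast
    next
      case False
      then show ?thesis using \<open>x \<in> pverts G\<close> assms(1) by (auto simp: msp_sinks_iff series_comp_def)
    qed
    ultimately show ?thesis using msp_sinks_iff[OF s(1)] by blast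
  next
    case False
    then show ?thesis using s arcs(2)[of x] arcs(4)[of x] wf by (auto simp: msp_sinks_iff) (auto simp: series_comp_def)
  qed
  then show "sinks (series_comp G H) = sinks H" by blast
  have "x \<in> sources (series_comp G H) \<longleftrightarrow> x \<in> sources G" for x
  proof (cases "x \<in> pverts H")
    case True
    then have "x \<notin> sources G" using assms(3) by (auto simp: sources_def)
    moreover have "\<exists>y. (y, x) \<in> parcs (series_comp G H)"
    proof (cases "x \<in> sources H")
      case True
      then show ?thesis using arcs(3)[of u x] u uG \<open>x \<in> pverts H\<close> by blast
    next
      case False
      then show ?thesis using \<open>x \<in> pverts H\<close> assms(2) by (auto simp: msp_sources_iff series_comp_def)
    qed
    ultimately show ?thesis using msp_sources_iff[OF s(1)] by blast
  next
    case False
    then show ?thesis using s arcs(1)[of _ x] arcs(4)[of _ x] wf by (auto simp: msp_sources_iff) (auto simp: series_comp_def)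
  qed
  then show "sources (series_comp G H) = sources G" by blast
qed

text \<open>The characteristic property of line digraphs: out-neighbourhoods are equal or disjoint.
  A series composition respects it because its new arcs form one complete block, from vertices that
  had no out-arcs to vertices that had no in-arcs.\<close>

lemma msp_out_nbrs:
  "msp_digraph G \<Longrightarrow> (u, v) \<in> parcs G \<Longrightarrow> (u', v) \<in> parcs G \<Longrightarrow> (u, w) \<in> parcs G \<Longrightarrow> (u', w) \<in> parcs G"
proof (induction rule: msp_digraph.induct)
  case (single v)
  then show ?case by simp
next
  case (parallel G H)
  then show ?case using msp_wellformed[OF parallel.hyps(1)] msp_wellformed[OF parallel.hyps(2)]
    by (auto simp: parallel_comp_def)
next
  case (series G H)
  have "sinks G \<subseteq> pverts G" "sources H \<subseteq> pverts H" by (auto simp: sinks_def sources_def)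
  moreover have "(x, y) \<notin> parcs G" if "x \<in> sinks G" for x y
    using that series.hyps by (simp add: msp_sinks_iff)
  moreover have "(x, y) \<notin> parcs H" if "y \<in> sources H" for x y
    using that series.hyps by (simp add: msp_sources_iff)
  moreover note w = msp_wellformed[OF series.hyps(1)] msp_wellformed[OF series.hyps(2)] series.hyps(3)
  ultimately show ?case using series.prems series.IH unfolding series_comp_def by auto
qed

text \<open>Node names enter through arbitrary maps for the tail and the head of an item, tied to
  the digraph only by equivalences. So the induction passes to a component by exchanging the
  terminals, without renaming any node.\<close>

lemma msp_ttsp:
  assumes "msp_digraph G" "s \<noteq> t"
    and "\<And>u v. u \<in> pverts G \<Longrightarrow> v \<in> pverts G \<Longrightarrow> hn u = tn v \<longleftrightarrow> (u, v) \<in> parcs G"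
    and "\<And>u. u \<in> pverts G \<Longrightarrow> hn u = t \<longleftrightarrow> u \<in> sinks G"
    and "\<And>u. u \<in> pverts G \<Longrightarrow> tn u = s \<longleftrightarrow> u \<in> sources G"
    and "\<And>u. u \<in> pverts G \<Longrightarrow> hn u \<noteq> s \<and> tn u \<noteq> t"
  shows "ttsp ((\<lambda>v. (tn v, v, hn v)) ` pverts G) s t"
  using assms
proof (induction arbitrary: s t rule: msp_digraph.induct)
  case (single v)
  have "v \<in> sinks \<lparr>pverts = {v}, parcs = {}\<rparr>" "v \<in> sources \<lparr>pverts = {v}, parcs = {}\<rparr>"
    by (auto simp: mem_sinks_iff mem_sources_iff)
  then show ?case using single.prems ttsp.edge[of s t v] by simp
next
  case (parallel G H)
  note hyps = parallel.hyps
  note arcs = parallel_comp_arc_cases[OF hyps]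
  note src = sources_parallel_comp[OF hyps]
  have sub: "sources G \<subseteq> pverts G" "sinks G \<subseteq> pverts G" "sources H \<subseteq> pverts H" "sinks H \<subseteq> pverts H"
    by (auto simp: sources_def sinks_def)
  have arc: "hn u = tn v \<longleftrightarrow> (u, v) \<in> parcs (parallel_comp G H)"
    if "u \<in> pverts G \<union> pverts H" "v \<in> pverts G \<union> pverts H" for u v
    using that parallel.prems(2) by simp
  let ?f = "\<lambda>v. (tn v, v, hn v)"
  have 1: "ttsp (?f ` pverts G) s t"
  proof (rule parallel.IH(1)[OF parallel.prems(1)])
    show "hn u = tn v \<longleftrightarrow> (u, v) \<in> parcs G" if "u \<in> pverts G" "v \<in> pverts G" for u v
      using arc[of u v] that arcs by simp
    show "hn u = t \<longleftrightarrow> u \<in> sinks G" if "u \<in> pverts G" for u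
      using parallel.prems(3)[of u] that src(2) sub(4) hyps(3) by auto
    show "tn u = s \<longleftrightarrow> u \<in> sources G" if "u \<in> pverts G" for u
      using parallel.prems(4)[of u] that src(1) sub(3) hyps(3) by auto
    show "hn u \<noteq> s \<and> tn u \<noteq> t" if "u \<in> pverts G" for u using parallel.prems(5)[of u] that by simp
  qed
  have 2: "ttsp (?f ` pverts H) s t"
  proof (rule parallel.IH(2)[OF parallel.prems(1)])
    show "hn u = tn v \<longleftrightarrow> (u, v) \<in> parcs H" if "u \<in> pverts H" "v \<in> pverts H" for u v
      using arc[of u v] that arcs by simp
    show "hn u = t \<longleftrightarrow> u \<in> sinks H" if "u \<in> pverts H" for u
      using parallel.prems(3)[of u] that src(2) sub(2) hyps(3) by auto
    show "tn u = s \<longleftrightarrow> u \<in> sources H" if "u \<in> pverts H" for u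
      using parallel.prems(4)[of u] that src(1) sub(1) hyps(3) by auto
    show "hn u \<noteq> s \<and> tn u \<noteq> t" if "u \<in> pverts H" for u using parallel.prems(5)[of u] that by simp
  qed
  \<comment> \<open>There are no arcs between the sides, so a common node is the tail of an item on
    each side or the head of one on each. Were it not a terminal, some item of \<open>H\<close>
    would end or start there and be adjacent to an item of \<open>G\<close>.\<close>
  have "x \<in> {s, t}" if x: "x \<in> nodes (?f ` pverts G)" "x \<in> nodes (?f ` pverts H)" for x
  proof -
    obtain a where a: "a \<in> pverts G" "x = tn a \<or> x = hn a" using x(1) by (auto simp: nodes_def)
    obtain b where b: "b \<in> pverts H" "x = tn b \<or> x = hn b" using x(2) by (auto simp: nodes_def)
    have no: "hn a' \<noteq> tn b'" "hn b' \<noteq> tn a'" if "a' \<in> pverts G" "b' \<in> pverts H" for a' b'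
      using arc[of a' b'] arc[of b' a'] arcs(3)[of a' b'] arcs(4)[of b' a'] that by auto
    consider "x = tn a" "x = tn b" | "x = hn a" "x = hn b"
      using a(2) b(2) no[OF a(1) b(1)] by metis
    then show ?thesis
    proof cases
      case 1
      have "b \<in> sources H"
      proof (rule ccontr)
        assume "b \<notin> sources H"
        then obtain b' where b': "(b', b) \<in> parcs H" using b hyps by (auto simp: msp_sources_iff)
        then have "b' \<in> pverts H" using msp_wellformed[OF hyps(2)] by auto
        then show False using arc[of b' b] arcs(2)[of b' b] b' b no[OF a(1), of b'] 1 by auto
      qed
      then show ?thesis using parallel.prems(4)[of b] b src 1 by simp
    next
      case 2
      have "b \<in> sinks H"
      proof (rule ccontr)
        assume "b \<notin> sinks H"
        then obtain b' where b': "(b, b') \<in> parcs H" using b hyps by (auto simp: msp_sinks_iff)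
        then have "b' \<in> pverts H" using msp_wellformed[OF hyps(2)] by auto
        then show False using arc[of b b'] arcs(2)[of b b'] b' b no[OF a(1), of b'] 2 by auto
      qed
      then show ?thesis using parallel.prems(3)[of b] b src 2 by simp
    qed
  qed
  then have "nodes (?f ` pverts G) \<inter> nodes (?f ` pverts H) = {s, t}"
    using ttsp_terminals[OF 1] ttsp_terminals[OF 2] by blast
  from ttsp.par[OF 1 2 this] show ?case using hyps(3) by (auto simp: image_Un)
next
  case (series G H)
  note hyps = series.hyps
  note arcs = series_comp_arc_cases[OF hyps]
  note src = sinks_series_comp[OF hyps]
  have sub: "sources G \<subseteq> pverts G" "sinks G \<subseteq> pverts G" "sources H \<subseteq> pverts H" "sinks H \<subseteq> pverts H"
    by (auto simp: sources_def sinks_def)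
  have arc: "hn u = tn v \<longleftrightarrow> (u, v) \<in> parcs (series_comp G H)"
    if "u \<in> pverts G \<union> pverts H" "v \<in> pverts G \<union> pverts H" for u v
    using that series.prems(2) by simp
  let ?f = "\<lambda>v. (tn v, v, hn v)"
  obtain u0 where u0: "u0 \<in> sinks G" using sources_sinks_nonempty[OF hyps(1)] by blast
  obtain v0 where v0: "v0 \<in> sources H" using sources_sinks_nonempty[OF hyps(2)] by blast
  have uv: "u0 \<in> pverts G" "v0 \<in> pverts H" using u0 v0 sub by auto
  \<comment> \<open>All sinks of \<open>G\<close> have the same head, which is the tail of all
    sources of \<open>H\<close>, because they are joined by arcs. This common name is the
    joint.\<close>
  define m where "m = hn u0"
  have mI: "tn v = m \<longleftrightarrow> v \<in> sources H" if "v \<in> pverts H" for v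
    using arc[of u0 v] arcs(3)[of u0 v] u0 uv that by (auto simp: m_def)
  have mv: "tn v0 = m" using mI v0 uv by simp
  have mO: "hn u = m \<longleftrightarrow> u \<in> sinks G" if "u \<in> pverts G" for u
    using arc[of u v0] arcs(3)[of u v0] v0 uv that mv by auto
  have tm: "tn u \<noteq> m" if "u \<in> pverts G" for u
    using arc[of u0 u] arcs(1)[of u0 u] u0 uv that hyps(1) by (auto simp: m_def msp_sinks_iff)
  have hm: "hn u \<noteq> m" if "u \<in> pverts H" for u
    using arc[of u v0] arcs(2)[of u v0] v0 uv that hyps(2) mv by (auto simp: msp_sources_iff)
  have sm: "s \<noteq> m" using series.prems(5)[of u0] uv by (auto simp: m_def)
  have mt: "m \<noteq> t" using series.prems(5)[of v0] uv mv by auto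
  have 1: "ttsp (?f ` pverts G) s m"
  proof (rule series.IH(1)[OF sm])
    show "hn u = tn v \<longleftrightarrow> (u, v) \<in> parcs G" if "u \<in> pverts G" "v \<in> pverts G" for u v
      using arc[of u v] that arcs by simp
    show "hn u = m \<longleftrightarrow> u \<in> sinks G" if "u \<in> pverts G" for u using mO that .
    show "tn u = s \<longleftrightarrow> u \<in> sources G" if "u \<in> pverts G" for u
      using series.prems(4)[of u] that src by simp
    show "hn u \<noteq> s \<and> tn u \<noteq> m" if "u \<in> pverts G" for u using series.prems(5)[of u] that tm by simp
  qed
  have 2: "ttsp (?f ` pverts H) m t"
  proof (rule series.IH(2)[OF mt])
    show "hn u = tn v \<longleftrightarrow> (u, v) \<in> parcs H" if "u \<in> pverts H" "v \<in> pverts H" for u v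
      using arc[of u v] that arcs by simp
    show "hn u = t \<longleftrightarrow> u \<in> sinks H" if "u \<in> pverts H" for u
      using series.prems(3)[of u] that src by simp
    show "tn u = m \<longleftrightarrow> u \<in> sources H" if "u \<in> pverts H" for u using mI that .
    show "hn u \<noteq> m \<and> tn u \<noteq> t" if "u \<in> pverts H" for u using series.prems(5)[of u] that hm by simp
  qed
  \<comment> \<open>No head in \<open>H\<close> is a tail in \<open>G\<close>. So a common node is a
    tail on both sides, a head on both, or a head in \<open>G\<close> and a tail in
    \<open>H\<close>; in each case the arcs leave only \<open>m\<close>.\<close>
  have "x = m" if x: "x \<in> nodes (?f ` pverts G)" "x \<in> nodes (?f ` pverts H)" for x
  proof -
    obtain a where a: "a \<in> pverts G" "x = tn a \<or> x = hn a" using x(1) by (auto simp: nodes_def)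
    obtain b where b: "b \<in> pverts H" "x = tn b \<or> x = hn b" using x(2) by (auto simp: nodes_def)
    have no: "hn b' \<noteq> tn a'" if "a' \<in> pverts G" "b' \<in> pverts H" for a' b'
      using arc[of b' a'] arcs(4)[of b' a'] that by auto
    have yes: "hn a' = m" if "hn a' = tn b'" "a' \<in> pverts G" "b' \<in> pverts H" for a' b'
      using arc[of a' b'] arcs(3)[of a' b'] that mO by (metis UnCI)
    consider "x = tn a" "x = tn b" | "x = hn a" "x = hn b" | "x = hn a" "x = tn b"
      using a(2) b(2) no[OF a(1) b(1)] by metis
    then show ?thesis
    proof cases
      case 1
      then have "b \<notin> sources H" using mI tm a(1) b(1) by metis
      then obtain b' where b': "(b', b) \<in> parcs H" using b hyps by (auto simp: msp_sources_iff)
      then have "b' \<in> pverts H" using msp_wellformed[OF hyps(2)] by auto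
      then show ?thesis using arc[of b' b] arcs(2)[of b' b] b' b no[OF a(1), of b'] 1 by auto
    next
      case 2
      have "a \<notin> sinks (series_comp G H)" using a src sub hyps(3) by auto
      then have "b \<notin> sinks H" using series.prems(3)[of a] series.prems(3)[of b] a b src 2 by auto
      then obtain b' where b': "(b, b') \<in> parcs H" using b hyps by (auto simp: msp_sinks_iff)
      then have "b' \<in> pverts H" using msp_wellformed[OF hyps(2)] by auto
      then show ?thesis using arc[of b b'] arcs(2)[of b b'] b' b yes[of a b'] a 2 by auto
    next
      case 3
      then show ?thesis using yes a b by metis
    qed
  qed
  then have "nodes (?f ` pverts G) \<inter> nodes (?f ` pverts H) = {m}"
    using ttsp_terminals[OF 1] ttsp_terminals[OF 2] by blast
  from ttsp.ser[OF 1 2 this] show ?case by (simp add: image_Un)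
qed

section \<open>Decomposition trees\<close>

datatype sptree = Leaf nat | Node bool sptree sptree

primrec leaves :: "sptree \<Rightarrow> nat set" where
  "leaves (Leaf j) = {j}"
| "leaves (Node b T U) = leaves T \<union> leaves U"

text \<open>The feasible parts of a component; \<open>b\<close> marks a series composition.\<close>

primrec fam :: "sptree \<Rightarrow> nat set set" where
  "fam (Leaf j) = {{}, {j}}"
| "fam (Node b T U) = {X \<union> Y |X Y. X \<in> fam T \<and> Y \<in> fam U \<and> (b \<longrightarrow> X = {} \<or> Y = leaves U)}"

primrec disjoint_tree :: "sptree \<Rightarrow> bool" where
  "disjoint_tree (Leaf j) = True"
| "disjoint_tree (Node b T U) = (leaves T \<inter> leaves U = {} \<and> disjoint_tree T \<and> disjoint_tree U)"

lemma leaves_nonempty [simp]: "leaves T \<noteq> {}"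
  by (induction T) auto

lemma finite_leaves [simp]: "finite (leaves T)"
  by (induction T) auto

lemma fam_subset: "X \<in> fam T \<Longrightarrow> X \<subseteq> leaves T"
  by (induction T arbitrary: X) fastforce+

text \<open>Disjoint leaves make the split of a set into its two parts unique: the parts are its
  intersections with the leaves.\<close>

lemma mem_fam_Node_iff:
  assumes "leaves T \<inter> leaves U = {}"
  shows "X \<inter> leaves (Node b T U) \<in> fam (Node b T U) \<longleftrightarrow>
    X \<inter> leaves T \<in> fam T \<and> X \<inter> leaves U \<in> fam U \<and> (b \<longrightarrow> X \<inter> leaves T = {} \<or> leaves U \<subseteq> X)"
    (is "?l = ?r")
proof
  assume ?l
  then obtain A B where AB: "X \<inter> (leaves T \<union> leaves U) = A \<union> B" "A \<in> fam T" "B \<in> fam U"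
    "b \<longrightarrow> A = {} \<or> B = leaves U" by auto
  then have "X \<inter> leaves T = A" "X \<inter> leaves U = B"
    using assms fam_subset[OF AB(2)] fam_subset[OF AB(3)] by blast+
  then show ?r using AB by auto
next
  assume r: ?r
  show ?l unfolding fam.simps mem_Collect_eq
    by (rule exI[of _ "X \<inter> leaves T"], rule exI[of _ "X \<inter> leaves U"]) (use r in auto)
qed

text \<open>A multigraph whose edges carry decomposition trees describes those item sets whose
  restriction to each edge is feasible there, and which contain all of an edge as soon as they
  meet an edge entering its tail.\<close>

definition obeys :: "(nat \<times> 'e \<times> nat) set \<Rightarrow> ('e \<Rightarrow> sptree) \<Rightarrow> nat set \<Rightarrow> bool" where
  "obeys G tr X \<longleftrightarrow> (\<forall>(a, v, b) \<in> G. X \<inter> leaves (tr v) \<in> fam (tr v)) \<and>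
    (\<forall>x. (\<exists>a v. (a, v, x) \<in> G \<and> X \<inter> leaves (tr v) \<noteq> {}) \<longrightarrow> (\<forall>v b. (x, v, b) \<in> G \<longrightarrow> leaves (tr v) \<subseteq> X))"

text \<open>The two edges have the same ends, so the conditions at nodes depend only on the union of
  their leaves.\<close>

lemma obeys_reduce_parallel:
  assumes "(a, u, b) \<in> G" "(a, v, b) \<in> G" "leaves (tr u) \<inter> leaves (tr v) = {}"
    and z: "tr z = Node False (tr u) (tr v)"
  shows "obeys (insert (a, z, b) (G - {(a, u, b), (a, v, b)})) tr X \<longleftrightarrow> obeys G tr X"
proof -
  let ?G = "insert (a, z, b) (G - {(a, u, b), (a, v, b)})"
  note zf = mem_fam_Node_iff[OF assms(3), of X False, folded z, simplified]
  have zl: "leaves (tr z) = leaves (tr u) \<union> leaves (tr v)" by (simp add: z)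
  have "(\<exists>a v. (a, v, x) \<in> ?G \<and> X \<inter> leaves (tr v) \<noteq> {}) \<longleftrightarrow> (\<exists>a v. (a, v, x) \<in> G \<and> X \<inter> leaves (tr v) \<noteq> {})"
    (is "?l \<longleftrightarrow> ?r") for x
  proof
    assume ?l
    then obtain a' v' where *: "(a', v', x) \<in> ?G" "X \<inter> leaves (tr v') \<noteq> {}" by blast
    show ?r
    proof (cases "(a', v', x) = (a, z, b)")
      case True
      then have "X \<inter> leaves (tr u) \<noteq> {} \<or> X \<inter> leaves (tr v) \<noteq> {}" using *(2) zl by auto
      then show ?thesis using assms(1,2) True by blast
    next
      case False
      then show ?thesis using * by blast
    qed
  next
    assume ?r
    then obtain a' v' where *: "(a', v', x) \<in> G" "X \<inter> leaves (tr v') \<noteq> {}" by blast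
    show ?l
    proof (cases "(a', v', x) \<in> {(a, u, b), (a, v, b)}")
      case True
      then have "X \<inter> leaves (tr z) \<noteq> {}" "x = b" using *(2) zl by auto
      then show ?thesis by blast
    next
      case False
      then show ?thesis using * by blast
    qed
  qed
  moreover have "(\<forall>v b. (x, v, b) \<in> ?G \<longrightarrow> leaves (tr v) \<subseteq> X) \<longleftrightarrow> (\<forall>v b. (x, v, b) \<in> G \<longrightarrow> leaves (tr v) \<subseteq> X)"
    (is "?l \<longleftrightarrow> ?r") for x
  proof
    assume l: ?l
    show ?r
    proof (intro allI impI)
      fix v' b' assume *: "(x, v', b') \<in> G"
      show "leaves (tr v') \<subseteq> X"
      proof (cases "(x, v', b') \<in> {(a, u, b), (a, v, b)}")
        case True
        then have "leaves (tr z) \<subseteq> X" "v' = u \<or> v' = v" using l by auto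
        then show ?thesis using zl by auto
      next
        case False
        then show ?thesis using * l by blast
      qed
    qed
  qed (use assms(1,2) zl in auto)
  moreover have "(\<forall>(a, v, b) \<in> ?G. X \<inter> leaves (tr v) \<in> fam (tr v)) \<longleftrightarrow> (\<forall>(a, v, b) \<in> G. X \<inter> leaves (tr v) \<in> fam (tr v))"
  proof -
    define D where "D = G - {(a, u, b), (a, v, b)}"
    have "G = insert (a, u, b) (insert (a, v, b) D)" using assms(1,2) by (auto simp: D_def)
    then have "(\<forall>g \<in> G. P g) \<longleftrightarrow> P (a, u, b) \<and> P (a, v, b) \<and> (\<forall>g \<in> D. P g)" for P
      by (metis insert_iff)
    then show ?thesis using zf unfolding D_def[symmetric] by simp
  qed
  ultimately show ?thesis unfolding obeys_def by simp
qed

text \<open>As \<open>u\<close> is the only edge into \<open>b\<close> and \<open>v\<close> the only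
  one out of it, the condition at \<open>b\<close> is just what \<open>fam\<close> imposes on a
  series node. The new edge takes over the role of \<open>v\<close> at \<open>d\<close> and that of
  \<open>u\<close> at \<open>a\<close>.\<close>

lemma obeys_reduce_series:
  fixes G :: "(nat \<times> 'e \<times> nat) set"
  assumes "(a, u, b) \<in> G" "(b, v, d) \<in> G" "leaves (tr u) \<inter> leaves (tr v) = {}"
    and ub: "\<And>a' e. (a', e, b) \<in> G \<Longrightarrow> (a', e) = (a, u)" and vb: "\<And>e b'. (b, e, b') \<in> G \<Longrightarrow> (e, b') = (v, d)"
    and ne: "a \<noteq> b" "b \<noteq> d"
    and z: "tr z = Node True (tr u) (tr v)"
  shows "obeys (insert (a, z, d) (G - {(a, u, b), (b, v, d)})) tr X \<longleftrightarrow> obeys G tr X"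
proof -
  let ?G = "insert (a, z, d) (G - {(a, u, b), (b, v, d)})"
  let ?C = "X \<inter> leaves (tr u) = {} \<or> leaves (tr v) \<subseteq> X"
  define hit where "hit G x \<longleftrightarrow> (\<exists>a v. (a, v, x) \<in> G \<and> X \<inter> leaves (tr v) \<noteq> {})" for G :: "(nat \<times> 'e \<times> nat) set" and x :: nat
  define full where "full G x \<longleftrightarrow> (\<forall>v b. (x, v, b) \<in> G \<longrightarrow> leaves (tr v) \<subseteq> X)" for G :: "(nat \<times> 'e \<times> nat) set" and x :: nat
  define ok where "ok G \<longleftrightarrow> (\<forall>(a, v, b) \<in> G. X \<inter> leaves (tr v) \<in> fam (tr v))" for G :: "(nat \<times> 'e \<times> nat) set"
  have ob: "obeys G tr X \<longleftrightarrow> ok G \<and> (\<forall>x. hit G x \<longrightarrow> full G x)" for G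
    by (simp add: obeys_def hit_def full_def ok_def)
  note zf = mem_fam_Node_iff[OF assms(3), of X True, folded z, simplified]
  have zl: "leaves (tr z) = leaves (tr u) \<union> leaves (tr v)" by (simp add: z)
  have okG: "ok ?G \<longleftrightarrow> ok G \<and> ?C"
  proof -
    define D where "D = G - {(a, u, b), (b, v, d)}"
    have "G = insert (a, u, b) (insert (b, v, d) D)" using assms(1,2) by (auto simp: D_def)
    then have "(\<forall>g \<in> G. P g) \<longleftrightarrow> P (a, u, b) \<and> P (b, v, d) \<and> (\<forall>g \<in> D. P g)" for P
      by (metis insert_iff)
    then show ?thesis using zf unfolding D_def[symmetric] ok_def by (simp add: conj_ac cong: conj_cong)
  qed
  have b: "(hit G b \<longrightarrow> full G b) \<longleftrightarrow> ?C"
  proof -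
    have "hit G b \<longleftrightarrow> X \<inter> leaves (tr u) \<noteq> {}" unfolding hit_def using ub assms(1) by (metis prod.inject)
    moreover have "full G b \<longleftrightarrow> leaves (tr v) \<subseteq> X" unfolding full_def using vb assms(2) by (metis prod.inject)
    ultimately show ?thesis by blast
  qed
  have b': "\<not> hit ?G b" unfolding hit_def using ub ne by auto
  define D where "D = G - {(a, u, b), (b, v, d)}"
  have D: "?G = insert (a, z, d) D" "G = insert (a, u, b) (insert (b, v, d) D)"
    using assms(1,2) by (auto simp: D_def)
  have hi: "hit (insert (p, w, y) A) x \<longleftrightarrow> y = x \<and> X \<inter> leaves (tr w) \<noteq> {} \<or> hit A x" for p w y A x
    unfolding hit_def by auto
  have fi: "full (insert (p, w, y) A) x \<longleftrightarrow> (p = x \<longrightarrow> leaves (tr w) \<subseteq> X) \<and> full A x" for p w y A x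
    unfolding full_def by auto
  \<comment> \<open>Given \<open>?C\<close>, a set that meets the new edge meets \<open>v\<close>:
    it either misses \<open>u\<close> or contains all of \<open>v\<close>, which is not empty. The
    next claim is dual: a set containing \<open>u\<close> meets it and hence contains
    \<open>v\<close>.\<close>
  have h: "hit ?G x \<longleftrightarrow> hit G x" if "x \<noteq> b" "?C" for x
  proof -
    have "X \<inter> leaves (tr z) \<noteq> {} \<longleftrightarrow> X \<inter> leaves (tr v) \<noteq> {}"
      using that(2) zl leaves_nonempty[of "tr v"] by blast
    then show ?thesis unfolding D(1) using that(1) by (subst D(2)) (simp add: hi)
  qed
  have f: "full ?G x \<longleftrightarrow> full G x" if "x \<noteq> b" "?C" for x
  proof -
    have "leaves (tr z) \<subseteq> X \<longleftrightarrow> leaves (tr u) \<subseteq> X"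
      using that(2) zl leaves_nonempty[of "tr u"] by blast
    then show ?thesis unfolding D(1) using that(1) by (subst D(2)) (simp add: fi)
  qed
  have "(\<forall>x. hit G x \<longrightarrow> full G x) \<longleftrightarrow> ?C \<and> (\<forall>x. x \<noteq> b \<longrightarrow> hit G x \<longrightarrow> full G x)" using b by metis
  moreover have "(\<forall>x. hit ?G x \<longrightarrow> full ?G x) \<longleftrightarrow> (\<forall>x. x \<noteq> b \<longrightarrow> hit ?G x \<longrightarrow> full ?G x)" using b' by metis
  moreover have "(\<forall>x. x \<noteq> b \<longrightarrow> hit ?G x \<longrightarrow> full ?G x) \<longleftrightarrow> (\<forall>x. x \<noteq> b \<longrightarrow> hit G x \<longrightarrow> full G x)" if ?C
    using h f that by metis
  ultimately show ?thesis unfolding ob okG by blast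
qed

section \<open>Weakest preconditions with elapsed time\<close>

lemma aval_le: "aval W S x \<sigma> e = Some v \<Longrightarrow> v \<le> W"
proof (induction e arbitrary: v)
  case (Add e f)
  then show ?case
    by (cases "aval W S x \<sigma> e"; cases "aval W S x \<sigma> f") (auto simp: fit_def split: if_splits)
next
  case (Sub e f)
  then show ?case
    by (cases "aval W S x \<sigma> e"; cases "aval W S x \<sigma> f") (auto simp: fit_def split: if_splits)
next
  case (Mul e f)
  then show ?case
    by (cases "aval W S x \<sigma> e"; cases "aval W S x \<sigma> f") (auto simp: fit_def split: if_splits)
qed (auto simp: fit_def split: if_splits option.splits)

text \<open>Reading a register or cell gets stuck if its content exceeds \<open>W\<close>. Every
  value written has passed \<open>fit\<close>, so this is an invariant of executions, and it spares
  \<open>safe\<close> any condition on the contents read.\<close>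

definition good :: "nat \<Rightarrow> state \<Rightarrow> bool" where
  "good W \<sigma> \<longleftrightarrow> (\<forall>r. fst \<sigma> r \<le> W) \<and> (\<forall>a i. snd \<sigma> a i \<le> W)"

lemma exec_good: "exec W S x p \<sigma> t \<tau> \<Longrightarrow> good W \<sigma> \<Longrightarrow> good W \<tau>"
  by (induction rule: exec.induct) (auto simp: good_def dest: aval_le)

primrec av :: "nat list \<Rightarrow> state \<Rightarrow> aexp \<Rightarrow> nat" where
  "av x \<sigma> (Const k) = k"
| "av x \<sigma> (Reg r) = fst \<sigma> r"
| "av x \<sigma> (Input e) = x ! av x \<sigma> e"
| "av x \<sigma> (Cell a e) = snd \<sigma> a (av x \<sigma> e)"
| "av x \<sigma> (Add e f) = av x \<sigma> e + av x \<sigma> f"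
| "av x \<sigma> (Sub e f) = av x \<sigma> e - av x \<sigma> f"
| "av x \<sigma> (Mul e f) = av x \<sigma> e * av x \<sigma> f"

primrec bv :: "nat list \<Rightarrow> state \<Rightarrow> bexp \<Rightarrow> bool" where
  "bv x \<sigma> (Less e f) = (av x \<sigma> e < av x \<sigma> f)"
| "bv x \<sigma> (Equal e f) = (av x \<sigma> e = av x \<sigma> f)"
| "bv x \<sigma> (Not b) = (\<not> bv x \<sigma> b)"
| "bv x \<sigma> (And b b') = (bv x \<sigma> b \<and> bv x \<sigma> b')"

definition For :: "nat \<Rightarrow> nat \<Rightarrow> com \<Rightarrow> com" where
  "For r h p = Seq (Assign r (Const 0))
    (While (Less (Reg r) (Reg h)) (Seq p (Assign r (Add (Reg r) (Const 1)))))"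

locale ram =
  fixes W S :: nat and x :: "nat list"
begin

primrec safe :: "state \<Rightarrow> aexp \<Rightarrow> bool" where
  "safe \<sigma> (Const k) = (k \<le> W)"
| "safe \<sigma> (Reg r) = True"
| "safe \<sigma> (Input e) = (safe \<sigma> e \<and> av x \<sigma> e < length x \<and> x ! av x \<sigma> e \<le> W)"
| "safe \<sigma> (Cell a e) = (safe \<sigma> e \<and> av x \<sigma> e < S)"
| "safe \<sigma> (Add e f) = (safe \<sigma> e \<and> safe \<sigma> f \<and> av x \<sigma> e + av x \<sigma> f \<le> W)"
| "safe \<sigma> (Sub e f) = (safe \<sigma> e \<and> safe \<sigma> f)"
| "safe \<sigma> (Mul e f) = (safe \<sigma> e \<and> safe \<sigma> f \<and> av x \<sigma> e * av x \<sigma> f \<le> W)"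

primrec bsafe :: "state \<Rightarrow> bexp \<Rightarrow> bool" where
  "bsafe \<sigma> (Less e f) = (safe \<sigma> e \<and> safe \<sigma> f)"
| "bsafe \<sigma> (Equal e f) = (safe \<sigma> e \<and> safe \<sigma> f)"
| "bsafe \<sigma> (Not b) = bsafe \<sigma> b"
| "bsafe \<sigma> (And b b') = (bsafe \<sigma> b \<and> (bv x \<sigma> b \<longrightarrow> bsafe \<sigma> b'))"

lemma aval_safe: "good W \<sigma> \<Longrightarrow> safe \<sigma> e \<Longrightarrow> aval W S x \<sigma> e = Some (av x \<sigma> e)"
proof (induction e)
  case (Cell a e)
  then show ?case by (auto simp: good_def fit_def)
next
  case (Sub e f)
  then have "av x \<sigma> e \<le> W" using aval_le[of W S x \<sigma> e] by simp
  with Sub show ?case by (auto simp: fit_def)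
qed (auto simp: good_def fit_def)

lemma bval_bsafe: "good W \<sigma> \<Longrightarrow> bsafe \<sigma> b \<Longrightarrow> bval W S x \<sigma> b = Some (bv x \<sigma> b)"
  by (induction b) (auto simp: aval_safe split: bool.splits)

text \<open>The postcondition receives the absolute clock, \<open>k\<close> being its value at the
  start, so that time bounds become ordinary assertions.\<close>

definition wp :: "com \<Rightarrow> (state \<Rightarrow> nat \<Rightarrow> bool) \<Rightarrow> state \<Rightarrow> nat \<Rightarrow> bool" where
  "wp p Q \<sigma> k \<longleftrightarrow> (good W \<sigma> \<longrightarrow> (\<exists>t \<tau>. exec W S x p \<sigma> t \<tau> \<and> Q \<tau> (k + t)))"

text \<open>Loop-free code is reduced to plain conditions by simplification; a \<open>While\<close>
  is left as a \<open>wp\<close> goal, to be met by an invariant.\<close>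

primrec vc :: "com \<Rightarrow> (state \<Rightarrow> nat \<Rightarrow> bool) \<Rightarrow> state \<Rightarrow> nat \<Rightarrow> bool" where
  "vc Skip Q \<sigma> k = Q \<sigma> (k + 1)"
| "vc (Assign r e) Q \<sigma> k = (safe \<sigma> e \<and> Q ((fst \<sigma>)(r := av x \<sigma> e), snd \<sigma>) (k + (acost e + 1)))"
| "vc (Store a e f) Q \<sigma> k = (safe \<sigma> e \<and> safe \<sigma> f \<and> av x \<sigma> e < S \<and>
    Q (fst \<sigma>, (snd \<sigma>)(a := (snd \<sigma> a)(av x \<sigma> e := av x \<sigma> f))) (k + (acost e + acost f + 1)))"
| "vc (Seq p q) Q \<sigma> k = vc p (\<lambda>\<tau> k'. vc q Q \<tau> (k' + 1)) \<sigma> k"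
| "vc (If b p q) Q \<sigma> k = (bsafe \<sigma> b \<and> (if bv x \<sigma> b then vc p Q \<sigma> (k + (bcost b + 1)) else vc q Q \<sigma> (k + (bcost b + 1))))"
| "vc (While b p) Q \<sigma> k = wp (While b p) Q \<sigma> k"

lemma wpD: "wp p Q \<sigma> k \<Longrightarrow> good W \<sigma> \<Longrightarrow> \<exists>t \<tau>. exec W S x p \<sigma> t \<tau> \<and> good W \<tau> \<and> Q \<tau> (k + t)"
  unfolding wp_def using exec_good by blast

lemma wp_mono: "wp p Q \<sigma> k \<Longrightarrow> (\<And>\<tau> k'. good W \<tau> \<Longrightarrow> Q \<tau> k' \<Longrightarrow> Q' \<tau> k') \<Longrightarrow> wp p Q' \<sigma> k"
  unfolding wp_def using exec_good by blast

lemma wp_Seq: "wp p (\<lambda>\<tau> k'. wp q Q \<tau> (k' + 1)) \<sigma> k \<Longrightarrow> wp (Seq p q) Q \<sigma> k"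
  unfolding wp_def
proof (intro impI)
  assume "good W \<sigma> \<longrightarrow> (\<exists>t \<tau>. exec W S x p \<sigma> t \<tau> \<and> (good W \<tau> \<longrightarrow> (\<exists>u \<rho>. exec W S x q \<tau> u \<rho> \<and> Q \<rho> (k + t + 1 + u))))"
    and g: "good W \<sigma>"
  then obtain t \<tau> u \<rho> where *: "exec W S x p \<sigma> t \<tau>" "exec W S x q \<tau> u \<rho>" "Q \<rho> (k + t + 1 + u)"
    using exec_good by blast
  then show "\<exists>t \<tau>. exec W S x (Seq p q) \<sigma> t \<tau> \<and> Q \<tau> (k + t)"
    using exec.Seq[OF *(1,2)] by (intro exI[of _ "t + u + 1"] exI[of _ \<rho>]) (simp add: ac_simps)
qed

lemma vc_wp: "vc p Q \<sigma> k \<Longrightarrow> wp p Q \<sigma> k"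
proof (induction p arbitrary: Q \<sigma> k)
  case Skip
  then show ?case unfolding wp_def using exec.Skip by fastforce
next
  case (Assign r e)
  obtain R M where \<sigma>: "\<sigma> = (R, M)" by (cases \<sigma>)
  show ?case unfolding wp_def \<sigma>
  proof (intro impI)
    assume "good W (R, M)"
    then show "\<exists>t \<tau>. exec W S x (Assign r e) (R, M) t \<tau> \<and> Q \<tau> (k + t)"
      using exec.Assign[OF aval_safe, of R M e r] Assign \<sigma> by fastforce
  qed
next
  case (Store a e f)
  obtain R M where \<sigma>: "\<sigma> = (R, M)" by (cases \<sigma>)
  show ?case unfolding wp_def \<sigma>
  proof (intro impI)
    assume "good W (R, M)"
    then show "\<exists>t \<tau>. exec W S x (Store a e f) (R, M) t \<tau> \<and> Q \<tau> (k + t)"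
      using exec.Store[OF aval_safe _ aval_safe, of R M e f a] Store \<sigma> by fastforce
  qed
next
  case (Seq p q)
  have "wp p (\<lambda>\<tau> k'. vc q Q \<tau> (k' + 1)) \<sigma> k" using Seq by simp
  then have "wp p (\<lambda>\<tau> k'. wp q Q \<tau> (k' + 1)) \<sigma> k" by (rule wp_mono) (rule Seq.IH)
  then show ?case by (rule wp_Seq)
next
  case (If b p q)
  show ?case unfolding wp_def
  proof (intro impI)
    assume g: "good W \<sigma>"
    have b: "bval W S x \<sigma> b = Some (bv x \<sigma> b)" using If.prems g by (simp add: bval_bsafe)
    show "\<exists>t \<tau>. exec W S x (If b p q) \<sigma> t \<tau> \<and> Q \<tau> (k + t)"
    proof (cases "bv x \<sigma> b")
      case True
      then have "wp p Q \<sigma> (k + (bcost b + 1))" using If by simp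
      then obtain t \<tau> where *: "exec W S x p \<sigma> t \<tau>" "Q \<tau> (k + (bcost b + 1) + t)"
        using g unfolding wp_def by blast
      show ?thesis using exec.IfTrue[OF _ *(1), of b q] b True *(2)
        by (intro exI[of _ "bcost b + t + 1"] exI[of _ \<tau>]) (simp add: ac_simps)
    next
      case False
      then have "wp q Q \<sigma> (k + (bcost b + 1))" using If by simp
      then obtain t \<tau> where *: "exec W S x q \<sigma> t \<tau>" "Q \<tau> (k + (bcost b + 1) + t)"
        using g unfolding wp_def by blast
      show ?thesis using exec.IfFalse[OF _ *(1), of b p] b False *(2)
        by (intro exI[of _ "bcost b + t + 1"] exI[of _ \<tau>]) (simp add: ac_simps)
    qed
  qed
qed simp

text \<open>Since elapsed time strictly increases, a bound on the elapsed time in the invariant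
  also proves termination.\<close>

lemma wp_While:
  assumes "I \<sigma> k"
    and bound: "\<And>\<sigma> k. I \<sigma> k \<Longrightarrow> k \<le> B"
    and step: "\<And>\<sigma> k. good W \<sigma> \<Longrightarrow> I \<sigma> k \<Longrightarrow> bsafe \<sigma> b \<and>
      (if bv x \<sigma> b then wp p I \<sigma> (k + (bcost b + 1)) else Q \<sigma> (k + (bcost b + 1)))"
  shows "wp (While b p) Q \<sigma> k"
proof -
  have "\<exists>t \<tau>. exec W S x (While b p) \<sigma> t \<tau> \<and> Q \<tau> (k + t)" if "good W \<sigma>" "I \<sigma> k"
    using that
  proof (induction "B - k" arbitrary: \<sigma> k rule: less_induct)
    case less
    have b: "bval W S x \<sigma> b = Some (bv x \<sigma> b)" using step[OF less.prems] less.prems by (simp add: bval_bsafe)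
    show ?case
    proof (cases "bv x \<sigma> b")
      case False
      then show ?thesis using exec.WhileFalse[of W S x \<sigma> b p] b step[OF less.prems]
        by (intro exI[of _ "bcost b + 1"] exI[of _ \<sigma>]) simp
    next
      case True
      then have "wp p I \<sigma> (k + (bcost b + 1))" using step[OF less.prems] by simp
      then obtain t \<tau> where *: "exec W S x p \<sigma> t \<tau>" "I \<tau> (k + (bcost b + 1) + t)" "good W \<tau>"
        using less.prems wpD by blast
      have "B - (k + (bcost b + 1) + t) < B - k" using bound[OF *(2)] by simp
      from less.hyps[OF this *(3,2)] obtain u \<rho> where
        **: "exec W S x (While b p) \<tau> u \<rho>" "Q \<rho> (k + (bcost b + 1) + t + u)" by blast
      show ?thesis using exec.WhileTrue[OF _ *(1) **(1)] b True **(2)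
        by (intro exI[of _ "bcost b + t + u + 1"] exI[of _ \<rho>]) (simp add: ac_simps)
    qed
  qed
  then show ?thesis using assms(1) unfolding wp_def by blast
qed

text \<open>A round costs 9 units beyond the body: 4 for the test, 4 for the increment and 1 for
  sequencing. The remaining 7 are 3 for initializing the counter and 4 for the last test.\<close>

lemma wp_For:
  assumes "I 0 (R(r := 0)) M" "R h = N" "r \<noteq> h" "1 \<le> W"
    and step: "\<And>i R M k. I i R M \<Longrightarrow> R r = i \<Longrightarrow> i < N \<Longrightarrow> R h = N \<Longrightarrow>
      wp p (\<lambda>\<tau> k'. I (Suc i) ((fst \<tau>)(r := Suc i)) (snd \<tau>) \<and> fst \<tau> r = i \<and> fst \<tau> h = N \<and> k' \<le> k + T) (R, M) k"
    and fin: "\<And>R M k'. I N R M \<Longrightarrow> R r = N \<Longrightarrow> R h = N \<Longrightarrow> k' \<le> k + (N * (T + 9) + 7) \<Longrightarrow> Q (R, M) k'"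
  shows "wp (For r h p) Q (R, M) k"
proof -
  define J where "J \<tau> k' \<longleftrightarrow> (\<exists>i. i \<le> N \<and> I i (fst \<tau>) (snd \<tau>) \<and> fst \<tau> r = i \<and> fst \<tau> h = N \<and> k' \<le> k + 3 + i * (T + 9))"
    for \<tau> :: state and k'
  have "wp (While (Less (Reg r) (Reg h)) (Seq p (Assign r (Add (Reg r) (Const 1))))) Q (R(r := 0), M) (k + 3)"
  proof (rule wp_While[where I = J and B = "k + 3 + N * (T + 9)"])
    show "J (R(r := 0), M) (k + 3)" unfolding J_def using assms by auto
    show "k' \<le> k + 3 + N * (T + 9)" if "J \<sigma> k'" for \<sigma> k'
    proof -
      from that obtain i where "i \<le> N" "k' \<le> k + 3 + i * (T + 9)" unfolding J_def by blast
      moreover have "i * (T + 9) \<le> N * (T + 9)" using \<open>i \<le> N\<close> by (rule mult_le_mono1)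
      ultimately show ?thesis by linarith
    qed
    show "bsafe \<sigma> (Less (Reg r) (Reg h)) \<and>
      (if bv x \<sigma> (Less (Reg r) (Reg h)) then wp (Seq p (Assign r (Add (Reg r) (Const 1)))) J \<sigma> (k' + (bcost (Less (Reg r) (Reg h)) + 1))
       else Q \<sigma> (k' + (bcost (Less (Reg r) (Reg h)) + 1)))" if g: "good W \<sigma>" and J: "J \<sigma> k'" for \<sigma> k'
    proof -
      obtain R' M' where \<sigma>: "\<sigma> = (R', M')" by (cases \<sigma>)
      from J obtain i where i: "i \<le> N" "I i R' M'" "R' r = i" "R' h = N" "k' \<le> k + 3 + i * (T + 9)"
        unfolding J_def \<sigma> by auto
      show ?thesis
      proof (cases "i < N")
        case False
        then show ?thesis using i unfolding \<sigma> by (auto intro!: fin)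
      next
        case True
        have "N \<le> W" using g i unfolding good_def \<sigma> by auto
        have "wp (Seq p (Assign r (Add (Reg r) (Const 1)))) J (R', M') (k' + 4)"
        proof (rule wp_Seq, rule wp_mono[OF step[OF i(2,3) True i(4)]])
          fix \<tau> k2
          assume t: "I (Suc i) ((fst \<tau>)(r := Suc i)) (snd \<tau>) \<and> fst \<tau> r = i \<and> fst \<tau> h = N \<and> k2 \<le> k' + 4 + T"
          show "wp (Assign r (Add (Reg r) (Const 1))) J \<tau> (k2 + 1)"
            by (rule vc_wp) (use t True \<open>N \<le> W\<close> assms(3,4) i(5) in \<open>auto simp: J_def\<close>)
        qed
        then show ?thesis using True i unfolding \<sigma> by (simp add: numeral_eq_Suc)
      qed
    qed
  qed
  then show ?thesis unfolding For_def by (intro vc_wp) (simp add: numeral_eq_Suc)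
qed

end

section \<open>Reducing the multigraph while recording a decomposition tree\<close>

text \<open>Component \<open>y\<close> is an item if \<open>y < n\<close>, and otherwise a series (\<open>K y \<noteq> 0\<close>) or parallel
  composition of the components \<open>L y\<close> and \<open>R y\<close>.\<close>

definition tree_arrays where
  "tree_arrays n z K L R tr \<longleftrightarrow> (\<forall>j<n. tr j = Leaf j) \<and>
    (\<forall>y. n \<le> y \<longrightarrow> y < z \<longrightarrow> L y < y \<and> R y < y \<and> L y \<noteq> R y \<and> tr y = Node (K y \<noteq> (0::nat)) (tr (L y)) (tr (R y))) \<and>
    (\<forall>y<z. disjoint_tree (tr y)) \<and>
    (\<forall>y y'. n \<le> y \<longrightarrow> y < y' \<longrightarrow> y' < z \<longrightarrow> {L y, R y} \<inter> {L y', R y'} = {})"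

definition tree_root where
  "tree_root n z L R v \<longleftrightarrow> v < z \<and> (\<forall>y. n \<le> y \<longrightarrow> y < z \<longrightarrow> v \<noteq> L y \<and> v \<noteq> (R y :: nat))"

text \<open>\<open>C\<close> is the constraint that the multigraph has to represent. The equation on
  cardinalities starts as \<open>n + n\<close>, and every reduction trades one edge for one
  component. The trees are quantified existentially since the program holds only their arrays;
  injectivity makes a label identify its edge.\<close>

definition reduced where
  "reduced C n s t G K L R z \<longleftrightarrow> ttsp G s t \<and> card G + z = 2 * n \<and> n \<le> z \<and>
    (\<forall>(a, v, b) \<in> G. tree_root n z L R v) \<and> inj_on (fst \<circ> snd) G \<and>
    (\<exists>tr. tree_arrays n z K L R tr \<and>
      (\<forall>(a, v, b) \<in> G. \<forall>(a', v', b') \<in> G. v \<noteq> v' \<longrightarrow> leaves (tr v) \<inter> leaves (tr v') = {}) \<and>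
      (\<Union>(a, v, b) \<in> G. leaves (tr v)) = {..<n} \<and>
      (\<forall>X. X \<subseteq> {..<n} \<longrightarrow> (C X \<longleftrightarrow> obeys G tr X)))"

lemma obeys_cong:
  assumes "\<And>a v b. (a, v, b) \<in> G \<Longrightarrow> tr v = tr' v"
  shows "obeys G tr X \<longleftrightarrow> obeys G tr' X"
proof -
  have "(\<forall>(a, v, b) \<in> G. X \<inter> leaves (tr v) \<in> fam (tr v)) \<longleftrightarrow> (\<forall>(a, v, b) \<in> G. X \<inter> leaves (tr' v) \<in> fam (tr' v))"
    using assms by (intro ball_cong refl) auto
  moreover have "(\<exists>a v. (a, v, x) \<in> G \<and> X \<inter> leaves (tr v) \<noteq> {}) \<longleftrightarrow> (\<exists>a v. (a, v, x) \<in> G \<and> X \<inter> leaves (tr' v) \<noteq> {})" for x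
    using assms by metis
  moreover have "(\<forall>v b. (x, v, b) \<in> G \<longrightarrow> leaves (tr v) \<subseteq> X) \<longleftrightarrow> (\<forall>v b. (x, v, b) \<in> G \<longrightarrow> leaves (tr' v) \<subseteq> X)" for x
    using assms by metis
  ultimately show ?thesis unfolding obeys_def by presburger
qed

lemma Ball_triple: "(\<forall>(a, v, b) \<in> G. P a v b) \<longleftrightarrow> (\<forall>a v b. (a, v, b) \<in> G \<longrightarrow> P a v b)"
  by auto

lemma reduced_init:
  assumes "ttsp ((\<lambda>e. (tn e, e, hn e)) ` {..<n}) s t"
    and "\<And>X. X \<subseteq> {..<n} \<Longrightarrow> C X \<longleftrightarrow> (\<forall>u<n. \<forall>v<n. hn u = tn v \<longrightarrow> u \<in> X \<longrightarrow> v \<in> X)"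
  shows "reduced C n s t ((\<lambda>e. (tn e, e, hn e)) ` {..<n}) K L R n"
proof -
  let ?G = "(\<lambda>e. (tn e, e, hn e)) ` {..<n}"
  have "card ?G = n" by (subst card_image) (auto simp: inj_on_def)
  moreover have "obeys ?G Leaf X \<longleftrightarrow> (\<forall>u<n. \<forall>v<n. hn u = tn v \<longrightarrow> u \<in> X \<longrightarrow> v \<in> X)" if "X \<subseteq> {..<n}" for X
  proof -
    have mem: "(a, v, b) \<in> ?G \<longleftrightarrow> v < n \<and> a = tn v \<and> b = hn v" for a v b by auto
    have "(\<forall>(a, v, b) \<in> ?G. X \<inter> leaves (Leaf v) \<in> fam (Leaf v))" by auto
    then show ?thesis unfolding obeys_def mem by auto
  qed
  ultimately show ?thesis unfolding reduced_def using assms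
    by (auto simp: tree_arrays_def tree_root_def inj_on_def intro!: exI[of _ Leaf])
qed

text \<open>The bookkeeping common to both reductions; what distinguishes them is confined to the
  premises \<open>ttsp\<close> and \<open>obeys\<close>.\<close>

lemma reduced_step:
  assumes red: "reduced C n s t G K L R z"
    and g: "(a, u, b) \<in> G" "(a', v, b') \<in> G" "u \<noteq> v"
    and ttsp: "ttsp (insert (p, z, q) (G - {(a, u, b), (a', v, b')})) s t"
    and obeys: "\<And>tr X. leaves (tr u) \<inter> leaves (tr v) = {} \<Longrightarrow> tr z = Node (k \<noteq> 0) (tr u) (tr v) \<Longrightarrow>
      obeys (insert (p, z, q) (G - {(a, u, b), (a', v, b')})) tr X \<longleftrightarrow> obeys G tr X"
  shows "reduced C n s t (insert (p, z, q) (G - {(a, u, b), (a', v, b')})) (K(z := k)) (L(z := u)) (R(z := v)) (Suc z)"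
proof -
  define D where "D = G - {(a, u, b), (a', v, b')}"
  have G: "G = insert (a, u, b) (insert (a', v, b') D)" using g by (auto simp: D_def)
  from red have "ttsp G s t" and cz: "card G + z = 2 * n" "n \<le> z"
    and roots: "\<forall>(a, v, b) \<in> G. tree_root n z L R v" and inj: "inj_on (fst \<circ> snd) G"
    and ex: "\<exists>tr. tree_arrays n z K L R tr \<and>
      (\<forall>(a, v, b) \<in> G. \<forall>(a', v', b') \<in> G. v \<noteq> v' \<longrightarrow> leaves (tr v) \<inter> leaves (tr v') = {}) \<and>
      (\<Union>(a, v, b) \<in> G. leaves (tr v)) = {..<n} \<and>
      (\<forall>X. X \<subseteq> {..<n} \<longrightarrow> (C X \<longleftrightarrow> obeys G tr X))" unfolding reduced_def by simp_all
  from ex obtain tr where tr0: "tree_arrays n z K L R tr"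
      "\<forall>(a, v, b) \<in> G. \<forall>(a', v', b') \<in> G. v \<noteq> v' \<longrightarrow> leaves (tr v) \<inter> leaves (tr v') = {}"
      "(\<Union>(a, v, b) \<in> G. leaves (tr v)) = {..<n}"
      "\<forall>X. X \<subseteq> {..<n} \<longrightarrow> (C X \<longleftrightarrow> obeys G tr X)"
    by (elim exE conjE)
  have "leaves (tr v) \<inter> leaves (tr v') = {}" if "(a, v, b) \<in> G" "(a', v', b') \<in> G" "v \<noteq> v'" for a v b a' v' b'
    using bspec[OF bspec[OF tr0(2) that(1), simplified] that(2)] that(3) by simp
  note tr = tr0(1) this tr0(3) tr0(4)[rule_format]
  have root: "tree_root n z L R w" if "(x, w, y) \<in> G" for x w y
    using roots that by auto
  have ids: "w < z" if "(x, w, y) \<in> G" for x w y using root[OF that] unfolding tree_root_def by simp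
  have uz: "u < z" and vz: "v < z" using ids g by auto
  have wD: "w \<noteq> u \<and> w \<noteq> v \<and> w < z" if w: "(x, w, y) \<in> D" for x w y
  proof -
    have *: "(x, w, y) \<in> G" "(x, w, y) \<noteq> (a, u, b)" "(x, w, y) \<noteq> (a', v, b')" using w by (auto simp: D_def)
    have "(x, w, y) = (x', w, y')" if "(x', w, y') \<in> G" for x' y'
      using inj_onD[OF inj, of "(x, w, y)" "(x', w, y')"] that *(1) by simp
    then have "w \<noteq> u" "w \<noteq> v" using g(1,2) *(2,3) by metis+
    then show ?thesis using ids[OF *(1)] by simp
  qed
  have fin: "finite G" using ttsp_finite[OF \<open>ttsp G s t\<close>] by simp
  have "card G = Suc (Suc (card D))" unfolding G using fin g(3) by (subst card_insert_disjoint) (auto simp: D_def)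
  moreover have "card (insert (p, z, q) D) = Suc (card D)" using fin wD[of p z q] by (subst card_insert_disjoint) (auto simp: D_def)
  ultimately have card: "card (insert (p, z, q) D) + Suc z = 2 * n" using cz by simp
  define tr' where "tr' = tr(z := Node (k \<noteq> 0) (tr u) (tr v))"
  have tr'_eq: "tr' w = tr w" if "w < z" for w using that by (simp add: tr'_def)
  have tr'z: "tr' z = Node (k \<noteq> 0) (tr' u) (tr' v)" using uz vz by (simp add: tr'_def)
  have uv: "leaves (tr u) \<inter> leaves (tr v) = {}" using tr(2)[OF g(1,2)] g(3) by simp
  have "tree_arrays n (Suc z) (K(z := k)) (L(z := u)) (R(z := v)) tr'"
  proof -
    have "tr' j = Leaf j" if "j < n" for j
      using tr(1) that cz(2) by (auto simp: tree_arrays_def tr'_def)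
    moreover have "(L(z := u)) y < y \<and> (R(z := v)) y < y \<and> (L(z := u)) y \<noteq> (R(z := v)) y \<and>
       tr' y = Node ((K(z := k)) y \<noteq> 0) (tr' ((L(z := u)) y)) (tr' ((R(z := v)) y))"
      if y: "n \<le> y" "y < Suc z" for y
    proof (cases "y = z")
      case True
      then show ?thesis using uz vz g(3) tr'z by simp
    next
      case False
      then have "L y < y \<and> R y < y \<and> L y \<noteq> R y \<and> tr y = Node (K y \<noteq> 0) (tr (L y)) (tr (R y))"
        using tr(1) y unfolding tree_arrays_def by simp
      then show ?thesis using False y by (simp add: tr'_def)
    qed
    moreover have "disjoint_tree (tr' y)" if "y < Suc z" for y
      using that tr(1) uv uz vz by (cases "y = z") (auto simp: tr'_def tree_arrays_def)
    \<comment> \<open>The labels of edges are roots, so neither \<open>u\<close> nor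
      \<open>v\<close> has been used as a child before.\<close>
    moreover have "{(L(z := u)) y, (R(z := v)) y} \<inter> {(L(z := u)) y', (R(z := v)) y'} = {}"
      if y: "n \<le> y" "y < y'" "y' < Suc z" for y y'
    proof (cases "y' = z")
      case True
      then show ?thesis using y root[OF g(1)] root[OF g(2)] by (auto simp: tree_root_def)
    next
      case False
      then show ?thesis using y tr(1) by (simp add: tree_arrays_def)
    qed
    ultimately show ?thesis unfolding tree_arrays_def by blast
  qed
  moreover have "tree_root n (Suc z) (L(z := u)) (R(z := v)) w" if w: "(x, w, y) \<in> insert (p, z, q) D" for x w y
  proof (cases "(x, w, y) = (p, z, q)")
    case True
    have "L y' < y' \<and> R y' < y'" if "n \<le> y'" "y' < z" for y' using tr(1) that by (simp add: tree_arrays_def)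
    then have "L y' \<noteq> z \<and> R y' \<noteq> z" if "n \<le> y'" "y' < z" for y' using that by (meson less_asym)
    then show ?thesis using True uz vz by (simp add: tree_root_def less_Suc_eq) metis
  next
    case False
    then have *: "(x, w, y) \<in> D" using w by blast
    then have "tree_root n z L R w" using root[of x w y] by (simp add: D_def)
    then show ?thesis using wD[OF *] by (simp add: tree_root_def)
  qed
  moreover have "inj_on (fst \<circ> snd) (insert (p, z, q) D)"
  proof -
    have "inj_on (fst \<circ> snd) D" using inj by (rule inj_on_subset) (auto simp: D_def)
    moreover have "(fst \<circ> snd) (p, z, q) \<notin> (fst \<circ> snd) ` (D - {(p, z, q)})" using wD by fastforce
    ultimately show ?thesis by simp
  qed
  moreover have "leaves (tr' w) \<inter> leaves (tr' w') = {}"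
    if w: "(x, w, y) \<in> insert (p, z, q) D" "(x', w', y') \<in> insert (p, z, q) D" "w \<noteq> w'" for x w y x' w' y'
  proof -
    have DG: "D \<subseteq> G" by (auto simp: D_def)
    have old: "leaves (tr' z) \<inter> leaves (tr' w) = {}" if "(x, w, y) \<in> D" for x w y
    proof -
      have "leaves (tr u) \<inter> leaves (tr w) = {}" "leaves (tr v) \<inter> leaves (tr w) = {}"
        using tr(2)[OF g(1), of x w y] tr(2)[OF g(2), of x w y] wD[OF that] that DG by auto
      then show ?thesis using wD[OF that] by (auto simp: tr'_def)
    qed
    consider "w = z" "(x', w', y') \<in> D" | "w' = z" "(x, w, y) \<in> D" | "(x, w, y) \<in> D" "(x', w', y') \<in> D"
      using w by auto
    then show ?thesis
    proof cases
      case 1 then show ?thesis using old by simp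
    next
      case 2 then show ?thesis using old by (simp add: Int_commute)
    next
      case 3
      then have "w < z" "w' < z" using wD by auto
      then show ?thesis using tr(2)[of x w y x' w' y'] 3 DG w(3) by (auto simp: tr'_eq)
    qed
  qed
  moreover have "(\<Union>(x, w, y) \<in> insert (p, z, q) D. leaves (tr' w)) = {..<n}"
  proof -
    have "(\<Union>(x, w, y) \<in> D. leaves (tr' w)) = (\<Union>(x, w, y) \<in> D. leaves (tr w))"
      using wD tr'_eq by (intro SUP_cong refl) fastforce
    moreover have "(\<Union>(x, w, y) \<in> G. leaves (tr w)) = leaves (tr u) \<union> leaves (tr v) \<union> (\<Union>(x, w, y) \<in> D. leaves (tr w))"
      by (subst G) auto
    ultimately show ?thesis using tr(3) by (simp add: tr'_def)
  qed
  moreover have "C X \<longleftrightarrow> obeys (insert (p, z, q) D) tr' X" if "X \<subseteq> {..<n}" for X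
  proof -
    have "obeys (insert (p, z, q) D) tr' X \<longleftrightarrow> obeys G tr' X"
      unfolding D_def by (rule obeys) (use uv uz vz tr'_eq tr'z in auto)
    also have "\<dots> \<longleftrightarrow> obeys G tr X" by (rule obeys_cong) (use ids tr'_eq in auto)
    finally show ?thesis using tr(4)[OF that] by simp
  qed
  moreover have "n \<le> Suc z" using cz by simp
  ultimately show ?thesis using ttsp card unfolding reduced_def D_def[symmetric] Ball_triple
    by (intro conjI exI[of _ tr'] allI impI) (simp_all del: insert_iff UN_insert)
qed

lemma reduced_fresh:
  assumes "reduced C n s t G K L R z"
  shows "(x, z, y) \<notin> G"
proof
  have "\<forall>(a, v, b) \<in> G. tree_root n z L R v" using assms unfolding reduced_def by simp
  moreover assume "(x, z, y) \<in> G"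
  ultimately show False by (auto simp: tree_root_def)
qed

lemma reduced_parallel:
  assumes "reduced C n s t G K L R z" "(a, u, b) \<in> G" "(a, v, b) \<in> G" "u \<noteq> v"
  shows "reduced C n s t (insert (a, z, b) (G - {(a, u, b), (a, v, b)})) (K(z := 0)) (L(z := u)) (R(z := v)) (Suc z)"
proof (rule reduced_step[OF assms])
  have "ttsp G s t" using assms(1) by (simp add: reduced_def)
  then show "ttsp (insert (a, z, b) (G - {(a, u, b), (a, v, b)})) s t"
    by (rule ttsp_reduce_parallel) (use assms reduced_fresh in auto)
qed (simp add: obeys_reduce_parallel assms(2,3))

lemma reduced_series:
  assumes red: "reduced C n s t G K L R z" and g: "(a, u, b) \<in> G" "(b, v, d) \<in> G"
    and u: "\<And>a' e. (a', e, b) \<in> G \<Longrightarrow> (a', e) = (a, u)" and v: "\<And>e b'. (b, e, b') \<in> G \<Longrightarrow> (e, b') = (v, d)"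
  shows "reduced C n s t (insert (a, z, d) (G - {(a, u, b), (b, v, d)})) (K(z := 1)) (L(z := u)) (R(z := v)) (Suc z)"
proof -
  have sp: "ttsp G s t" and inj: "inj_on (fst \<circ> snd) G" using red by (auto simp: reduced_def)
  \<comment> \<open>Acyclicity excludes loops, so the two edges are different and hence carry
    different labels.\<close>
  obtain r :: "nat \<Rightarrow> nat" where "\<forall>(a, e, b) \<in> G. r a < r b \<and> r b \<le> r t" using ttsp_rank[OF sp] by blast
  then have ne: "a \<noteq> b" "b \<noteq> d" using g by fastforce+
  have uv: "u \<noteq> v" using inj g ne unfolding inj_on_def by fastforce
  show ?thesis
  proof (rule reduced_step[OF red g uv])
    show "ttsp (insert (a, z, d) (G - {(a, u, b), (b, v, d)})) s t"
      by (rule ttsp_reduce_series[OF sp g u v reduced_fresh[OF red]])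
  qed (simp add: obeys_reduce_series[OF g _ u v ne])
qed

text \<open>With \<open>s \<noteq> t\<close> no edge leaves the node that the last edge enters, so
  only membership in \<open>fam\<close> remains of \<open>obeys\<close>.\<close>

lemma reduced_single:
  assumes "reduced C n s t {(s, r, t)} K L R z"
  obtains tr where "tree_arrays n z K L R tr" "tree_root n z L R r" "leaves (tr r) = {..<n}"
    "\<And>X. X \<subseteq> {..<n} \<Longrightarrow> C X \<longleftrightarrow> X \<in> fam (tr r)"
proof -
  from assms have sp: "ttsp {(s, r, t)} s t" and root: "tree_root n z L R r"
    and ex: "\<exists>tr. tree_arrays n z K L R tr \<and> leaves (tr r) = {..<n} \<and>
      (\<forall>X. X \<subseteq> {..<n} \<longrightarrow> (C X \<longleftrightarrow> obeys {(s, r, t)} tr X))" unfolding reduced_def by simp_all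
  from ex obtain tr where tr: "tree_arrays n z K L R tr" "leaves (tr r) = {..<n}"
    "\<forall>X. X \<subseteq> {..<n} \<longrightarrow> (C X \<longleftrightarrow> obeys {(s, r, t)} tr X)" by (elim exE conjE)
  have "s \<noteq> t" using ttsp_terminals[OF sp] by simp
  then have "obeys {(s, r, t)} tr X \<longleftrightarrow> X \<inter> leaves (tr r) \<in> fam (tr r)" for X
    unfolding obeys_def by auto
  then have "C X \<longleftrightarrow> X \<in> fam (tr r)" if "X \<subseteq> {..<n}" for X
    using tr(2,3) that by (simp add: Int_absorb2)
  then show ?thesis using that tr(1,2) root by blast
qed

section \<open>Building the multigraph\<close>

lemma nth_concat_pairs:
  "i < length l \<Longrightarrow> concat (map (\<lambda>(u, v). [u, v]) l) ! (2 * i) = fst (l ! i) \<and>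
    concat (map (\<lambda>(u, v). [u, v]) l) ! Suc (2 * i) = snd (l ! i)"
proof (induction l arbitrary: i)
  case (Cons p l)
  then show ?case by (cases i; cases p) auto
qed simp

lemma length_concat_pairs: "length (concat (map (\<lambda>(u, v). [u, v]) l)) = 2 * length l"
  by (induction l) auto

section \<open>Instances, word length and array length\<close>

locale msp_instance =
  fixes I :: ssg
  assumes inst: "ssg_instance I" and msp: "msp_digraph (ssg_graph I)"
begin

abbreviation "n \<equiv> num_items I"
abbreviation "m \<equiv> num_arcs I"
abbreviation "c \<equiv> capacity I"
abbreviation "alist \<equiv> arc_list I"
abbreviation "wt j \<equiv> sizes I ! j"

definition "W = word_bound 4 (encode I)"
text \<open>At most \<open>2 * n\<close> components have a table row of
  \<open>c + 1 \<le> 2 * c\<close> cells each; the other arrays fit into this length as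
  well.\<close>

definition "S = 4 * n * c"

sublocale ram W S "encode I" .

definition "wbase = length (encode I) + Max (set (encode I))"

lemma n_pos: "0 < n" and c_pos: "0 < c"
  using msp_wellformed[OF msp] inst by (auto simp: ssg_graph_def ssg_instance_def)

lemma arcs_less: "(u, v) \<in> set alist \<Longrightarrow> u < n \<and> v < n"
  using msp_wellformed[OF msp] by (auto simp: ssg_graph_def)

lemma size_pos: "j < n \<Longrightarrow> 0 < wt j"
  using inst by (auto simp: ssg_instance_def num_items_def)

lemma length_encode: "length (encode I) = 3 + n + 2 * m"
  by (simp add: encode_def num_items_def num_arcs_def length_concat_pairs)

lemma encode_header [simp]: "encode I ! 0 = n" "encode I ! Suc 0 = m" "encode I ! 2 = c"
  by (simp_all add: encode_def)

lemma encode_size: "j < n \<Longrightarrow> encode I ! (j + 3) = wt j"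
  by (simp add: encode_def nth_append num_items_def numeral_3_eq_3)

lemma encode_arc:
  assumes "i < m"
  shows "encode I ! (n + 3 + 2 * i) = fst (alist ! i)" "encode I ! (n + 4 + 2 * i) = snd (alist ! i)"
proof -
  have e: "encode I = ([n, m, c] @ sizes I) @ concat (map (\<lambda>(u, v). [u, v]) alist)"
    by (simp add: encode_def)
  have l: "length ([n, m, c] @ sizes I) = n + 3" by (simp add: num_items_def)
  have i: "n + 4 + 2 * i = n + 3 + Suc (2 * i)" by simp
  show "encode I ! (n + 3 + 2 * i) = fst (alist ! i)" "encode I ! (n + 4 + 2 * i) = snd (alist ! i)"
    unfolding i unfolding e nth_append l using nth_concat_pairs[of i alist] assms by (simp_all add: num_arcs_def)
qed

lemma encode_le: "i < length (encode I) \<Longrightarrow> encode I ! i \<le> wbase"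
  unfolding wbase_def by (intro trans_le_add2 Max_ge) simp_all

lemma header_le: "n \<le> wbase" "c \<le> wbase" "n + 2 * m + 3 \<le> wbase"
  using encode_le[of 0] encode_le[of 2] length_encode by (auto simp: wbase_def)

text \<open>Table addresses and total sizes reach the order of \<open>wbase * wbase\<close>. As
  \<open>wbase\<close> is at least 5, the exponent 4 leaves a factor of 25 for the
  constants.\<close>

lemma W_ge: "4 * (wbase * wbase) + 100 \<le> W"
proof -
  have "n \<le> Max (set (encode I))" by (rule Max_ge[OF finite_set]) (simp add: encode_def)
  then have "3 + n + 1 \<le> wbase" using length_encode n_pos unfolding wbase_def by linarith
  then have b: "5 \<le> wbase" using n_pos by simp
  have "25 \<le> wbase * wbase" using mult_le_mono[OF b b] by simp
  then have "25 * (wbase * wbase) \<le> wbase * wbase * (wbase * wbase)" by (rule mult_le_mono1)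
  also have "\<dots> = W" by (simp add: W_def word_bound_def wbase_def power4_eq_xxxx ac_simps)
  finally show ?thesis using \<open>25 \<le> wbase * wbase\<close> by linarith
qed

lemma wbase_le: "wbase \<le> wbase * wbase"
  by simp

lemma small_le_W [simp]: "k \<le> 2 * wbase + 100 \<Longrightarrow> k \<le> W"
  using W_ge wbase_le by linarith

lemma encode_le_W: "i < length (encode I) \<Longrightarrow> encode I ! i \<le> W"
  using encode_le[of i] by simp

lemma S_ge: "n + 2 \<le> S" "i < n + 2 \<Longrightarrow> i < S" "i < 2 * n \<Longrightarrow> i < S"
proof -
  have "n \<le> n * c" using c_pos by simp
  then have *: "4 * n \<le> S" by (simp add: S_def)
  show "n + 2 \<le> S" using * n_pos by linarith
  show "i < S" if "i < n + 2" using * that n_pos by linarith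
  show "i < S" if "i < 2 * n" using * that n_pos by linarith
qed

definition header :: "(nat \<Rightarrow> nat) \<Rightarrow> bool" where
  "header R \<longleftrightarrow> R 0 = n \<and> R 1 = m \<and> R 2 = c"

text \<open>A node of the multigraph is named by the least head of the alist that it collects; the two
  terminals are \<open>n + 1\<close> and \<open>n\<close>.\<close>

definition line_graph :: "(nat \<Rightarrow> nat) \<Rightarrow> (nat \<Rightarrow> nat) \<Rightarrow> bool" where
  "line_graph hn tn \<longleftrightarrow> ttsp ((\<lambda>e. (tn e, e, hn e)) ` {..<n}) (Suc n) n \<and>
    (\<forall>e<n. hn e < n + 2 \<and> tn e < n + 2) \<and>
    (\<forall>X. X \<subseteq> {..<n} \<longrightarrow> ((\<forall>(u, v) \<in> set alist. u \<in> X \<longrightarrow> v \<in> X) \<longleftrightarrow>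
      (\<forall>u<n. \<forall>v<n. hn u = tn v \<longrightarrow> u \<in> X \<longrightarrow> v \<in> X)))"

text \<open>The initial head \<open>n\<close> exceeds every item, so the running minimum needs no
  special case, and an item without out-neighbours ends up at the sink, which has this very
  name.\<close>

definition heads_upto where
  "heads_upto i hn \<longleftrightarrow> (\<forall>u<n. (hn u = n \<or> (u, hn u) \<in> set (take i alist)) \<and>
    (\<forall>v. (u, v) \<in> set (take i alist) \<longrightarrow> hn u \<le> v) \<and> hn u \<le> n)"

definition tails_upto where
  "tails_upto i hn tn \<longleftrightarrow> (\<forall>v<n. (tn v = Suc n \<and> (\<forall>u. (u, v) \<notin> set (take i alist))) \<or>
    (\<exists>u. (u, v) \<in> set (take i alist) \<and> tn v = (hn u :: nat)))"

text \<open>Two in-neighbours of \<open>v\<close> have the same out-neighbours, hence the same least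
  one, so whichever of them sets the tail of \<open>v\<close>, the result is the same. Conversely
  \<open>hn u\<close> is itself an out-neighbour of \<open>u\<close>, so equal heads come from a
  common out-neighbour.\<close>

lemma line_graphI:
  assumes h: "heads_upto m hn" and t: "tails_upto m hn tn"
  shows "line_graph hn tn"
proof -
  let ?G = "ssg_graph I"
  have E: "set (take m alist) = set alist" by (simp add: num_arcs_def)
  have hE: "hn u = n \<or> (u, hn u) \<in> set alist" "(u, v) \<in> set alist \<Longrightarrow> hn u \<le> v" "hn u \<le> n" if "u < n" for u v
    using h that unfolding heads_upto_def E by auto
  have tE: "(tn v = Suc n \<and> (\<forall>u. (u, v) \<notin> set alist)) \<or> (\<exists>u. (u, v) \<in> set alist \<and> tn v = hn u)" if "v < n" for v
    using t that unfolding tails_upto_def E by blast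
  have nbrs: "(u', w) \<in> set alist" if "(u, v) \<in> set alist" "(u', v) \<in> set alist" "(u, w) \<in> set alist" for u v u' w
    using msp_out_nbrs[OF msp, of u v u' w] that by (simp add: ssg_graph_def)
  have hn_arc: "(u, hn u) \<in> set alist" "hn u < n" if "(u, v) \<in> set alist" for u v
    using hE(1)[of u] hE(2)[of u v] arcs_less[OF that] that by auto
  have same: "hn u = hn u'" if "(u, v) \<in> set alist" "(u', v) \<in> set alist" for u v u'
  proof (rule antisym)
    show "hn u \<le> hn u'" using nbrs[OF that(2,1)] hn_arc[OF that(2)] hE(2)[of u] arcs_less[OF that(1)] by blast
    show "hn u' \<le> hn u" using nbrs[OF that] hn_arc[OF that(1)] hE(2)[of u'] arcs_less[OF that(2)] by blast
  qed
  have arc_iff: "hn u = tn v \<longleftrightarrow> (u, v) \<in> set alist" if u: "u < n" and v: "v < n" for u v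
  proof
    assume eq: "hn u = tn v"
    from tE[OF v] hE(3)[OF u] eq obtain u' where u': "(u', v) \<in> set alist" "tn v = hn u'" by auto
    have "(u, hn u) \<in> set alist" using hE(1)[OF u] hn_arc(2)[OF u'(1)] u' eq by auto
    then show "(u, v) \<in> set alist" using nbrs[of u' "hn u" u v] hn_arc(1)[OF u'(1)] u' eq by simp
  next
    assume a: "(u, v) \<in> set alist"
    then obtain u' where "(u', v) \<in> set alist" "tn v = hn u'" using tE[OF v] by blast
    then show "hn u = tn v" using same[OF a] by simp
  qed
  have V: "pverts ?G = {..<n}" and A: "parcs ?G = set alist" by (simp_all add: ssg_graph_def)
  have "ttsp ((\<lambda>e. (tn e, e, hn e)) ` pverts ?G) (Suc n) n"
  proof (rule msp_ttsp[OF msp])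
    show "hn u = tn v \<longleftrightarrow> (u, v) \<in> parcs ?G" if "u \<in> pverts ?G" "v \<in> pverts ?G" for u v
      using arc_iff that by (simp add: V A)
    show "hn u = n \<longleftrightarrow> u \<in> sinks ?G" if "u \<in> pverts ?G" for u
      using hE(1)[of u] hn_arc(2)[of u] that by (auto simp: V A msp_sinks_iff[OF msp])
    show "tn u = Suc n \<longleftrightarrow> u \<in> sources ?G" if "u \<in> pverts ?G" for u
      using tE[of u] that hn_arc(2) by (fastforce simp: V A msp_sources_iff[OF msp])
    show "hn u \<noteq> Suc n \<and> tn u \<noteq> n" if "u \<in> pverts ?G" for u
      using tE[of u] hE(3)[of u] that hn_arc(2) by (fastforce simp: V)
  qed simp
  moreover have "hn e < n + 2 \<and> tn e < n + 2" if "e < n" for e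
    using tE[OF that] hE(3)[OF that] hn_arc(2) by fastforce
  moreover have "(\<forall>(u, v) \<in> set alist. u \<in> X \<longrightarrow> v \<in> X) \<longleftrightarrow> (\<forall>u<n. \<forall>v<n. hn u = tn v \<longrightarrow> u \<in> X \<longrightarrow> v \<in> X)" for X
    using arc_iff arcs_less by blast
  ultimately show ?thesis unfolding line_graph_def V by blast
qed

end

text \<open>
  Registers 0, 1, 2 hold \<open>n\<close>, \<open>m\<close>, \<open>c\<close>, and later register 9 the number of components and
  register 13 the row length \<open>c + 1\<close> of the tables. Arrays 1 and 2 contain the head and the tail of
  each item as an edge of the multigraph; 3, 4 and 5, 6 the lists (first element, successor) of the
  incoming and outgoing edges of each node; 7 the number of unremoved incoming edges; 8 the nodes in
  topological order; 9 the number of outgoing edges; 10, 11, 12 the functions \<open>acc\<close>, \<open>par\<close>, \<open>inn\<close> of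
  the reduction; 13, 14, 15 the decomposition tree \<open>K\<close>, \<open>L\<close>, \<open>R\<close>; 16 the tables and 17 the total size
  of each component; 0 the size assigned to each component and finally the output.
\<close>

definition "arc_tail = Input (Add (Add (Reg 0) (Const 3)) (Mul (Const 2) (Reg 3)))"
definition "arc_head = Input (Add (Add (Reg 0) (Const 4)) (Mul (Const 2) (Reg 3)))"

definition read_header :: com where
  "read_header = Seq (Assign 0 (Input (Const 0))) (Seq (Assign 1 (Input (Const 1))) (Assign 2 (Input (Const 2))))"

definition init_nodes :: com where
  "init_nodes = For 3 0 (Seq (Store 1 (Reg 3) (Reg 0)) (Store 2 (Reg 3) (Add (Reg 0) (Const 1))))"

definition min_head :: com where
  "min_head = Seq (Assign 4 arc_tail) (Seq (Assign 5 arc_head)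
    (If (Less (Reg 5) (Cell 1 (Reg 4))) (Store 1 (Reg 4) (Reg 5)) Skip))"

definition set_tail :: com where
  "set_tail = Seq (Assign 4 arc_tail) (Seq (Assign 5 arc_head) (Store 2 (Reg 5) (Cell 1 (Reg 4))))"

definition build_graph :: com where
  "build_graph = Seq read_header (Seq init_nodes (Seq (For 3 1 min_head) (For 3 1 set_tail)))"

context msp_instance
begin

lemma wp_read_header:
  assumes "\<And>R' k'. header R' \<Longrightarrow> k' \<le> k + 20 \<Longrightarrow> Q (R', M) k'"
  shows "wp read_header Q (R, M) k"
  unfolding read_header_def
  by (rule vc_wp) (use length_encode encode_le_W[of 0] encode_le_W[of 1] encode_le_W[of 2] in
    \<open>auto intro!: assms simp: header_def\<close>)

lemma wp_init_nodes:
  assumes "header R"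
    and "\<And>R' M' k'. header R' \<Longrightarrow> \<forall>u<n. M' 1 u = n \<and> M' 2 u = Suc n \<Longrightarrow>
      \<forall>a. a \<noteq> 1 \<longrightarrow> a \<noteq> 2 \<longrightarrow> M' a = M a \<Longrightarrow> k' \<le> k + (n * 30 + 7) \<Longrightarrow> Q (R', M') k'"
  shows "wp init_nodes Q (R, M) k"
  unfolding init_nodes_def
  by (rule wp_For[where T = 21 and N = n and
        I = "\<lambda>i R' M'. header R' \<and> (\<forall>u<i. M' 1 u = n \<and> M' 2 u = Suc n) \<and> (\<forall>a. a \<noteq> 1 \<longrightarrow> a \<noteq> 2 \<longrightarrow> M' a = M a)"];
      (rule vc_wp)?; use assms header_le in \<open>auto simp: header_def S_ge less_Suc_eq\<close>)

lemma take_Suc_arcs: "i < m \<Longrightarrow> take (Suc i) alist = take i alist @ [alist ! i]"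
  by (simp add: take_Suc_conv_app_nth num_arcs_def)

lemma nth_arcs_less: "i < m \<Longrightarrow> fst (alist ! i) < n \<and> snd (alist ! i) < n"
  using arcs_less[of "fst (alist ! i)" "snd (alist ! i)"] by (simp add: num_arcs_def)

text \<open>The fetch with which both scans of the arc list begin: it brings the two ends of the
  current arc into registers 4 and 5.\<close>

lemma wp_arc:
  assumes "header R" "R 3 = i" "i < m"
    and "\<And>k'. k' \<le> k + 25 \<Longrightarrow> wp p Q (R(4 := fst (alist ! i), 5 := snd (alist ! i)), M) k'"
  shows "wp (Seq (Assign 4 arc_tail) (Seq (Assign 5 arc_head) p)) Q (R, M) k"
proof -
  have le: "encode I ! (n + 3 + 2 * i) \<le> W" "encode I ! (n + 4 + 2 * i) \<le> W"
    using encode_le_W[of "n + 3 + 2 * i"] encode_le_W[of "n + 4 + 2 * i"] length_encode assms(3) by simp_all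
  note arc = le[unfolded encode_arc[OF assms(3)]] encode_arc[OF assms(3)]
  have h: "R 0 = n" using assms(1) by (simp add: header_def)
  show ?thesis
  proof (rule wp_Seq, rule vc_wp)
    show "vc (Assign 4 arc_tail) (\<lambda>\<tau> k'. wp (Seq (Assign 5 arc_head) p) Q \<tau> (k' + 1)) (R, M) k"
      unfolding arc_tail_def vc.simps safe.simps av.simps fst_conv snd_conv h assms(2) arc
    proof (intro conjI arc)
      show "wp (Seq (Assign 5 arc_head) p) Q (R(4 := fst (alist ! i)), M)
        (k + (acost (Input (Add (Add (Reg 0) (Const 3)) (Mul (Const 2) (Reg 3)))) + 1) + 1)"
      proof (rule wp_Seq, rule vc_wp)
        have h': "(R(4 := fst (alist ! i))) 0 = n" "(R(4 := fst (alist ! i))) 3 = i" using h assms(2) by simp_all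
        show "vc (Assign 5 arc_head) (\<lambda>\<tau> k'. wp p Q \<tau> (k' + 1)) (R(4 := fst (alist ! i)), M)
          (k + (acost (Input (Add (Add (Reg 0) (Const 3)) (Mul (Const 2) (Reg 3)))) + 1) + 1)"
          unfolding arc_head_def vc.simps safe.simps av.simps fst_conv snd_conv h' arc
          by (intro conjI arc assms(4)) (use header_le length_encode assms(3) in simp_all)
      qed
    qed (use header_le length_encode assms(3) in simp_all)
  qed
qed

lemma wp_min_heads:
  assumes "header R" "\<forall>u<n. M 1 u = n"
    and "\<And>R' M' k'. header R' \<Longrightarrow> heads_upto m (M' 1) \<Longrightarrow>
      \<forall>a. a \<noteq> 1 \<longrightarrow> M' a = M a \<Longrightarrow> k' \<le> k + (m * 59 + 7) \<Longrightarrow> Q (R', M') k'"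
  shows "wp (For 3 1 min_head) Q (R, M) k"
proof (rule wp_For[where T = 50 and N = m and
    I = "\<lambda>i R' M'. header R' \<and> heads_upto i (M' 1) \<and> (\<forall>a. a \<noteq> 1 \<longrightarrow> M' a = M a)"])
  show "header (R(3 := 0)) \<and> heads_upto 0 (M 1) \<and> (\<forall>a. a \<noteq> 1 \<longrightarrow> M a = M a)"
    using assms by (auto simp: header_def heads_upto_def)
  fix i R' M' k'
  assume I: "header R' \<and> heads_upto i (M' 1) \<and> (\<forall>a. a \<noteq> 1 \<longrightarrow> M' a = M a)" "R' 3 = i" "i < m"
  obtain u v where uv: "alist ! i = (u, v)" by (cases "alist ! i")
  have less: "u < n" "v < n" using nth_arcs_less[OF I(3)] uv by auto
  have "heads_upto (Suc i) ((M' 1)(u := v))" if "v < M' 1 u"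
    using I(1) that less by (auto simp: heads_upto_def take_Suc_arcs[OF I(3)] uv) (meson less_le_trans less_imp_le)
  moreover have "heads_upto (Suc i) (M' 1)" if "\<not> v < M' 1 u"
    using I(1) that less by (auto simp: heads_upto_def take_Suc_arcs[OF I(3)] uv)
  ultimately show "wp min_head
    (\<lambda>\<tau> k2. (header ((fst \<tau>)(3 := Suc i)) \<and> heads_upto (Suc i) (snd \<tau> 1) \<and> (\<forall>a. a \<noteq> 1 \<longrightarrow> snd \<tau> a = M a)) \<and>
      fst \<tau> 3 = i \<and> fst \<tau> 1 = m \<and> k2 \<le> k' + 50) (R', M') k'"
    unfolding min_head_def using I less by (intro wp_arc vc_wp) (auto simp: header_def uv[folded I(2)] S_ge)
qed (use assms in \<open>auto simp: header_def\<close>)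

lemma wp_set_tails:
  assumes "header R" "\<forall>u<n. M 2 u = Suc n"
    and "\<And>R' M' k'. header R' \<Longrightarrow> tails_upto m (M 1) (M' 2) \<Longrightarrow>
      \<forall>a. a \<noteq> 2 \<longrightarrow> M' a = M a \<Longrightarrow> k' \<le> k + (m * 59 + 7) \<Longrightarrow> Q (R', M') k'"
  shows "wp (For 3 1 set_tail) Q (R, M) k"
proof (rule wp_For[where T = 50 and N = m and
    I = "\<lambda>i R' M'. header R' \<and> tails_upto i (M 1) (M' 2) \<and> (\<forall>a. a \<noteq> 2 \<longrightarrow> M' a = M a)"])
  show "header (R(3 := 0)) \<and> tails_upto 0 (M 1) (M 2) \<and> (\<forall>a. a \<noteq> 2 \<longrightarrow> M a = M a)"
    using assms by (auto simp: header_def tails_upto_def)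
  fix i R' M' k'
  assume I: "header R' \<and> tails_upto i (M 1) (M' 2) \<and> (\<forall>a. a \<noteq> 2 \<longrightarrow> M' a = M a)" "R' 3 = i" "i < m"
  obtain u v where uv: "alist ! i = (u, v)" by (cases "alist ! i")
  have less: "u < n" "v < n" using nth_arcs_less[OF I(3)] uv by auto
  have "tails_upto (Suc i) (M 1) ((M' 2)(v := M 1 u))"
    using I(1) less by (auto simp: tails_upto_def take_Suc_arcs[OF I(3)] uv)
  then show "wp set_tail
    (\<lambda>\<tau> k2. (header ((fst \<tau>)(3 := Suc i)) \<and> tails_upto (Suc i) (M 1) (snd \<tau> 2) \<and> (\<forall>a. a \<noteq> 2 \<longrightarrow> snd \<tau> a = M a)) \<and>
      fst \<tau> 3 = i \<and> fst \<tau> 1 = m \<and> k2 \<le> k' + 50) (R', M') k'"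
    unfolding set_tail_def using I less by (intro wp_arc vc_wp) (auto simp: header_def uv[folded I(2)] S_ge)
qed (use assms in \<open>auto simp: header_def\<close>)

lemma wp_build_graph:
  assumes "\<And>R' M' k'. header R' \<Longrightarrow> line_graph (M' 1) (M' 2) \<Longrightarrow>
      \<forall>a. a \<noteq> 1 \<longrightarrow> a \<noteq> 2 \<longrightarrow> M' a = M a \<Longrightarrow> k' \<le> k + (30 * n + 118 * m + 50) \<Longrightarrow> Q (R', M') k'"
  shows "wp build_graph Q (R, M) k"
  unfolding build_graph_def
proof (rule wp_Seq, rule wp_read_header, rule wp_Seq, erule wp_init_nodes, rule wp_Seq, erule wp_min_heads)
  fix R1 k1 R2 M2 k2 R3 M3 k3
  assume k1: "k1 \<le> k + 20" and M2: "\<forall>u<n. M2 1 u = n \<and> M2 2 u = Suc n" "\<forall>a. a \<noteq> 1 \<longrightarrow> a \<noteq> 2 \<longrightarrow> M2 a = M a"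
    and k2: "k2 \<le> k1 + 1 + (n * 30 + 7)"
  show "\<forall>u<n. M2 1 u = n" using M2 by simp
  assume R3: "header R3" and M3: "heads_upto m (M3 1)" "\<forall>a. a \<noteq> 1 \<longrightarrow> M3 a = M2 a"
    and k3: "k3 \<le> k2 + 1 + (m * 59 + 7)"
  show "wp (For 3 1 set_tail) Q (R3, M3) (k3 + 1)"
  proof (rule wp_set_tails[OF R3])
    show "\<forall>u<n. M3 2 u = Suc n" using M2 M3 by simp
    fix R4 M4 k4
    assume "header R4" "tails_upto m (M3 1) (M4 2)" "\<forall>a. a \<noteq> 2 \<longrightarrow> M4 a = M3 a" "k4 \<le> k3 + 1 + (m * 59 + 7)"
    then show "Q (R4, M4) k4" using M2 M3 k1 k2 k3 by (intro assms) (auto intro!: line_graphI)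
  qed
qed

end

section \<open>Incidence lists\<close>

text \<open>Linked lists grow at the front, hence the reversal.\<close>

definition bucket :: "(nat \<Rightarrow> nat) \<Rightarrow> nat \<Rightarrow> nat \<Rightarrow> nat list" where
  "bucket key i b = rev (filter (\<lambda>e. key e = b) [0..<i])"

lemma bucket_0 [simp]: "bucket key 0 b = []"
  by (simp add: bucket_def)

lemma bucket_Suc: "bucket key (Suc i) b = (if key i = b then i # bucket key i b else bucket key i b)"
  by (simp add: bucket_def)

lemma set_bucket [simp]: "set (bucket key i b) = {e. e < i \<and> key e = b}"
  by (auto simp: bucket_def)

lemma distinct_bucket [simp]: "distinct (bucket key i b)"
  by (simp add: bucket_def)

lemma length_bucket: "length (bucket key i b) = card {e. e < i \<and> key e = b}"
  using distinct_card[OF distinct_bucket, of key i b] by simp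

lemma length_bucket_le: "length (bucket key i b) \<le> i"
  by (auto simp: bucket_def intro: order.trans[OF length_filter_le])

text \<open>Linked lists store \<open>e + 1\<close> for the element \<open>e\<close>, so that 0 can mark the end.\<close>

primrec linked :: "(nat \<Rightarrow> nat) \<Rightarrow> nat \<Rightarrow> nat list \<Rightarrow> bool" where
  "linked nx h [] \<longleftrightarrow> h = 0"
| "linked nx h (e # es) \<longleftrightarrow> h = Suc e \<and> linked nx (nx e) es"

lemma linked_upd: "e \<notin> set es \<Longrightarrow> linked (nx(e := y)) h es = linked nx h es"
  by (induction es arbitrary: h) auto

definition insert_edge :: "nat \<Rightarrow> nat \<Rightarrow> nat \<Rightarrow> nat \<Rightarrow> com" where
  "insert_edge key h nx cnt =
    Seq (Store nx (Reg 3) (Cell h (Cell key (Reg 3))))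
    (Seq (Store h (Cell key (Reg 3)) (Add (Reg 3) (Const 1)))
         (Store cnt (Cell key (Reg 3)) (Add (Cell cnt (Cell key (Reg 3))) (Const 1))))"

definition build_list :: "nat \<Rightarrow> nat \<Rightarrow> nat \<Rightarrow> nat \<Rightarrow> com" where
  "build_list key h nx cnt = For 3 0 (insert_edge key h nx cnt)"

definition release_edge :: com where
  "release_edge =
    Seq (Assign 8 (Cell 1 (Sub (Reg 7) (Const 1))))
    (Seq (Store 7 (Reg 8) (Sub (Cell 7 (Reg 8)) (Const 1)))
    (Seq (If (Equal (Cell 7 (Reg 8)) (Const 0))
           (Seq (Store 8 (Reg 5) (Reg 8)) (Assign 5 (Add (Reg 5) (Const 1)))) Skip)
         (Assign 7 (Cell 6 (Sub (Reg 7) (Const 1))))))"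

definition release_node :: com where
  "release_node =
    Seq (Seq (Assign 6 (Cell 8 (Reg 4))) (Seq (Assign 4 (Add (Reg 4) (Const 1))) (Assign 7 (Cell 5 (Reg 6)))))
      (While (Less (Const 0) (Reg 7)) release_edge)"

text \<open>Array 8 serves as a queue with read position in register 4 and write position in
  register 5; what has passed through the queue is the order itself.\<close>

definition topo_order :: com where
  "topo_order = Seq
    (Seq (Store 8 (Const 0) (Add (Reg 0) (Const 1))) (Seq (Assign 4 (Const 0)) (Assign 5 (Const 1))))
    (While (Less (Reg 4) (Reg 5))
      release_node)"

lemma (in ram) wp_Seq_vc: "vc p (\<lambda>\<tau> k'. wp q Q \<tau> (k' + 1)) \<sigma> k \<Longrightarrow> wp (Seq p q) Q \<sigma> k"
  by (intro wp_Seq vc_wp)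

locale multigraph = msp_instance +
  fixes hn tn :: "nat \<Rightarrow> nat"
  assumes line_graph: "line_graph hn tn"
begin

definition "G0 = (\<lambda>e. (tn e, e, hn e)) ` {..<n}"

lemma mem_G0 [simp]: "(a, e, b) \<in> G0 \<longleftrightarrow> e < n \<and> a = tn e \<and> b = hn e"
  by (auto simp: G0_def)

lemma ttsp_G0: "ttsp G0 (Suc n) n"
  using line_graph by (simp add: line_graph_def G0_def)

lemma hn_less: "e < n \<Longrightarrow> hn e < n + 2" and tn_less: "e < n \<Longrightarrow> tn e < n + 2"
  using line_graph by (simp_all add: line_graph_def)

lemma hn_tn_S [simp]: "e < n \<Longrightarrow> hn e < S" "e < n \<Longrightarrow> tn e < S" "e < n \<Longrightarrow> e < S"
  using hn_less tn_less by (simp_all add: S_ge)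

lemma hn_not_source: "e < n \<Longrightarrow> hn e \<noteq> Suc n"
  using ttsp_no_in_source[OF ttsp_G0, of "tn e" e] by auto

lemma n_le_W [simp]: "k \<le> n + 3 \<Longrightarrow> k \<le> W"
  using header_le by simp

lemma wp_build_list:
  assumes "distinct [key, h, nx, cnt]" "header R" "M key = f" "\<And>e. e < n \<Longrightarrow> f e < S"
    and "M h = (\<lambda>_. 0)" "M cnt = (\<lambda>_. 0)"
    and "\<And>R' M' k'. header R' \<Longrightarrow> \<forall>b. linked (M' nx) (M' h b) (bucket f n b) \<Longrightarrow>
      M' cnt = (\<lambda>b. length (bucket f n b)) \<Longrightarrow> \<forall>a. a \<notin> {h, nx, cnt} \<longrightarrow> M' a = M a \<Longrightarrow>
      k' \<le> k + (n * 39 + 7) \<Longrightarrow> Q (R', M') k'"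
  shows "wp (build_list key h nx cnt) Q (R, M) k"
  unfolding build_list_def
proof (rule wp_For[where T = 30 and N = n and
    I = "\<lambda>i R' M'. header R' \<and> (\<forall>b. linked (M' nx) (M' h b) (bucket f i b)) \<and>
      M' cnt = (\<lambda>b. length (bucket f i b)) \<and> (\<forall>a. a \<notin> {h, nx, cnt} \<longrightarrow> M' a = M a)"])
  fix i R' M' k'
  assume I: "header R' \<and> (\<forall>b. linked (M' nx) (M' h b) (bucket f i b)) \<and>
    M' cnt = (\<lambda>b. length (bucket f i b)) \<and> (\<forall>a. a \<notin> {h, nx, cnt} \<longrightarrow> M' a = M a)" "R' 3 = i" "i < n"
  have le: "length (bucket f i b) < n" for b
    using length_bucket_le[of f i b] I(3) by simp
  have W: "i + 1 \<le> W" "length (bucket f i b) + 1 \<le> W" "1 \<le> W" for b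
    using le[of b] I(3) by (auto intro!: n_le_W)
  have R: "R' 0 = n" "R' 1 = m" "R' 2 = c" using I(1) by (simp_all add: header_def)
  have key: "M' key = f" using I(1) assms(1,3) by simp
  have cnt: "M' cnt = (\<lambda>b. length (bucket f i b))" using I(1) by simp
  have lk: "linked ((M' nx)(i := y)) z (bucket f i b) = linked (M' nx) z (bucket f i b)" for b y z
    by (auto intro!: linked_upd)
  have ne: "key \<noteq> h" "key \<noteq> nx" "key \<noteq> cnt" "h \<noteq> nx" "h \<noteq> cnt" "nx \<noteq> cnt" using assms(1) by auto
  note ne = ne ne[symmetric]
  show "wp (insert_edge key h nx cnt)
    (\<lambda>\<tau> k2. (header ((fst \<tau>)(3 := Suc i)) \<and> (\<forall>b. linked (snd \<tau> nx) (snd \<tau> h b) (bucket f (Suc i) b)) \<and>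
      snd \<tau> cnt = (\<lambda>b. length (bucket f (Suc i) b)) \<and> (\<forall>a. a \<notin> {h, nx, cnt} \<longrightarrow> snd \<tau> a = M a)) \<and>
      fst \<tau> 3 = i \<and> fst \<tau> 0 = n \<and> k2 \<le> k' + 30) (R', M') k'"
    by (rule vc_wp) (use I(1) W in
      \<open>auto simp: insert_edge_def R key cnt I(2,3) header_def bucket_Suc lk ne assms(4) fun_eq_iff S_ge\<close>)
qed (use assms in \<open>auto simp: header_def\<close>)

section \<open>Topological order of the nodes\<close>

text \<open>\<open>U\<close> are the edges not yet removed, \<open>ord\<close> the nodes without incoming edges in \<open>U\<close>.\<close>

definition kahn :: "nat set \<Rightarrow> nat list \<Rightarrow> (nat \<Rightarrow> nat) \<Rightarrow> bool" where
  "kahn U ord pend \<longleftrightarrow> U \<subseteq> {..<n} \<and> (\<forall>b. pend b = card {e \<in> U. hn e = b}) \<and>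
    distinct ord \<and> ord \<noteq> [] \<and> ord ! 0 = Suc n \<and>
    set ord = insert (Suc n) {hn e |e. e < n \<and> hn e \<notin> hn ` U} \<and>
    (\<forall>e<n. e \<notin> U \<longrightarrow> tn e \<in> set ord) \<and>
    (\<forall>j<length ord. \<forall>e<n. hn e = ord ! j \<longrightarrow> tn e \<in> set (take j ord))"

lemma kahn_init: "kahn {..<n} [Suc n] (\<lambda>b. length (bucket hn n b))"
  using hn_not_source by (auto simp: kahn_def length_bucket intro!: arg_cong[of _ _ card])

lemma kahn_step:
  assumes k: "kahn U ord pend" and e: "e \<in> U" "tn e \<in> set ord"
  shows "0 < pend (hn e)"
    and "pend (hn e) - 1 = 0 \<Longrightarrow> kahn (U - {e}) (ord @ [hn e]) (pend(hn e := pend (hn e) - 1))"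
    and "pend (hn e) - 1 \<noteq> 0 \<Longrightarrow> kahn (U - {e}) ord (pend(hn e := pend (hn e) - 1))"
    and "length ord < n + 2"
proof -
  let ?p = "pend(hn e := pend (hn e) - 1)" and ?U = "U - {e}"
  have U: "U \<subseteq> {..<n}" and fin: "finite U" and en: "e < n"
    using k e(1) finite_subset[of U "{..<n}"] by (auto simp: kahn_def)
  have pend: "pend b = card {e \<in> U. hn e = b}" for b using k by (simp add: kahn_def)
  have ord: "distinct ord" "ord \<noteq> []" "ord ! 0 = Suc n"
    "set ord = insert (Suc n) {hn e |e. e < n \<and> hn e \<notin> hn ` U}"
    "\<And>e. e < n \<Longrightarrow> e \<notin> U \<Longrightarrow> tn e \<in> set ord"
    "\<And>j e. j < length ord \<Longrightarrow> e < n \<Longrightarrow> hn e = ord ! j \<Longrightarrow> tn e \<in> set (take j ord)"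
    using k unfolding kahn_def by blast+
  have "e \<in> {e' \<in> U. hn e' = hn e}" using e by simp
  then show "0 < pend (hn e)" unfolding pend using fin by (auto simp: card_gt_0_iff)
  have p: "?p b = card {e' \<in> ?U. hn e' = b}" for b
  proof (cases "b = hn e")
    case True
    have "{e' \<in> ?U. hn e' = b} = {e' \<in> U. hn e' = b} - {e}" by auto
    then show ?thesis using True e(1) fin by (simp add: pend card_Diff_singleton)
  next
    case False
    then have "{e' \<in> ?U. hn e' = b} = {e' \<in> U. hn e' = b}" by auto
    then show ?thesis using False by (simp add: pend)
  qed
  \<comment> \<open>The edge \<open>e\<close> itself still enters \<open>hn e\<close>, so this node
    cannot be listed yet.\<close>
  have "hn e \<in> hn ` U" using e(1) by (rule imageI)
  then have new: "hn e \<notin> set ord" using ord(4) hn_not_source[OF en] by auto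
  have tails: "tn e' \<in> set ord" if "e' < n" "e' \<notin> ?U" for e' using ord(5)[of e'] that e(2) by auto
  have zero: "pend (hn e) - 1 = 0 \<longleftrightarrow> hn e \<notin> hn ` ?U"
  proof -
    have "pend (hn e) - 1 = card {e' \<in> ?U. hn e' = hn e}" using p[of "hn e"] by simp
    moreover have "finite {e' \<in> ?U. hn e' = hn e}" using fin by simp
    ultimately have "pend (hn e) - 1 = 0 \<longleftrightarrow> {e' \<in> ?U. hn e' = hn e} = {}" by simp
    moreover have "hn e \<in> hn ` ?U \<longleftrightarrow> (\<exists>e' \<in> ?U. hn e' = hn e)" by (auto simp: image_iff eq_commute[of "hn e"])
    ultimately show ?thesis by auto
  qed
  have other: "x \<notin> hn ` ?U \<longleftrightarrow> x \<notin> hn ` U" if "x \<noteq> hn e" for x using that by auto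
  show "kahn ?U (ord @ [hn e]) ?p" if z: "pend (hn e) - 1 = 0"
  proof -
    have *: "hn e \<notin> hn ` ?U" using z zero by simp
    have "set (ord @ [hn e]) = insert (Suc n) {hn e' |e'. e' < n \<and> hn e' \<notin> hn ` ?U}"
    proof (rule set_eqI)
      fix b
      show "b \<in> set (ord @ [hn e]) \<longleftrightarrow> b \<in> insert (Suc n) {hn e' |e'. e' < n \<and> hn e' \<notin> hn ` ?U}"
        using * en other[of b] ord(4) by (cases "b = hn e") auto
    qed
    moreover have "tn e' \<in> set (take j (ord @ [hn e]))"
      if j: "j < length (ord @ [hn e])" "e' < n" "hn e' = (ord @ [hn e]) ! j" for j e'
    proof (cases "j < length ord")
      case True
      then show ?thesis using ord(6)[of j e'] j by (simp add: nth_append)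
    next
      case False
      then have "hn e' = hn e" "j = length ord" using j by (simp_all add: less_Suc_eq)
      moreover have "e' \<notin> ?U" using * calculation(1) by (metis imageI)
      ultimately show ?thesis using tails j(2) by simp
    qed
    moreover have "distinct (ord @ [hn e])" using ord(1) new by simp
    ultimately show ?thesis unfolding kahn_def using ord(2,3) U p tails by (auto simp: nth_append)
  qed
  show "kahn ?U ord ?p" if z: "pend (hn e) - 1 \<noteq> 0"
  proof -
    have *: "hn e \<in> hn ` ?U" using z zero by simp
    have "set ord = insert (Suc n) {hn e' |e'. e' < n \<and> hn e' \<notin> hn ` ?U}"
    proof (rule set_eqI)
      fix b
      show "b \<in> set ord \<longleftrightarrow> b \<in> insert (Suc n) {hn e' |e'. e' < n \<and> hn e' \<notin> hn ` ?U}"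
        using * en other[of b] ord(4) new hn_not_source[OF en] by (cases "b = hn e") auto
    qed
    then show ?thesis unfolding kahn_def using ord U p tails by blast
  qed
  \<comment> \<open>\<open>hn e\<close> is a node beyond those listed, so the next free position of
    the order lies below the number \<open>n + 2\<close> of node names and hence inside the
    array.\<close>
  have "set (hn e # ord) \<subseteq> {..<n + 2}" using ord(4) hn_less en by auto
  then have "card (set (hn e # ord)) \<le> n + 2" using card_mono[of "{..<n + 2}" "set (hn e # ord)"] by simp
  then show "length ord < n + 2" using new ord(1) by (simp add: distinct_card)
qed

lemma kahn_length: "kahn U ord pend \<Longrightarrow> length ord \<le> n + 2"
proof -
  assume k: "kahn U ord pend"
  then have "set ord \<subseteq> {..<n + 2}" using hn_less by (auto simp: kahn_def)
  then have "card (set ord) \<le> n + 2" using card_mono[of "{..<n + 2}" "set ord"] by simp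
  moreover have "distinct ord" using k by (simp add: kahn_def)
  ultimately show "length ord \<le> n + 2" using distinct_card[of ord] by linarith
qed

definition topological :: "nat list \<Rightarrow> bool" where
  "topological ord \<longleftrightarrow> distinct ord \<and> ord \<noteq> [] \<and> ord ! 0 = Suc n \<and> set ord = nodes G0 \<and>
    (\<forall>j<length ord. \<forall>e<n. hn e = ord ! j \<longrightarrow> tn e \<in> set (take j ord))"

text \<open>Otherwise take an unremoved edge whose tail has least rank. The tail is not the source,
  so some edge enters it; as the tail is not listed, an unremoved edge enters it, and this one
  starts lower still.\<close>

lemma kahn_final:
  assumes k: "kahn {e. e < n \<and> tn e \<notin> set ord} ord pend"
  shows "topological ord"
proof -
  let ?U = "{e. e < n \<and> tn e \<notin> set ord}"
  obtain r :: "nat \<Rightarrow> nat" where r: "\<forall>(a, e, b) \<in> G0. r a < r b \<and> r b \<le> r n"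
    using ttsp_rank[OF ttsp_G0] by blast
  have ord: "set ord = insert (Suc n) {hn e |e. e < n \<and> hn e \<notin> hn ` ?U}" using k by (simp add: kahn_def)
  have "False" if "e \<in> ?U" for e
    using that
  proof (induction "r (tn e)" arbitrary: e rule: less_induct)
    case less
    then have "tn e \<in> nodes G0" "tn e \<noteq> Suc n" using nodesI(1)[of "tn e" e "hn e" G0] ord by auto
    then obtain e' where e': "e' < n" "hn e' = tn e" using ttsp_ex_in[OF ttsp_G0] by fastforce
    have "hn e' \<in> hn ` ?U"
    proof (rule ccontr)
      assume "hn e' \<notin> hn ` ?U"
      then have "hn e' \<in> set ord" using e'(1) by (subst ord) blast
      then show False using less.prems e' by simp
    qed
    then obtain e2 where e2: "e2 \<in> ?U" "hn e2 = tn e" using e' by auto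
    have "r (tn e2) < r (tn e)" using r e2 by (metis (no_types, lifting) case_prodD mem_Collect_eq mem_G0)
    then show ?case using less.hyps e2 by blast
  qed
  then have "?U = {}" by blast
  then have "set ord = insert (Suc n) (hn ` {..<n})" "\<forall>e<n. tn e \<in> set ord" using ord by auto
  moreover have "nodes G0 = hn ` {..<n} \<union> tn ` {..<n}" by (auto simp: nodes_def)
  moreover have "Suc n \<in> nodes G0" using ttsp_terminals[OF ttsp_G0] by simp
  ultimately have "set ord = nodes G0" by auto
  then show ?thesis using k by (simp add: topological_def kahn_def)
qed

lemma wp_topo_order:
  assumes h: "header R" and M: "M 1 = hn" "M 2 = tn"
    "\<And>b. linked (M 6) (M 5 b) (bucket tn n b)" "M 7 = (\<lambda>b. length (bucket hn n b))"
    and Q: "\<And>R' M' k'. header R' \<Longrightarrow> topological (map (M' 8) [0..<R' 5]) \<Longrightarrow>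
      \<forall>a. a \<noteq> 7 \<longrightarrow> a \<noteq> 8 \<longrightarrow> M' a = M a \<Longrightarrow> k' \<le> k + (n * 80 + 150) \<Longrightarrow> Q (R', M') k'"
  shows "wp topo_order Q (R, M) k"
proof -
  define ord where "ord \<tau> = map (snd \<tau> 8) [0..<fst \<tau> 5]" for \<tau> :: state
  \<comment> \<open>The unremoved edges: those whose tail has not been taken from the queue, and the
    rest \<open>es\<close> of the list being traversed.\<close>
  define left where "left \<tau> es = {e. e < n \<and> tn e \<notin> set (take (fst \<tau> 4) (ord \<tau>))} \<union> set es" for \<tau> :: state and es
  \<comment> \<open>Every edge removed and every node taken from the queue pays 40 time
    units.\<close>
  define inv where "inv es \<tau> k' \<longleftrightarrow> header (fst \<tau>) \<and> kahn (left \<tau> es) (ord \<tau>) (snd \<tau> 7) \<and>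
    fst \<tau> 4 \<le> fst \<tau> 5 \<and> (\<forall>a. a \<noteq> 7 \<longrightarrow> a \<noteq> 8 \<longrightarrow> snd \<tau> a = M a) \<and>
    k' + 40 * card (left \<tau> es) \<le> k + 20 + 40 * n + 40 * fst \<tau> 4" for es and \<tau> :: state and k'
  define suffix where "suffix \<tau> es \<longleftrightarrow> linked (M 6) (fst \<tau> 7) es \<and> distinct es \<and>
    (\<forall>e \<in> set es. e < n \<and> tn e \<in> set (take (fst \<tau> 4) (ord \<tau>)))" for \<tau> :: state and es
  have len: "fst \<tau> 5 \<le> n + 2" if "inv es \<tau> k'" for es \<tau> k'
    using kahn_length[of "left \<tau> es" "ord \<tau>"] that by (auto simp: inv_def ord_def)
  have bound: "k' \<le> k + (n * 80 + 140)" if "inv es \<tau> k'" for es \<tau> k'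
    using len[OF that] that unfolding inv_def by linarith
  \<comment> \<open>The offset 4 reserves the time of the test that ends the inner loop.\<close>
  have step: "wp release_edge (\<lambda>\<tau> k'. inv es \<tau> (k' + 4) \<and> suffix \<tau> es) \<tau> k1"
    if J: "inv (e # es) \<tau> k1" and suf: "suffix \<tau> (e # es)" for \<tau> k1 e es
  proof -
    obtain R1 M1 where \<tau>: "\<tau> = (R1, M1)" by (cases \<tau>)
    have e: "e < n" "tn e \<in> set (take (R1 4) (ord \<tau>))" "R1 7 = Suc e" "linked (M 6) (M 6 e) es"
      "distinct es" "e \<notin> set es" "\<And>e. e \<in> set es \<Longrightarrow> e < n \<and> tn e \<in> set (take (R1 4) (ord \<tau>))"
      using suf by (auto simp: suffix_def \<tau>)
    have R1: "R1 4 \<le> R1 5" "R1 5 \<le> n + 2" "R1 0 = n" "R1 1 = m" "R1 2 = c"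
      and M1: "\<And>a. a \<noteq> 7 \<Longrightarrow> a \<noteq> 8 \<Longrightarrow> M1 a = M a"
      and kahn: "kahn (left \<tau> (e # es)) (ord \<tau>) (M1 7)"
      and time: "k1 + 40 * card (left \<tau> (e # es)) \<le> k + 20 + 40 * n + 40 * R1 4"
      using J len[OF J] by (auto simp: inv_def \<tau> header_def)
    have o: "ord \<tau> = map (M1 8) [0..<R1 5]" by (simp add: ord_def \<tau>)
    have el: "e \<in> left \<tau> (e # es)" by (simp add: left_def)
    have l': "left \<tau> (e # es) - {e} = left \<tau> es" using e by (auto simp: left_def \<tau>)
    have fl: "finite (left \<tau> (e # es))" by (simp add: left_def)
    have eo: "tn e \<in> set (ord \<tau>)" using e(2) by (rule in_set_takeD)
    note step = kahn_step[OF kahn el eo, unfolded l']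
    have b5: "R1 5 < n + 2" using step(4) by (simp add: o)
    have card: "card (left \<tau> (e # es)) = Suc (card (left \<tau> es))" using el fl l' by (metis card_Suc_Diff1)
    have mapu: "map ((M1 8)(R1 5 := y)) [0..<R1 5] = ord \<tau>" for y
      unfolding o by (auto intro: map_cong)
    have lt: "take (R1 4) (ord \<tau> @ [y]) = take (R1 4) (ord \<tau>)" for y using R1 by (simp add: o)
    have simps: "R1 7 - 1 = e" "M1 1 = hn" "M1 6 = M 6" using e M1 M by auto
    have left: "left (R', M') es = left \<tau> es" if "R' 4 = R1 4" "take (R1 4) (ord (R', M')) = take (R1 4) (ord \<tau>)" for R' M'
      using that by (simp add: left_def \<tau>)
    show ?thesis
    proof (rule vc_wp, cases "M1 7 (hn e) - 1 = 0")
      case True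
      let ?\<tau> = "(R1(8 := hn e, 5 := Suc (R1 5), 7 := M 6 e), M1(7 := (M1 7)(hn e := M1 7 (hn e) - 1), 8 := (M1 8)(R1 5 := hn e)))"
      have o': "ord ?\<tau> = ord \<tau> @ [hn e]" by (simp add: ord_def mapu)
      have l: "left ?\<tau> es = left \<tau> es" using o' lt by (intro left) simp_all
      have "inv es ?\<tau> k'" if "k' \<le> k1 + 40" for k'
        using step(2)[OF True] R1 M1 time card that unfolding inv_def l o' by (simp add: header_def)
      moreover have "suffix ?\<tau> es" using e lt unfolding suffix_def o' by simp
      ultimately show "vc release_edge (\<lambda>\<tau> k'. inv es \<tau> (k' + 4) \<and> suffix \<tau> es) \<tau> k1"
        using True e(1) b5 by (simp add: release_edge_def \<tau> simps[simplified] e(3) S_ge(2)[simplified])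
    next
      case False
      let ?\<tau> = "(R1(8 := hn e, 7 := M 6 e), M1(7 := (M1 7)(hn e := M1 7 (hn e) - 1)))"
      have o': "ord ?\<tau> = ord \<tau>" by (simp add: ord_def \<tau>)
      have l: "left ?\<tau> es = left \<tau> es" using o' by (intro left) simp_all
      have "inv es ?\<tau> k'" if "k' \<le> k1 + 40" for k'
        using step(3)[OF False] R1 M1 time card that unfolding inv_def l o' by (simp add: header_def)
      moreover have "suffix ?\<tau> es" using e unfolding suffix_def o' by simp
      ultimately show "vc release_edge (\<lambda>\<tau> k'. inv es \<tau> (k' + 4) \<and> suffix \<tau> es) \<tau> k1"
        using False e(1) b5 by (simp add: release_edge_def \<tau> simps[simplified] e(3))
    qed
  qed
  have release: "wp (While (Less (Const 0) (Reg 7)) release_edge) (inv []) \<tau> k1"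
    if "inv es \<tau> (k1 + 4)" "suffix \<tau> es" for \<tau> k1 es
  proof (rule wp_While[where I = "\<lambda>\<tau> k'. \<exists>es. inv es \<tau> (k' + 4) \<and> suffix \<tau> es" and B = "k + (n * 80 + 140)"])
    show "\<exists>es. inv es \<tau> (k1 + 4) \<and> suffix \<tau> es" using that by blast
    show "k' \<le> k + (n * 80 + 140)" if "\<exists>es. inv es \<tau> (k' + 4) \<and> suffix \<tau> es" for \<tau> k'
      using bound that by fastforce
  next
    fix \<tau> k1
    assume "\<exists>es. inv es \<tau> (k1 + 4) \<and> suffix \<tau> es"
    then obtain es where J: "inv es \<tau> (k1 + 4)" and suf: "suffix \<tau> es" by blast
    show "bsafe \<tau> (Less (Const 0) (Reg 7)) \<and>
      (if bv (encode I) \<tau> (Less (Const 0) (Reg 7))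
       then wp release_edge (\<lambda>\<tau> k'. \<exists>es. inv es \<tau> (k' + 4) \<and> suffix \<tau> es) \<tau> (k1 + (bcost (Less (Const 0) (Reg 7)) + 1))
       else inv [] \<tau> (k1 + (bcost (Less (Const 0) (Reg 7)) + 1)))"
    proof (cases es)
      case Nil
      then show ?thesis using J suf by (simp add: suffix_def numeral_eq_Suc)
    next
      case (Cons e es')
      have "wp release_edge (\<lambda>\<tau> k'. \<exists>es. inv es \<tau> (k' + 4) \<and> suffix \<tau> es) \<tau> (k1 + 4)"
        by (rule wp_mono[OF step[OF J[unfolded Cons] suf[unfolded Cons]]]) blast
      then show ?thesis using suf by (simp add: suffix_def Cons numeral_eq_Suc)
    qed
  qed
  define loop where "loop = While (Less (Reg 4) (Reg 5))
    release_node"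
  have "wp loop Q (R(4 := 0, 5 := Suc 0), M(8 := (M 8)(0 := Suc n))) k0" if "k0 \<le> k + 20" for k0
    unfolding loop_def
    proof (rule wp_While[where I = "inv []" and B = "k + (n * 80 + 140)"])
      show "inv [] (R(4 := 0, 5 := Suc 0), M(8 := (M 8)(0 := Suc n))) k0"
      proof -
        have "{e. e < n \<and> tn e \<notin> set []} = {..<n}" by auto
        then show ?thesis using h M kahn_init that by (simp add: inv_def left_def ord_def header_def)
      qed
      show "k' \<le> k + (n * 80 + 140)" if "inv [] \<tau> k'" for \<tau> k' using bound[OF that] .
    next
      fix \<tau> k1
      assume J: "inv [] \<tau> k1"
      obtain R1 M1 where \<tau>: "\<tau> = (R1, M1)" by (cases \<tau>)
      have R1: "R1 4 \<le> R1 5" "R1 5 \<le> n + 2" "header R1"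
        and M1: "\<And>a. a \<noteq> 7 \<Longrightarrow> a \<noteq> 8 \<Longrightarrow> M1 a = M a"
        and kahn: "kahn (left \<tau> []) (ord \<tau>) (M1 7)"
        and time: "k1 + 40 * card (left \<tau> []) \<le> k + 20 + 40 * n + 40 * R1 4"
        using J len[OF J] by (auto simp: inv_def \<tau>)
      have o: "ord \<tau> = map (M1 8) [0..<R1 5]" by (simp add: ord_def \<tau>)
      show "bsafe \<tau> (Less (Reg 4) (Reg 5)) \<and>
        (if bv (encode I) \<tau> (Less (Reg 4) (Reg 5))
         then wp release_node (inv []) \<tau> (k1 + (bcost (Less (Reg 4) (Reg 5)) + 1))
         else Q \<tau> (k1 + (bcost (Less (Reg 4) (Reg 5)) + 1)))"
      proof (cases "R1 4 < R1 5")
        case False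
        have "take (R1 4) (ord \<tau>) = ord \<tau>" using False R1 by (simp add: o)
        then have "left \<tau> [] = {e. e < n \<and> tn e \<notin> set (ord \<tau>)}" by (simp add: left_def \<tau>)
        then have "topological (ord \<tau>)" using kahn by (metis kahn_final)
        then show ?thesis using False R1 M1 time by (auto simp: \<tau> o[unfolded \<tau>] intro!: Q)
      next
        case True
        let ?d = "M1 8 (R1 4)"
        let ?\<tau> = "(R1(6 := ?d, 4 := Suc (R1 4), 7 := M 5 ?d), M1)"
        have o': "ord ?\<tau> = ord \<tau>" by (simp add: ord_def \<tau>)
        have tk: "take (Suc (R1 4)) (ord \<tau>) = take (R1 4) (ord \<tau>) @ [?d]" using True by (simp add: take_Suc_conv_app_nth o)
        have "distinct (ord \<tau>)" using kahn by (simp add: kahn_def)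
        then have "distinct (take (Suc (R1 4)) (ord \<tau>))" by (rule distinct_take)
        then have d: "?d \<notin> set (take (R1 4) (ord \<tau>))" by (simp add: tk)
        have "?d \<in> set (ord \<tau>)" using True by (simp add: o)
        then have dn: "?d < n + 2" using kahn hn_less by (auto simp: kahn_def)
        have l: "left ?\<tau> (bucket tn n ?d) = left \<tau> []" using d unfolding left_def o' by (auto simp: \<tau> tk[unfolded \<tau>])
        have "inv (bucket tn n ?d) ?\<tau> k'" if "k' \<le> k1 + 40" for k'
          using kahn R1 M1 time that True unfolding inv_def l o' by (simp add: header_def)
        moreover have "suffix ?\<tau> (bucket tn n ?d)" using M(3) by (simp add: suffix_def o' tk)
        ultimately have r: "wp (While (Less (Const 0) (Reg 7)) release_edge) (inv []) ?\<tau> k'" if "k' + 4 \<le> k1 + 40" for k'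
          using that by (intro release) simp_all
        have "wp release_node (inv []) \<tau> (k1 + 4)"
          unfolding release_node_def using True R1 dn by (intro wp_Seq_vc) (auto simp: \<tau> M1 S_ge intro!: r)
        then show ?thesis using True by (simp add: \<tau> numeral_eq_Suc)
      qed
  qed
  then show ?thesis unfolding topo_order_def loop_def[symmetric]
    by (intro wp_Seq_vc) (simp add: h[unfolded header_def] S_ge(2)[simplified])
qed

end

section \<open>Reduction in topological order\<close>

context multigraph
begin

definition closed :: "nat set \<Rightarrow> bool" where
  "closed X \<longleftrightarrow> (\<forall>(u, v) \<in> set alist. u \<in> X \<longrightarrow> v \<in> X)"

text \<open>\<open>P\<close> are the nodes processed so far, \<open>A\<close> those that still exist; each of them except the
  source has the single incoming edge \<open>inn y\<close> from \<open>par y\<close>. While node \<open>d\<close> is processed,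
  \<open>Rem\<close> are the incoming edges not yet considered, \<open>acc y - 1\<close> is the merged edge from \<open>y\<close> to \<open>d\<close>,
  and \<open>cur\<close> contains an edge to \<open>d\<close> waiting to be merged.\<close>

abbreviation "tree_edges par inn A \<equiv> {(par y, inn y, y) |y. y \<in> A \<and> y \<noteq> Suc n}"
abbreviation "later_edges P \<equiv> {(tn e, e, hn e) |e. e < n \<and> hn e \<notin> P}"
abbreviation "edges_to d E \<equiv> {(tn e, e, d) |e. e \<in> E}"
abbreviation "merged_edges d acc \<equiv> {(y, acc y - 1, d) |y. acc y \<noteq> (0 :: nat)}"
abbreviation "waiting_edges d cur \<equiv> {(x, v, d) |x v. (x, v) \<in> cur}"

definition settled where
  "settled P A G par inn cnt K L R z \<longleftrightarrow>
    reduced closed n (Suc n) n G K L R z \<and> Suc n \<in> A \<and> A \<subseteq> P \<and> P \<subseteq> {..<n + 2} \<and>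
    G = tree_edges par inn A \<union> later_edges P \<and>
    (\<forall>y \<in> A. y \<noteq> Suc n \<longrightarrow> par y \<in> A) \<and> (\<forall>e<n. hn e \<notin> P \<longrightarrow> tn e \<in> P \<longrightarrow> tn e \<in> A) \<and>
    (\<forall>y. y \<notin> P - A \<longrightarrow> cnt y = card {g \<in> G. fst g = y})"

text \<open>\<open>cnt y\<close> leaves out the merged edge, so an inner node with a merged edge
  admits a series reduction exactly when its counter is 0. Eliminated nodes, those in
  \<open>P - A\<close>, keep stale counters. The last line ensures that no edge is described twice,
  labels being stored in \<open>acc\<close> with offset 1.\<close>

definition work where
  "work P A d Rem cur G par inn acc cnt K L R z \<longleftrightarrow>
    reduced closed n (Suc n) n G K L R z \<and> Suc n \<in> A \<and> A \<subseteq> P \<and> P \<subseteq> {..<n + 2} \<and> d \<notin> P \<and> d < n + 2 \<and> Rem \<subseteq> {..<n} \<and>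
    G = tree_edges par inn A \<union> later_edges (insert d P) \<union>
      edges_to d Rem \<union> merged_edges d acc \<union> waiting_edges d cur \<and>
    (\<forall>y. acc y \<noteq> 0 \<longrightarrow> y \<in> A) \<and> (\<forall>x v. (x, v) \<in> cur \<longrightarrow> x \<in> A) \<and> (\<forall>e \<in> Rem. tn e \<in> A) \<and>
    (\<forall>y \<in> A. y \<noteq> Suc n \<longrightarrow> par y \<in> A) \<and> (\<forall>e<n. hn e \<notin> insert d P \<longrightarrow> tn e \<in> P \<longrightarrow> tn e \<in> A) \<and>
    (\<forall>y. y \<notin> P - A \<longrightarrow> cnt y + (if acc y \<noteq> 0 then 1 else 0) = card {g \<in> G. fst g = y}) \<and>
    (\<forall>e \<in> Rem. \<forall>y. acc y \<noteq> Suc e) \<and> (\<forall>x v. (x, v) \<in> cur \<longrightarrow> v \<notin> Rem \<and> (\<forall>y. acc y \<noteq> Suc v))"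

text \<open>No series reduction is pending: a merged edge never is the only edge left at its tail,
  unless the tail is the source.\<close>

definition eager :: "(nat \<Rightarrow> nat) \<Rightarrow> (nat \<Rightarrow> nat) \<Rightarrow> bool" where
  "eager acc cnt \<longleftrightarrow> (\<forall>y. acc y \<noteq> 0 \<longrightarrow> y \<noteq> Suc n \<longrightarrow> cnt y \<noteq> 0)"

lemma reduced_facts:
  assumes "reduced C n s t G K L R z"
  shows "ttsp G s t" "finite G" "card G + z = 2 * n" "n \<le> z" "\<And>a v b. (a, v, b) \<in> G \<Longrightarrow> v < z"
    "\<And>a v b a' b'. (a, v, b) \<in> G \<Longrightarrow> (a', v, b') \<in> G \<Longrightarrow> a = a' \<and> b = b'"
proof -
  show sp: "ttsp G s t" and "card G + z = 2 * n" "n \<le> z" using assms by (simp_all add: reduced_def)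
  show "finite G" using ttsp_finite[OF sp] by simp
  have "\<forall>(a, v, b) \<in> G. tree_root n z L R v" and inj: "inj_on (fst \<circ> snd) G" using assms by (simp_all add: reduced_def)
  then show "v < z" if "(a, v, b) \<in> G" for a v b using that by (auto simp: tree_root_def)
  show "a = a' \<and> b = b'" if "(a, v, b) \<in> G" "(a', v, b') \<in> G" for a v b a' b'
    using inj_onD[OF inj, of "(a, v, b)" "(a', v, b')"] that by simp
qed

lemma workD:
  assumes "work P A d Rem cur G par inn acc cnt K L R z"
  shows "reduced closed n (Suc n) n G K L R z" "Suc n \<in> A" "A \<subseteq> P" "P \<subseteq> {..<n + 2}" "d \<notin> P" "d < n + 2" "Rem \<subseteq> {..<n}"
    "G = tree_edges par inn A \<union> later_edges (insert d P) \<union>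
      edges_to d Rem \<union> merged_edges d acc \<union> waiting_edges d cur"
    "\<And>y. acc y \<noteq> 0 \<Longrightarrow> y \<in> A" "\<And>x v. (x, v) \<in> cur \<Longrightarrow> x \<in> A" "\<And>e. e \<in> Rem \<Longrightarrow> tn e \<in> A"
    "\<And>y. y \<in> A \<Longrightarrow> y \<noteq> Suc n \<Longrightarrow> par y \<in> A" "\<And>e. e < n \<Longrightarrow> hn e \<notin> insert d P \<Longrightarrow> tn e \<in> P \<Longrightarrow> tn e \<in> A"
    "\<And>y. y \<notin> P - A \<Longrightarrow> cnt y + (if acc y \<noteq> 0 then 1 else 0) = card {g \<in> G. fst g = y}"
    "\<And>e y. e \<in> Rem \<Longrightarrow> acc y \<noteq> Suc e" "\<And>x v. (x, v) \<in> cur \<Longrightarrow> v \<notin> Rem" "\<And>x v y. (x, v) \<in> cur \<Longrightarrow> acc y \<noteq> Suc v"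
  using assms by (simp_all only: work_def simp_thms) (metis | blast)+

lemma work_head_cases:
  assumes "work P A d Rem cur G par inn acc cnt K L R z" "(a, v, b) \<in> G"
  shows "b \<in> P \<Longrightarrow> b \<in> A \<and> b \<noteq> Suc n \<and> a = par b \<and> v = inn b"
    "b = d \<Longrightarrow> (v \<in> Rem \<and> a = tn v) \<or> acc a = Suc v \<or> (a, v) \<in> cur"
    "a \<in> P \<Longrightarrow> a \<in> A" "b \<in> insert d P \<Longrightarrow> a \<in> A"
proof -
  note w = workD[OF assms(1)]
  have *: "(b \<in> A \<and> b \<noteq> Suc n \<and> a = par b \<and> v = inn b) \<or> (v < n \<and> hn v \<notin> insert d P \<and> a = tn v \<and> b = hn v) \<or>
     (b = d \<and> v \<in> Rem \<and> a = tn v) \<or> (b = d \<and> acc a = Suc v) \<or> (b = d \<and> (a, v) \<in> cur)"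
    using assms(2) unfolding w(8) by auto
  show "b \<in> P \<Longrightarrow> b \<in> A \<and> b \<noteq> Suc n \<and> a = par b \<and> v = inn b" using * w(5) by auto
  show "b = d \<Longrightarrow> (v \<in> Rem \<and> a = tn v) \<or> acc a = Suc v \<or> (a, v) \<in> cur" using * w(3,5) by auto
  have acc: "a \<in> A" if "acc a = Suc v" using w(9)[of a] that by simp
  show "a \<in> P \<Longrightarrow> a \<in> A" using * w(10,11,12,13) acc by auto
  show "b \<in> insert d P \<Longrightarrow> a \<in> A" using * w(3,10,11,12) acc by blast
qed

text \<open>The multigraph stays the same; only its description changes, the waiting edge becoming
  the merged edge of its tail.\<close>

lemma work_store:
  assumes w: "work P A d Rem {(x, v)} G par inn acc cnt K L R z" and a: "acc x = 0"
  shows "0 < cnt x" "work P A d Rem {} G par inn (acc(x := Suc v)) (cnt(x := cnt x - 1)) K L R z"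
proof -
  note w = workD[OF w]
  have xA: "x \<in> A" using w(10) by simp
  have xv: "(x, v, d) \<in> G" by (subst w(8)) auto
  have fin: "finite G" using reduced_facts[OF w(1)] by simp
  have "card {g \<in> G. fst g = x} \<noteq> 0" using xv fin by (auto simp: card_eq_0_iff)
  then show c: "0 < cnt x" using w(14)[of x] xA a by simp
  have "merged_edges d acc \<union> waiting_edges d {(x, v)} =
    merged_edges d (acc(x := Suc v))" using a by auto
  then have "G = tree_edges par inn A \<union> later_edges (insert d P) \<union>
      edges_to d Rem \<union> merged_edges d (acc(x := Suc v))"
    using w(8) by (simp only: Un_assoc)
  moreover have "(cnt(x := cnt x - 1)) y + (if (acc(x := Suc v)) y \<noteq> 0 then 1 else 0) = card {g \<in> G. fst g = y}"
    if "y \<notin> P - A" for y using w(14)[OF that] c a by (cases "y = x") auto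
  moreover have "\<forall>e \<in> Rem. \<forall>y. (acc(x := Suc v)) y \<noteq> Suc e" using w(15,16) by auto
  ultimately show "work P A d Rem {} G par inn (acc(x := Suc v)) (cnt(x := cnt x - 1)) K L R z"
    unfolding work_def using w(1-7,9,11-13) xA by auto
qed

text \<open>One edge replaces the merged and the waiting one, so the out-degree of \<open>x\<close>
  and its counter drop by one. The presence of two edges bounds the new component number through the
  equation in \<open>reduced\<close>.\<close>

lemma work_parallel:
  assumes wk: "work P A d Rem {(x, v)} G par inn acc cnt K L R z" and a: "acc x \<noteq> 0"
  shows "0 < cnt x" "Suc z < 2 * n" "v < z" "acc x \<le> z"
    "\<exists>G'. work P A d Rem {} G' par inn (acc(x := Suc z)) (cnt(x := cnt x - 1)) (K(z := 0)) (L(z := acc x - 1)) (R(z := v)) (Suc z)"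
proof -
  note w = workD[OF wk]
  define u where "u = acc x - 1"
  define G' where "G' = insert (x, z, d) (G - {(x, u, d), (x, v, d)})"
  have xA: "x \<in> A" using w(10) by simp
  have xv: "(x, v, d) \<in> G" by (subst w(8)) auto
  have xu: "(x, u, d) \<in> G" using a by (subst w(8)) (auto simp: u_def)
  have uv: "u \<noteq> v" using w(17)[of x v x] a by (auto simp: u_def)
  note rf = reduced_facts[OF w(1)]
  have two: "{(x, u, d), (x, v, d)} \<subseteq> {g \<in> G. fst g = x}" using xu xv by auto
  have c2: "2 \<le> card {g \<in> G. fst g = x}" using card_mono[OF _ two] rf(2) uv by simp
  then show c: "0 < cnt x" using w(14)[of x] xA a by simp
  have "2 \<le> card G" using c2 card_mono[of G "{g \<in> G. fst g = x}"] rf(2) by auto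
  then show "Suc z < 2 * n" using rf(3) by linarith
  show "v < z" using rf(5)[OF xv] .
  show "acc x \<le> z" using rf(5)[OF xu] a by (simp add: u_def)
  have red: "reduced closed n (Suc n) n G' (K(z := 0)) (L(z := u)) (R(z := v)) (Suc z)"
    unfolding G'_def by (rule reduced_parallel[OF w(1) xu xv uv])
  have e1: "tree_edges par inn A \<inter> {(x, u, d), (x, v, d)} = {}" using w(3,5) by auto
  have e2: "later_edges (insert d P) \<inter> {(x, u, d), (x, v, d)} = {}" by auto
  have e3: "edges_to d Rem \<inter> {(x, u, d), (x, v, d)} = {}" using w(15)[of u x] w(16)[of x v] a by (auto simp: u_def)
  have e4: "insert (x, z, d) ((merged_edges d acc \<union> waiting_edges d {(x, v)}) - {(x, u, d), (x, v, d)}) =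
    merged_edges d (acc(x := Suc z))"
    using w(17)[of x v] by (auto simp: u_def)
  have G': "G' = tree_edges par inn A \<union> later_edges (insert d P) \<union>
      edges_to d Rem \<union> merged_edges d (acc(x := Suc z))"
  proof -
    have "insert p (A' \<union> B \<union> C \<union> D \<union> E - X) = A' \<union> B \<union> C \<union> insert p (D \<union> E - X)"
      if "A' \<inter> X = {}" "B \<inter> X = {}" "C \<inter> X = {}" for p :: "nat \<times> nat \<times> nat" and A' B C D E X using that by blast
    from this[OF e1 e2 e3] show ?thesis unfolding e4[symmetric] G'_def by (subst w(8)) assumption
  qed
  have out: "{g \<in> G'. fst g = y} = {g \<in> G. fst g = y}" if "y \<noteq> x" for y using that by (auto simp: G'_def)
  have "{g \<in> G'. fst g = x} = insert (x, z, d) ({g \<in> G. fst g = x} - {(x, u, d), (x, v, d)})" by (auto simp: G'_def)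
  moreover have "(x, z, d) \<notin> G" using reduced_fresh[OF w(1)] by simp
  ultimately have "card {g \<in> G'. fst g = x} = Suc (card {g \<in> G. fst g = x} - 2)"
    using rf(2) uv two by (simp add: card_Diff_subset)
  then have outx: "Suc (card {g \<in> G'. fst g = x}) = card {g \<in> G. fst g = x}" using c2 by simp
  have "(cnt(x := cnt x - 1)) y + (if (acc(x := Suc z)) y \<noteq> 0 then 1 else 0) = card {g \<in> G'. fst g = y}"
    if "y \<notin> P - A" for y using w(14)[OF that] c a out[of y] outx by (cases "y = x") auto
  moreover have "\<forall>e \<in> Rem. \<forall>y. (acc(x := Suc z)) y \<noteq> Suc e" using w(7,15) rf(4) by auto
  ultimately have "work P A d Rem {} G' par inn (acc(x := Suc z)) (cnt(x := cnt x - 1)) (K(z := 0)) (L(z := acc x - 1)) (R(z := v)) (Suc z)"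
    unfolding work_def using red G' w(2-7,9,11-13) xA by (auto simp: u_def)
  then show "\<exists>G'. work P A d Rem {} G' par inn (acc(x := Suc z)) (cnt(x := cnt x - 1)) (K(z := 0)) (L(z := acc x - 1)) (R(z := v)) (Suc z)"
    by blast
qed

text \<open>The edge from \<open>par x\<close> to \<open>x\<close> is replaced by one from
  \<open>par x\<close> to \<open>d\<close>, so the counter of \<open>par x\<close> is unchanged. The
  new edge has to wait, since \<open>par x\<close> may already have a merged edge to
  \<open>d\<close>.\<close>

lemma work_series:
  assumes wk: "work P A d Rem {} G par inn acc cnt K L R z" and a: "acc x \<noteq> 0" "cnt x = 0" "x \<noteq> Suc n"
  shows "Suc z < 2 * n" "inn x < z" "acc x \<le> z" "par x < n + 2"
    "\<exists>G'. work P (A - {x}) d Rem {(par x, z)} G' par inn (acc(x := 0)) cnt (K(z := 1)) (L(z := inn x)) (R(z := acc x - 1)) (Suc z)"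
proof -
  note w = workD[OF wk]
  define w' where "w' = acc x - 1"
  define G' where "G' = insert (par x, z, d) (G - {(par x, inn x, x), (x, w', d)})"
  have xA: "x \<in> A" using w(9) a by simp
  have xP: "x \<in> P" using xA w(3) by auto
  have xw: "(x, w', d) \<in> G" using a by (subst w(8)) (auto simp: w'_def)
  have px: "(par x, inn x, x) \<in> G" using a xA by (subst w(8)) auto
  note rf = reduced_facts[OF w(1)]
  obtain r :: "nat \<Rightarrow> nat" where r: "\<forall>(a, e, b) \<in> G. r a < r b \<and> r b \<le> r n" using ttsp_rank[OF rf(1)] by blast
  have ne: "par x \<noteq> x" "x \<noteq> d" using r px xw by fastforce+
  have two: "{(par x, inn x, x), (x, w', d)} \<subseteq> G" using px xw by auto
  have "2 \<le> card G" using card_mono[OF rf(2) two] ne by simp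
  then show "Suc z < 2 * n" using rf(3) by linarith
  show "inn x < z" using rf(5)[OF px] .
  show "acc x \<le> z" using rf(5)[OF xw] a by (simp add: w'_def)
  have pA: "par x \<in> A" using w(12) xA a by simp
  then show "par x < n + 2" using w(3,4) by auto
  \<comment> \<open>Counter 0 plus the merged edge: \<open>x\<close> has out-degree one. Hence none
    of the other groups of edges contains an edge with tail \<open>x\<close>, and they survive the
    contraction.\<close>
  have "card {g \<in> G. fst g = x} = 1" using w(14)[of x] xA a by simp
  then obtain g where g: "{g \<in> G. fst g = x} = {g}" by (rule card_1_singletonE)
  have "(x, w', d) \<in> {g \<in> G. fst g = x}" using xw by simp
  then have single: "{g \<in> G. fst g = x} = {(x, w', d)}" unfolding g by simp
  have out: "(e, b') = (w', d)" if "(x, e, b') \<in> G" for e b'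
  proof -
    have "(x, e, b') \<in> {g \<in> G. fst g = x}" using that by simp
    then show ?thesis unfolding single by simp
  qed
  have inn: "(a', e) = (par x, inn x)" if "(a', e, x) \<in> G" for a' e
    using work_head_cases(1)[OF wk that xP] by simp
  have red: "reduced closed n (Suc n) n G' (K(z := 1)) (L(z := inn x)) (R(z := w')) (Suc z)"
    unfolding G'_def by (rule reduced_series[OF w(1) px xw inn out])
  have parx: "par y \<noteq> x" if "y \<in> A" "y \<noteq> Suc n" for y
  proof
    assume "par y = x"
    then have "(x, inn y, y) \<in> G" using that by (subst w(8)) auto
    then show False using out w(3,5) that by auto
  qed
  have remx: "tn e \<noteq> x" if "e \<in> Rem" for e
  proof
    assume "tn e = x"
    then have "(x, e, d) \<in> G" using that by (subst w(8)) auto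
    then show False using out[of e d] w(15)[OF that, of x] a by (auto simp: w'_def)
  qed
  have othx: "tn e \<noteq> x" if "e < n" "hn e \<notin> insert d P" for e
  proof
    assume "tn e = x"
    then have "(x, e, hn e) \<in> G" using that by (subst w(8)) auto
    then show False using out[of e "hn e"] that by auto
  qed
  have e1: "tree_edges par inn A - {(par x, inn x, x), (x, w', d)} =
    tree_edges par inn (A - {x})" using parx by auto
  have e2: "later_edges (insert d P) - {(par x, inn x, x), (x, w', d)} =
     later_edges (insert d P)" using xP by auto
  have e3: "edges_to d Rem - {(par x, inn x, x), (x, w', d)} = edges_to d Rem" using remx ne by auto
  have e4: "merged_edges d acc - {(par x, inn x, x), (x, w', d)} =
    merged_edges d (acc(x := 0))" using \<open>x \<noteq> d\<close> unfolding w'_def by auto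
  have G': "G' = tree_edges par inn (A - {x}) \<union> later_edges (insert d P) \<union>
      edges_to d Rem \<union> merged_edges d (acc(x := 0)) \<union> waiting_edges d {(par x, z)}"
  proof -
    have "insert p (A' \<union> B \<union> C \<union> D \<union> {} - X) = (A' - X) \<union> (B - X) \<union> (C - X) \<union> (D - X) \<union> {p}"
      for p :: "nat \<times> nat \<times> nat" and A' B C D X by blast
    from this[of "(par x, z, d)" "tree_edges par inn A"
        "later_edges (insert d P)" "edges_to d Rem" "merged_edges d acc"
        "{(par x, inn x, x), (x, w', d)}"]
    have "insert (par x, z, d) (tree_edges par inn A \<union> later_edges (insert d P) \<union>
      edges_to d Rem \<union> merged_edges d acc \<union> {} - {(par x, inn x, x), (x, w', d)}) =
      tree_edges par inn (A - {x}) \<union> later_edges (insert d P) \<union>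
      edges_to d Rem \<union> merged_edges d (acc(x := 0)) \<union> {(par x, z, d)}"
      unfolding e1 e2 e3 e4 .
    moreover have "G = tree_edges par inn A \<union> later_edges (insert d P) \<union>
      edges_to d Rem \<union> merged_edges d acc \<union> {}" by (subst w(8)) simp
    moreover have "waiting_edges d {(par x, z)} = {(par x, z, d)}" by auto
    ultimately show ?thesis unfolding G'_def by metis
  qed
  have cnt: "cnt y + (if (acc(x := 0)) y \<noteq> 0 then 1 else 0) = card {g \<in> G'. fst g = y}"
    if y: "y \<notin> P - (A - {x})" for y
  proof -
    have yx: "y \<noteq> x" "y \<notin> P - A" using y xP by auto
    have "card {g \<in> G'. fst g = y} = card {g \<in> G. fst g = y}"
    proof (cases "y = par x")
      case True
      have "{g \<in> G'. fst g = y} = insert (par x, z, d) ({g \<in> G. fst g = y} - {(par x, inn x, x)})"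
        using True yx by (auto simp: G'_def)
      moreover have "(par x, z, d) \<notin> G" using reduced_fresh[OF w(1)] by simp
      moreover have "(par x, inn x, x) \<in> {g \<in> G. fst g = y}" using px True by simp
      moreover have fin: "finite {g \<in> G. fst g = y}" using rf(2) by simp
      moreover have "card (insert (par x, z, d) ({g \<in> G. fst g = y} - {(par x, inn x, x)})) =
          Suc (card ({g \<in> G. fst g = y} - {(par x, inn x, x)}))"
        by (rule card_insert_disjoint) (use fin \<open>(par x, z, d) \<notin> G\<close> in auto)
      ultimately have "card {g \<in> G'. fst g = y} = Suc (card ({g \<in> G. fst g = y} - {(par x, inn x, x)}))" by simp
      then show ?thesis
        by (rule trans[OF _ card_Suc_Diff1[OF fin \<open>(par x, inn x, x) \<in> {g \<in> G. fst g = y}\<close>]])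
    next
      case False
      then have "{g \<in> G'. fst g = y} = {g \<in> G. fst g = y}" using yx by (auto simp: G'_def)
      then show ?thesis by simp
    qed
    then show ?thesis using w(14)[OF yx(2)] yx(1) by simp
  qed
  have accz: "acc y \<noteq> Suc z" for y
  proof
    assume *: "acc y = Suc z"
    have "(y, acc y - 1, d) \<in> G" using * by (subst w(8)) auto
    then show False using rf(5)[of y "acc y - 1" d] * by simp
  qed
  have "work P (A - {x}) d Rem {(par x, z)} G' par inn (acc(x := 0)) cnt (K(z := 1)) (L(z := inn x)) (R(z := w')) (Suc z)"
    unfolding work_def
  proof (intro conjI)
    show "\<forall>y. y \<notin> P - (A - {x}) \<longrightarrow> cnt y + (if (acc(x := 0)) y \<noteq> 0 then 1 else 0) = card {g \<in> G'. fst g = y}" using cnt by blast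
    show "\<forall>e<n. hn e \<notin> insert d P \<longrightarrow> tn e \<in> P \<longrightarrow> tn e \<in> A - {x}" using w(13) othx by auto
    show "\<forall>x' v. (x', v) \<in> {(par x, z)} \<longrightarrow> v \<notin> Rem \<and> (\<forall>y. (acc(x := 0)) y \<noteq> Suc v)" using accz w(7) rf(4) by auto
  qed (use red G' w(2-7,9,11,12,15) xA pA ne parx remx a in auto)
  then show "\<exists>G'. work P (A - {x}) d Rem {(par x, z)} G' par inn (acc(x := 0)) cnt (K(z := 1)) (L(z := inn x)) (R(z := acc x - 1)) (Suc z)"
    unfolding w'_def by blast
qed

lemma work_next:
  assumes wk: "work P A d (insert e Rem) {} G par inn acc cnt K L R z" "e \<notin> Rem"
  shows "work P A d Rem {(tn e, e)} G par inn acc cnt K L R z"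
proof -
  note w = workD[OF wk(1)]
  have "edges_to d (insert e Rem) = edges_to d Rem \<union> waiting_edges d {(tn e, e)}" by auto
  then have "G = tree_edges par inn A \<union> later_edges (insert d P) \<union>
      edges_to d Rem \<union> merged_edges d acc \<union> waiting_edges d {(tn e, e)}"
    by (subst w(8)) auto
  then show ?thesis unfolding work_def using w(1-7,9,11-15) wk(2) by auto
qed

lemma settled_work:
  assumes s: "settled P A G par inn cnt K L R z" and d: "d \<notin> P" "d < n + 2" and t: "\<And>e. e < n \<Longrightarrow> hn e = d \<Longrightarrow> tn e \<in> P"
  shows "work P A d {e. e < n \<and> hn e = d} {} G par inn (\<lambda>_. 0) cnt K L R z"
proof -
  have G: "G = tree_edges par inn A \<union> later_edges P"
    using s unfolding settled_def by blast
  have "later_edges P = later_edges (insert d P) \<union>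
      edges_to d {e. e < n \<and> hn e = d}" using d by auto
  then have "G = tree_edges par inn A \<union> later_edges (insert d P) \<union>
      edges_to d {e. e < n \<and> hn e = d}" using G by (simp only: Un_assoc)
  then show ?thesis unfolding work_def using s d t unfolding settled_def by auto
qed

text \<open>With two tails left, \<open>ttsp_reducible\<close> would yield two parallel edges into
  \<open>d\<close>, although \<open>acc\<close> has one label per tail, or a tail other than the
  source with out-degree one, against \<open>eager\<close>.\<close>

lemma work_settled:
  assumes wk: "work P A d {} {} G par inn acc cnt K L R z" and eager: "eager acc cnt" and x: "acc x \<noteq> 0"
  shows "acc = (\<lambda>_. 0)(x := acc x)" "x < n + 2"
    "settled (insert d P) (insert d A) G (par(d := x)) (inn(d := acc x - 1)) (cnt(x := cnt x + 1)) K L R z"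
    "d = n \<Longrightarrow> G = {(Suc n, acc x - 1, n)}" "cnt x < card G" "acc x \<le> z"
proof -
  note w = workD[OF wk]
  note rf = reduced_facts[OF w(1)]
  have xd: "(x, acc x - 1, d) \<in> G" using x by (subst w(8)) auto
  have into_d: "acc a = Suc v" if "(a, v, d) \<in> G" for a v using work_head_cases(2)[OF wk that] by simp
  have uniq: "y = x" if "acc y \<noteq> 0" for y
  proof (rule ccontr)
    assume yx: "y \<noteq> x"
    have yd: "(y, acc y - 1, d) \<in> G" using that by (subst w(8)) auto
    have "(\<exists>a u v. u \<noteq> v \<and> (a, u, d) \<in> G \<and> (a, v, d) \<in> G) \<or>
      (\<exists>a u. a \<noteq> Suc n \<and> (a, u, d) \<in> G \<and> (\<forall>e b. (a, e, b) \<in> G \<longrightarrow> (e, b) = (u, d)))"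
    proof (rule ttsp_reducible[OF rf(1) yd xd])
      show "a \<in> P" if "(a, e, b) \<in> G" "b \<in> insert d P" for a e b
        using work_head_cases(4)[OF wk that] w(3) by auto
      show "(a, e) = (a', e')" if "b \<in> P" "(a, e, b) \<in> G" "(a', e', b) \<in> G" for a e a' e' b
        using work_head_cases(1)[OF wk that(2,1)] work_head_cases(1)[OF wk that(3,1)] by simp
    qed (use yx in simp)
    then show False
    proof (elim disjE exE conjE)
      fix a u v assume "u \<noteq> v" "(a, u, d) \<in> G" "(a, v, d) \<in> G"
      then show False using into_d[of a u] into_d[of a v] by simp
    next
      fix a u assume *: "a \<noteq> Suc n" "(a, u, d) \<in> G" "\<forall>e b. (a, e, b) \<in> G \<longrightarrow> (e, b) = (u, d)"
      have sg: "g = (a, u, d)" if g: "g \<in> G" "fst g = a" for g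
      proof -
        obtain e b where "g = (a, e, b)" using g(2) by (cases g) simp
        then show ?thesis using *(3)[rule_format, of e b] g(1) by simp
      qed
      have "{g \<in> G. fst g = a} \<subseteq> {(a, u, d)}" using sg by blast
      moreover have "(a, u, d) \<in> {g \<in> G. fst g = a}" using *(2) by simp
      ultimately have "{g \<in> G. fst g = a} = {(a, u, d)}" by blast
      then have "card {g \<in> G. fst g = a} = 1" by simp
      moreover have "acc a \<noteq> 0" using into_d[OF *(2)] by simp
      moreover have "a \<in> A" using w(9) calculation(2) by simp
      ultimately have "cnt a = 0" using w(14)[of a] by simp
      then show False using eager *(1) \<open>acc a \<noteq> 0\<close> unfolding eager_def by blast
    qed
  qed
  show acc: "acc = (\<lambda>_. 0)(x := acc x)" using uniq by fastforce
  have xA: "x \<in> A" using w(9) x by simp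
  then show "x < n + 2" using w(3,4) by auto
  show "acc x \<le> z" using rf(5)[OF xd] by simp
  have cx: "cnt x + 1 = card {g \<in> G. fst g = x}" using w(14)[of x] xA x by simp
  then show "cnt x < card G" using card_mono[OF rf(2), of "{g \<in> G. fst g = x}"] by simp
  have dA: "d \<notin> A" using w(3,5) by auto
  have ds: "d \<noteq> Suc n" using w(2) dA by auto
  have e1: "tree_edges (par(d := x)) (inn(d := acc x - 1)) (insert d A) =
    tree_edges par inn A \<union> merged_edges d acc"
  proof -
    have "merged_edges d acc = {(x, acc x - 1, d)}" using uniq x by blast
    then show ?thesis using dA ds by auto
  qed
  have G: "G = tree_edges (par(d := x)) (inn(d := acc x - 1)) (insert d A) \<union> later_edges (insert d P)"
    unfolding e1 by (subst w(8)) auto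
  have "(cnt(x := cnt x + 1)) y = card {g \<in> G. fst g = y}" if "y \<notin> insert d P - insert d A" for y
  proof (cases "y = x")
    case True
    then show ?thesis using cx by simp
  next
    case False
    have "y \<notin> P - A" using that w(5) by auto
    moreover have "acc y = 0" using uniq[of y] False by blast
    ultimately show ?thesis using w(14)[of y] False by simp
  qed
  then show "settled (insert d P) (insert d A) G (par(d := x)) (inn(d := acc x - 1)) (cnt(x := cnt x + 1)) K L R z"
    unfolding settled_def using G w(1-7,12,13) xA dA by auto
  \<comment> \<open>Now all in-degrees are at most one, so the multigraph is a path; its last tail
    has out-degree one and by \<open>eager\<close> is the source.\<close>
  assume dn: "d = n"
  have Q: "nodes G \<subseteq> insert n P"
    by (rule ttsp_ancestors[OF rf(1)]) (use work_head_cases(4)[OF wk] w(3) dn in auto)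
  have path: "(e, b) = (e', b')" if "(y, e, b) \<in> G" "(y, e', b') \<in> G" for y e b e' b'
  proof (rule ttsp_path[OF rf(1) _ that])
    fix a e a' e' b assume *: "(a, e, b) \<in> G" "(a', e', b) \<in> G"
    then have "b = d \<or> b \<in> P" using Q nodesI(2)[OF *(1)] dn by auto
    then show "(a, e) = (a', e')"
    proof
      assume "b = d"
      then have "acc a = Suc e" "acc a' = Suc e'" using into_d * by auto
      then show ?thesis using uniq[of a] uniq[of a'] by simp
    next
      assume "b \<in> P"
      then show ?thesis using work_head_cases(1)[OF wk *(1)] work_head_cases(1)[OF wk *(2)] by simp
    qed
  qed
  have "g = (x, acc x - 1, d)" if g: "g \<in> G" "fst g = x" for g
  proof -
    obtain e b where "g = (x, e, b)" using g(2) by (cases g) simp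
    then show ?thesis using path[OF xd, of e b] g(1) by simp
  qed
  then have "{g \<in> G. fst g = x} \<subseteq> {(x, acc x - 1, d)}" by blast
  moreover have "(x, acc x - 1, d) \<in> {g \<in> G. fst g = x}" using xd by simp
  ultimately have "{g \<in> G. fst g = x} = {(x, acc x - 1, d)}" by blast
  then have "cnt x = 0" using cx by simp
  then have xs: "x = Suc n" using eager x unfolding eager_def by blast
  have "G = {(Suc n, acc x - 1, n)} \<or> ttsp (G - {(Suc n, acc x - 1, n)}) (Suc n) n"
    by (rule ttsp_delete_source_sink[OF rf(1)]) (use xd xs dn in simp)
  then show "G = {(Suc n, acc x - 1, n)}"
  proof
    assume t: "ttsp (G - {(Suc n, acc x - 1, n)}) (Suc n) n"
    then obtain e b where "(Suc n, e, b) \<in> G - {(Suc n, acc x - 1, n)}"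
      using ttsp_ex_out[OF t] ttsp_terminals[OF t] by blast
    then show ?thesis using path[OF xd[unfolded xs dn], of e b] xs by auto
  qed
qed

lemma settled_init: "settled {Suc n} {Suc n} G0 par inn (\<lambda>y. length (bucket tn n y)) K L R n"
proof -
  have "reduced closed n (Suc n) n G0 K L R n" unfolding G0_def
    by (rule reduced_init) (use line_graph in \<open>auto simp: line_graph_def closed_def\<close>)
  moreover have "length (bucket tn n y) = card {g \<in> G0. fst g = y}" for y
  proof -
    have "{g \<in> G0. fst g = y} = (\<lambda>e. (tn e, e, hn e)) ` {e. e < n \<and> tn e = y}" by (auto simp: G0_def)
    then show ?thesis by (simp add: length_bucket card_image inj_on_def)
  qed
  moreover have "G0 = later_edges {Suc n}" using hn_not_source by (auto simp: G0_def)
  ultimately show ?thesis unfolding settled_def by auto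
qed

end

section \<open>The reduction as a program\<close>

definition combine :: com where
  "combine = Seq
    (If (Equal (Cell 10 (Reg 8)) (Const 0))
      (Store 10 (Reg 8) (Add (Reg 10) (Const 1)))
      (Seq (Store 13 (Reg 9) (Const 0))
      (Seq (Store 14 (Reg 9) (Sub (Cell 10 (Reg 8)) (Const 1)))
      (Seq (Store 15 (Reg 9) (Reg 10))
      (Seq (Assign 9 (Add (Reg 9) (Const 1)))
           (Store 10 (Reg 8) (Reg 9)))))))
    (Store 9 (Reg 8) (Sub (Cell 9 (Reg 8)) (Const 1)))"

text \<open>Registers 8 and 10 hold the tail and the label of the waiting edge. A series reduction
  produces such an edge again, one node further back; register 11 is cleared when none applies,
  which ends the loop in \<open>merge_edge\<close>.\<close>

definition contract :: com where
  "contract = If (And (Equal (Cell 9 (Reg 8)) (Const 0)) (Not (Equal (Reg 8) (Add (Reg 0) (Const 1)))))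
    (Seq (Store 13 (Reg 9) (Const 1))
    (Seq (Store 14 (Reg 9) (Cell 12 (Reg 8)))
    (Seq (Store 15 (Reg 9) (Sub (Cell 10 (Reg 8)) (Const 1)))
    (Seq (Assign 10 (Reg 9))
    (Seq (Assign 9 (Add (Reg 9) (Const 1)))
    (Seq (Store 10 (Reg 8) (Const 0))
         (Assign 8 (Cell 11 (Reg 8)))))))))
    (Assign 11 (Const 0))"

definition merge_edge :: com where
  "merge_edge = Seq (Seq (Assign 10 (Sub (Reg 7) (Const 1)))
      (Seq (Assign 8 (Cell 2 (Reg 10))) (Seq (Assign 7 (Cell 4 (Reg 10))) (Assign 11 (Const 1)))))
    (While (Less (Const 0) (Reg 11)) (Seq combine contract))"

definition merge_edges :: com where
  "merge_edges = While (Less (Const 0) (Reg 7))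
    merge_edge"

definition finish_node :: com where
  "finish_node =
    Seq (Store 11 (Reg 6) (Reg 8))
    (Seq (Store 12 (Reg 6) (Sub (Cell 10 (Reg 8)) (Const 1)))
    (Seq (Store 10 (Reg 8) (Const 0))
    (Seq (Store 9 (Reg 8) (Add (Cell 9 (Reg 8)) (Const 1)))
         (Assign 4 (Add (Reg 4) (Const 1))))))"

definition reduce_graph :: com where
  "reduce_graph = Seq (Seq (Assign 9 (Reg 0)) (Assign 4 (Const 1)))
    (While (Less (Reg 4) (Reg 5))
      (Seq (Seq (Assign 6 (Cell 8 (Reg 4))) (Assign 7 (Cell 3 (Reg 6))))
      (Seq merge_edges finish_node)))"

lemma (in ram) wp_While_cost:
  assumes "I \<sigma> k" "bcost b + 1 = d"
    and "\<And>\<sigma> k. I \<sigma> k \<Longrightarrow> k \<le> B"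
    and "\<And>\<sigma> k. I \<sigma> k \<Longrightarrow> bsafe \<sigma> b"
    and "\<And>\<sigma> k. good W \<sigma> \<Longrightarrow> I \<sigma> k \<Longrightarrow> bv x \<sigma> b \<Longrightarrow> wp p I \<sigma> (k + d)"
    and "\<And>\<sigma> k. good W \<sigma> \<Longrightarrow> I \<sigma> k \<Longrightarrow> \<not> bv x \<sigma> b \<Longrightarrow> Q \<sigma> (k + d)"
  shows "wp (While b p) Q \<sigma> k"
  by (rule wp_While[where I = I and B = B]) (use assms in auto)

context multigraph
begin

lemma le_W2: "k \<le> 2 * n + 50 \<Longrightarrow> k \<le> W"
  using header_le by (intro small_le_W) linarith

definition working where
  "working P A d Rem cur R M \<longleftrightarrow> header R \<and>
    (\<exists>G. work P A d Rem cur G (M 11) (M 12) (M 10) (M 9) (M 13) (M 14) (M 15) (R 9))"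

lemma work_ids:
  assumes "work P A d Rem {(x, v)} G par inn acc cnt K L R z"
  shows "v < z" "z < 2 * n" "x < n + 2" "n \<le> z"
proof -
  note w = workD[OF assms]
  note rf = reduced_facts[OF w(1)]
  have xv: "(x, v, d) \<in> G" by (subst w(8)) auto
  show "v < z" using rf(5)[OF xv] .
  show "n \<le> z" by (rule rf)
  have "card G \<noteq> 0" using xv rf(2) by auto
  then show "z < 2 * n" using rf(3) by linarith
  show "x < n + 2" using w(3,4,10) by auto
qed

lemma wp_combine:
  assumes w: "working P A d Rem {(R 8, R 10)} R M"
    and Q: "\<And>R' M' k'. working P A d Rem {} R' M' \<Longrightarrow> M' 10 (R 8) \<noteq> 0 \<Longrightarrow> M' 9 = (M 9)(R 8 := M 9 (R 8) - 1) \<Longrightarrow>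
      \<forall>y. y \<noteq> R 8 \<longrightarrow> M' 10 y = M 10 y \<Longrightarrow> \<forall>a. a \<notin> {9..15} \<longrightarrow> M' a = M a \<Longrightarrow> \<forall>r. r \<noteq> 9 \<longrightarrow> R' r = R r \<Longrightarrow>
      R 9 \<le> R' 9 \<Longrightarrow> k' \<le> k + 45 \<Longrightarrow> Q (R', M') k'"
  shows "wp combine Q (R, M) k"
proof -
  from w obtain G where h: "header R"
    and g: "work P A d Rem {(R 8, R 10)} G (M 11) (M 12) (M 10) (M 9) (M 13) (M 14) (M 15) (R 9)"
    by (auto simp: working_def)
  note ids = work_ids[OF g]
  have b: "R 8 < S" "R 10 + 1 \<le> W" "R 9 + 1 \<le> W" "R 9 < S" "1 \<le> W"
    using S_ge(2)[OF ids(3)] S_ge(3)[OF ids(2)] ids by (auto intro!: le_W2)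
  show ?thesis
  proof (rule vc_wp, cases "M 10 (R 8) = 0")
    case True
    note w' = work_store[OF g True]
    have "working P A d Rem {} R (M(10 := (M 10)(R 8 := Suc (R 10)), 9 := (M 9)(R 8 := M 9 (R 8) - 1)))"
      using w'(2) h by (auto simp: working_def)
    then show "vc combine Q (R, M) k"
      using True b by (auto simp: combine_def intro!: Q)
  next
    case False
    obtain G' where G': "work P A d Rem {} G' (M 11) (M 12) ((M 10)(R 8 := Suc (R 9))) ((M 9)(R 8 := M 9 (R 8) - 1))
        ((M 13)(R 9 := 0)) ((M 14)(R 9 := M 10 (R 8) - 1)) ((M 15)(R 9 := R 10)) (Suc (R 9))"
      using work_parallel(5)[OF g False] by blast
    have "working P A d Rem {} (R(9 := Suc (R 9))) (M(13 := (M 13)(R 9 := 0), 14 := (M 14)(R 9 := M 10 (R 8) - 1),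
        15 := (M 15)(R 9 := R 10), 10 := (M 10)(R 8 := Suc (R 9)), 9 := (M 9)(R 8 := M 9 (R 8) - 1)))"
      unfolding working_def using h G' by (intro conjI exI[of _ G']) (auto simp: header_def)
    then show "vc combine Q (R, M) k"
      using False b by (auto simp: combine_def intro!: Q)
  qed
qed

text \<open>\<open>combine\<close> has lowered the counter of the tail in register 8 only, so only
  there can a series reduction have become possible. This is why eagerness is assumed for all other
  tails.\<close>

lemma wp_contract:
  assumes w: "working P A d Rem {} R M" "M 10 (R 8) \<noteq> 0"
    and e: "\<And>y. y \<noteq> R 8 \<Longrightarrow> M 10 y \<noteq> 0 \<Longrightarrow> y \<noteq> Suc n \<Longrightarrow> M 9 y \<noteq> 0"
    and Q1: "\<And>R' k'. working P A d Rem {} R' M \<Longrightarrow> eager (M 10) (M 9) \<Longrightarrow> R' 11 = 0 \<Longrightarrow>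
      \<forall>r. r \<noteq> 11 \<longrightarrow> R' r = R r \<Longrightarrow> k' \<le> k + 35 \<Longrightarrow> Q (R', M) k'"
    and Q2: "\<And>R' M' k' A'. working P A' d Rem {(R' 8, R' 10)} R' M' \<Longrightarrow> eager (M' 10) (M' 9) \<Longrightarrow>
      \<forall>a. a \<notin> {9..15} \<longrightarrow> M' a = M a \<Longrightarrow> \<forall>r. r \<notin> {8, 9, 10} \<longrightarrow> R' r = R r \<Longrightarrow>
      R 9 < R' 9 \<Longrightarrow> k' \<le> k + 50 \<Longrightarrow> Q (R', M') k'"
  shows "wp contract Q (R, M) k"
proof -
  from w obtain G where h: "header R"
    and g: "work P A d Rem {} G (M 11) (M 12) (M 10) (M 9) (M 13) (M 14) (M 15) (R 9)"
    by (auto simp: working_def)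
  note wd = workD[OF g]
  have x: "R 8 < n + 2" using wd(9)[of "R 8"] wd(3,4) w(2) by auto
  have b: "R 8 < S" "R 0 + 1 \<le> W" "1 \<le> W" "R 0 = n" using h S_ge(2)[OF x] by (auto intro!: le_W2 simp: header_def)
  show ?thesis
  proof (rule vc_wp, cases "M 9 (R 8) = 0 \<and> R 8 \<noteq> Suc n")
    case False
    have "working P A d Rem {} (R(11 := 0)) M" using w by (auto simp: working_def header_def)
    moreover have "eager (M 10) (M 9)" unfolding eager_def using e False by metis
    ultimately show "vc contract Q (R, M) k"
      using False b by (auto simp: contract_def intro!: Q1)
  next
    case True
    note s = work_series[OF g w(2) conjunct1[OF True] conjunct2[OF True]]
    obtain G' where G': "work P (A - {R 8}) d Rem {(M 11 (R 8), R 9)} G' (M 11) (M 12) ((M 10)(R 8 := 0)) (M 9)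
        ((M 13)(R 9 := 1)) ((M 14)(R 9 := M 12 (R 8))) ((M 15)(R 9 := M 10 (R 8) - 1)) (Suc (R 9))"
      using s(5) by blast
    have z: "R 9 < S" "Suc (R 9) \<le> W" using s(1) by (auto intro!: S_ge le_W2)
    have "working P (A - {R 8}) d Rem {(M 11 (R 8), R 9)} (R(10 := R 9, 9 := Suc (R 9), 8 := M 11 (R 8)))
      (M(13 := (M 13)(R 9 := Suc 0), 14 := (M 14)(R 9 := M 12 (R 8)), 15 := (M 15)(R 9 := M 10 (R 8) - 1), 10 := (M 10)(R 8 := 0)))"
      unfolding working_def using h G' by (intro conjI exI[of _ G']) (auto simp: header_def)
    moreover have "eager ((M 10)(R 8 := 0)) (M 9)" unfolding eager_def using e by auto
    ultimately show "vc contract Q (R, M) k"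
      using True b z by (auto simp: contract_def intro!: Q2 split: if_splits)
  qed
qed

lemma working_z: "working P A d Rem cur R M \<Longrightarrow> n \<le> R 9 \<and> R 9 \<le> 2 * n"
  unfolding working_def using workD(1) reduced_facts(3,4) by (metis le_add2)

text \<open>The chain set off by one edge may be long, but every round except the last creates a
  component, so its time is charged to the increase of register 9.\<close>

lemma wp_merge_chain:
  assumes w: "working P A d Rem {(R 8, R 10)} R M" and e: "eager (M 10) (M 9)" and c: "R 11 = 1"
    and Q: "\<And>R' M' k' A'. working P A' d Rem {} R' M' \<Longrightarrow> eager (M' 10) (M' 9) \<Longrightarrow> M' 10 (R' 8) \<noteq> 0 \<Longrightarrow>
      \<forall>a. a \<notin> {9..15} \<longrightarrow> M' a = M a \<Longrightarrow> \<forall>r. r \<notin> {8..11} \<longrightarrow> R' r = R r \<Longrightarrow>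
      k' + 110 * R 9 \<le> k + 110 + 110 * R' 9 \<Longrightarrow> Q (R', M') k'"
  shows "wp (While (Less (Const 0) (Reg 11)) (Seq combine contract)) Q (R, M) k"
proof -
  define frame where "frame \<tau> \<longleftrightarrow> eager (snd \<tau> 10) (snd \<tau> 9) \<and>
    (\<forall>a. a \<notin> {9..15} \<longrightarrow> snd \<tau> a = M a) \<and> (\<forall>r. r \<notin> {8..11} \<longrightarrow> fst \<tau> r = R r)" for \<tau> :: state
  define more where "more \<tau> k' \<longleftrightarrow> fst \<tau> 11 \<noteq> 0 \<and> (\<exists>A'. working P A' d Rem {(fst \<tau> 8, fst \<tau> 10)} (fst \<tau>) (snd \<tau>)) \<and>
    frame \<tau> \<and> k' + 110 * R 9 \<le> k + 110 * fst \<tau> 9" for \<tau> :: state and k'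
  define stop where "stop \<tau> k' \<longleftrightarrow> fst \<tau> 11 = 0 \<and> (\<exists>A'. working P A' d Rem {} (fst \<tau>) (snd \<tau>)) \<and> snd \<tau> 10 (fst \<tau> 8) \<noteq> 0 \<and>
    frame \<tau> \<and> k' + 110 * R 9 \<le> k + 106 + 110 * fst \<tau> 9" for \<tau> :: state and k'
  show ?thesis
  proof (rule wp_While_cost[where I = "\<lambda>\<tau> k'. more \<tau> k' \<or> stop \<tau> k'" and d = 4 and B = "k + 106 + 220 * n"])
    show "more (R, M) k \<or> stop (R, M) k" using w e c by (auto simp: more_def frame_def)
    show "k' \<le> k + 106 + 220 * n" if "more \<tau> k' \<or> stop \<tau> k'" for \<tau> k'
    proof -
      have "fst \<tau> 9 \<le> 2 * n" "k' + 110 * R 9 \<le> k + 106 + 110 * fst \<tau> 9"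
        using that working_z unfolding more_def stop_def by fastforce+
      then show ?thesis by linarith
    qed
    show "wp (Seq combine contract) (\<lambda>\<tau> k'. more \<tau> k' \<or> stop \<tau> k') \<tau> (k1 + 4)"
      if J: "more \<tau> k1 \<or> stop \<tau> k1" "bv (encode I) \<tau> (Less (Const 0) (Reg 11))" for \<tau> k1
    proof -
      obtain R1 M1 where \<tau>: "\<tau> = (R1, M1)" by (cases \<tau>)
      have "more \<tau> k1" using J by (auto simp: stop_def)
      then obtain A' where A': "working P A' d Rem {(R1 8, R1 10)} R1 M1" and f: "frame (R1, M1)" and c1: "R1 11 \<noteq> 0"
        and t: "k1 + 110 * R 9 \<le> k + 110 * R1 9" by (auto simp: more_def \<tau>)
      show ?thesis unfolding \<tau>
      proof (rule wp_Seq, rule wp_combine[OF A'])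
        fix R2 M2 k2
        assume 2: "working P A' d Rem {} R2 M2" "M2 10 (R1 8) \<noteq> 0" "M2 9 = (M1 9)(R1 8 := M1 9 (R1 8) - 1)"
          "\<forall>y. y \<noteq> R1 8 \<longrightarrow> M2 10 y = M1 10 y" "\<forall>a. a \<notin> {9..15} \<longrightarrow> M2 a = M1 a" "\<forall>r. r \<noteq> 9 \<longrightarrow> R2 r = R1 r"
          "R1 9 \<le> R2 9" "k2 \<le> k1 + 4 + 45"
        have r8: "R2 8 = R1 8" using 2(6) by simp
        show "wp contract (\<lambda>\<tau> k'. more \<tau> k' \<or> stop \<tau> k') (R2, M2) (k2 + 1)"
        proof (rule wp_contract[OF 2(1)])
          show "M2 10 (R2 8) \<noteq> 0" using 2(2) r8 by simp
          show "M2 9 y \<noteq> 0" if "y \<noteq> R2 8" "M2 10 y \<noteq> 0" "y \<noteq> Suc n" for y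
            using f that 2(3,4) r8 by (auto simp: frame_def eager_def)
          fix R3 k3
          assume "working P A' d Rem {} R3 M2" "eager (M2 10) (M2 9)" "R3 11 = 0"
            "\<forall>r. r \<noteq> 11 \<longrightarrow> R3 r = R2 r" "k3 \<le> k2 + 1 + 35"
          then have "stop (R3, M2) k3" using f 2(2,5-8) t r8 by (auto simp: stop_def frame_def)
          then show "more (R3, M2) k3 \<or> stop (R3, M2) k3" ..
        next
          fix R3 M3 k3 A3
          assume 3: "working P A3 d Rem {(R3 8, R3 10)} R3 M3" "eager (M3 10) (M3 9)"
            "\<forall>a. a \<notin> {9..15} \<longrightarrow> M3 a = M2 a" "\<forall>r. r \<notin> {8, 9, 10} \<longrightarrow> R3 r = R2 r" "R2 9 < R3 9" "k3 \<le> k2 + 1 + 50"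
          have "R3 r = R r" if "r \<notin> {8..11}" for r
          proof -
            have "r \<notin> {8, 9, 10}" "r \<noteq> 9" using that by auto
            then show ?thesis using 3(4) 2(6) f that by (simp add: frame_def)
          qed
          then have "frame (R3, M3)" using f 2(5) 3(2,3) by (simp add: frame_def)
          moreover have "R3 11 \<noteq> 0" using 3(4) 2(6) c1 by simp
          moreover have "k3 + 110 * R 9 \<le> k + 110 * R3 9" using 3(5,6) 2(7,8) t by linarith
          ultimately have "more (R3, M3) k3" using 3(1) by (auto simp: more_def)
          then show "more (R3, M3) k3 \<or> stop (R3, M3) k3" ..
        qed
      qed
    qed
    show "Q \<tau> (k1 + 4)" if J: "more \<tau> k1 \<or> stop \<tau> k1" "\<not> bv (encode I) \<tau> (Less (Const 0) (Reg 11))" for \<tau> k1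
    proof -
      obtain R1 M1 where \<tau>: "\<tau> = (R1, M1)" by (cases \<tau>)
      have "stop (R1, M1) k1" using J by (auto simp: more_def \<tau>)
      then show ?thesis unfolding \<tau> stop_def frame_def by (auto intro!: Q)
    qed
  qed simp_all
qed

lemma wp_merge_edges:
  assumes w: "working P A d (set es) {} R M" and e: "eager (M 10) (M 9)" and l: "linked (M 4) (R 7) es" "distinct es"
    and M2: "M 2 = tn" and ne: "es \<noteq> []"
    and Q: "\<And>R' M' k' A'. working P A' d {} {} R' M' \<Longrightarrow> eager (M' 10) (M' 9) \<Longrightarrow> M' 10 (R' 8) \<noteq> 0 \<Longrightarrow>
      \<forall>a. a \<notin> {9..15} \<longrightarrow> M' a = M a \<Longrightarrow> \<forall>r. r \<notin> {7..11} \<longrightarrow> R' r = R r \<Longrightarrow>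
      k' + 110 * R 9 \<le> k + 4 + 140 * length es + 110 * R' 9 \<Longrightarrow> Q (R', M') k'"
  shows "wp merge_edges Q (R, M) k"
proof -
  \<comment> \<open>Register 8 names a tail with a merged edge only after the first round; since
    \<open>es\<close> is not empty, this is ensured at the end.\<close>
  define inv where "inv fs \<tau> k' \<longleftrightarrow> (\<exists>A'. working P A' d (set fs) {} (fst \<tau>) (snd \<tau>)) \<and> eager (snd \<tau> 10) (snd \<tau> 9) \<and>
    (\<forall>a. a \<notin> {9..15} \<longrightarrow> snd \<tau> a = M a) \<and> (\<forall>r. r \<notin> {7..11} \<longrightarrow> fst \<tau> r = R r) \<and>
    linked (M 4) (fst \<tau> 7) fs \<and> distinct fs \<and> (fs = es \<or> snd \<tau> 10 (fst \<tau> 8) \<noteq> 0) \<and>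
    k' + 140 * length fs + 110 * R 9 \<le> k + 140 * length es + 110 * fst \<tau> 9" for fs and \<tau> :: state and k'
  show ?thesis unfolding merge_edges_def
  proof (rule wp_While_cost[where I = "\<lambda>\<tau> k'. \<exists>fs. inv fs \<tau> k'" and d = 4 and B = "k + 140 * length es + 220 * n"])
    show "\<exists>fs. inv fs (R, M) k" using w e l by (intro exI[of _ es]) (auto simp: inv_def)
    show "k' \<le> k + 140 * length es + 220 * n" if "\<exists>fs. inv fs \<tau> k'" for \<tau> k'
    proof -
      from that obtain fs where "inv fs \<tau> k'" ..
      then have "fst \<tau> 9 \<le> 2 * n" "k' + 140 * length fs + 110 * R 9 \<le> k + 140 * length es + 110 * fst \<tau> 9"
        using working_z unfolding inv_def by fastforce+
      then show ?thesis by linarith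
    qed
    show "wp merge_edge (\<lambda>\<tau> k'. \<exists>fs. inv fs \<tau> k') \<tau> (k1 + 4)"
      if J: "\<exists>fs. inv fs \<tau> k1" "bv (encode I) \<tau> (Less (Const 0) (Reg 7))" for \<tau> k1
    proof -
      obtain R1 M1 where \<tau>: "\<tau> = (R1, M1)" by (cases \<tau>)
      from J obtain fs0 where J0: "inv fs0 \<tau> k1" by blast
      then obtain f fs where fs0: "fs0 = f # fs" using J(2) by (cases fs0) (auto simp: inv_def)
      from J0 obtain A' where A': "working P A' d (insert f (set fs)) {} R1 M1" and e1: "eager (M1 10) (M1 9)"
        and fr: "\<forall>a. a \<notin> {9..15} \<longrightarrow> M1 a = M a" "\<forall>r. r \<notin> {7..11} \<longrightarrow> R1 r = R r"
        and ln: "R1 7 = Suc f" "linked (M 4) (M 4 f) fs" "distinct fs" "f \<notin> set fs"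
        and t: "k1 + 140 * length fs + 140 + 110 * R 9 \<le> k + 140 * length es + 110 * R1 9"
        by (auto simp: inv_def \<tau> fs0)
      from A' obtain G where g: "work P A' d (insert f (set fs)) {} G (M1 11) (M1 12) (M1 10) (M1 9) (M1 13) (M1 14) (M1 15) (R1 9)"
        and h: "header R1" by (auto simp: working_def)
      have fn: "f < n" using workD(7)[OF g] by simp
      note g2 = work_next[OF g ln(4)]
      have m: "M1 2 = tn" "M1 4 = M 4" using fr(1) M2 by simp_all
      let ?R = "R1(10 := f, 8 := tn f, 7 := M 4 f, 11 := 1)"
      have wk: "working P A' d (set fs) {(?R 8, ?R 10)} ?R M1"
        unfolding working_def using g2 h by (auto simp: header_def)
      have "wp (While (Less (Const 0) (Reg 11)) (Seq combine contract)) (\<lambda>\<tau> k'. \<exists>fs. inv fs \<tau> k') (?R, M1) k2" if k2: "k2 \<le> k1 + 25" for k2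
      proof (rule wp_merge_chain[OF wk e1])
        fix R3 M3 k3 A3
        assume "working P A3 d (set fs) {} R3 M3" "eager (M3 10) (M3 9)" "M3 10 (R3 8) \<noteq> 0"
          "\<forall>a. a \<notin> {9..15} \<longrightarrow> M3 a = M1 a" "\<forall>r. r \<notin> {8..11} \<longrightarrow> R3 r = ?R r" "k3 + 110 * ?R 9 \<le> k2 + 110 + 110 * R3 9"
        then have "inv fs (R3, M3) k3" using fr ln t k2 by (auto simp: inv_def)
        then show "\<exists>fs. inv fs (R3, M3) k3" ..
      qed simp
      then show ?thesis unfolding \<tau> merge_edge_def using ln(1) fn m by (intro wp_Seq_vc) (auto simp: le_W2)
    qed
    show "Q \<tau> (k1 + 4)" if J: "\<exists>fs. inv fs \<tau> k1" "\<not> bv (encode I) \<tau> (Less (Const 0) (Reg 7))" for \<tau> k1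
    proof -
      obtain R1 M1 where \<tau>: "\<tau> = (R1, M1)" by (cases \<tau>)
      from J obtain fs where J0: "inv fs \<tau> k1" by blast
      then have fs: "fs = []" using J(2) by (cases fs) (auto simp: inv_def)
      show ?thesis using J0 ne unfolding \<tau> fs by (auto simp: inv_def intro!: Q)
    qed
  qed simp_all
qed

lemma topological_tails:
  assumes "topological ord" "i < length ord" "e < n"
  shows "hn e = ord ! i \<Longrightarrow> tn e \<in> set (take i ord)"
    and "hn e \<in> set (take i ord) \<Longrightarrow> tn e \<in> set (take i ord)"
proof -
  have t: "\<And>j. j < length ord \<Longrightarrow> hn e = ord ! j \<Longrightarrow> tn e \<in> set (take j ord)"
    using assms(1,3) unfolding topological_def by blast
  show "hn e = ord ! i \<Longrightarrow> tn e \<in> set (take i ord)" by (rule t[OF assms(2)])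
  assume "hn e \<in> set (take i ord)"
  then obtain j where j: "j < i" "hn e = ord ! j" using assms(2) by (auto simp: in_set_conv_nth)
  then have "tn e \<in> set (take j ord)" using t[of j] assms(2) by simp
  then show "tn e \<in> set (take i ord)" using set_take_subset_set_take[of j i ord] j(1) by auto
qed

lemma wp_reduce_graph:
  assumes h: "header R" and M: "M 2 = tn" "\<And>b. linked (M 4) (M 3 b) (bucket hn n b)"
    "M 9 = (\<lambda>b. length (bucket tn n b))" "M 10 = (\<lambda>_. 0)"
    and topo: "topological (map (M 8) [0..<R 5])"
    and Q: "\<And>R' M' k'. header R' \<Longrightarrow>
      reduced closed n (Suc n) n {(Suc n, M' 12 n, n)} (M' 13) (M' 14) (M' 15) (R' 9) \<Longrightarrow>
      \<forall>a. a \<notin> {9..15} \<longrightarrow> M' a = M a \<Longrightarrow> k' \<le> k + (310 * n + 160) \<Longrightarrow> Q (R', M') k'"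
  shows "wp reduce_graph Q (R, M) k"
proof -
  define ord where "ord = map (M 8) [0..<R 5]"
  have ord: "topological ord" "length ord = R 5" using topo by (simp_all add: ord_def)
  have nth: "M 8 i = ord ! i" if "i < R 5" for i using that by (simp add: ord_def)
  have od: "distinct ord" "set ord = nodes G0" "ord ! 0 = Suc n" "ord \<noteq> []" using ord(1) by (auto simp: topological_def)
  have nG0: "nodes G0 \<subseteq> {..<n + 2}" using hn_less tn_less by (auto simp: nodes_def)
  have len: "R 5 \<le> n + 2"
  proof -
    have "card (set ord) \<le> n + 2" using card_mono[OF _ nG0] od(2) by simp
    then show ?thesis using od(1) ord(2) by (simp add: distinct_card)
  qed
  have nt: "n \<in> set ord" unfolding od(2) using ttsp_terminals[OF ttsp_G0] by simp
  have R5: "0 < R 5" using od(4) ord(2) by (metis length_greater_0_conv)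
  define P where "P i = set (take i ord)" for i
  define handled where "handled i = card {e. e < n \<and> hn e \<in> P i}" for i
  \<comment> \<open>Three accounts pay for the time: 60 per node, 140 per edge entering a processed
    node and 110 per component created. Register 9 starts at \<open>n\<close>, hence
    \<open>110 * n\<close> on the left.\<close>
  define inv where "inv \<tau> k' \<longleftrightarrow> header (fst \<tau>) \<and> 1 \<le> fst \<tau> 4 \<and> fst \<tau> 4 \<le> R 5 \<and> fst \<tau> 5 = R 5 \<and>
    (\<exists>A G. settled (P (fst \<tau> 4)) A G (snd \<tau> 11) (snd \<tau> 12) (snd \<tau> 9) (snd \<tau> 13) (snd \<tau> 14) (snd \<tau> 15) (fst \<tau> 9) \<and>
      (n \<in> P (fst \<tau> 4) \<longrightarrow> G = {(Suc n, snd \<tau> 12 n, n)})) \<and>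
    snd \<tau> 10 = (\<lambda>_. 0) \<and> (\<forall>a. a \<notin> {9..15} \<longrightarrow> snd \<tau> a = M a) \<and>
    k' + 110 * n \<le> k + 20 + 60 * fst \<tau> 4 + 140 * handled (fst \<tau> 4) + 110 * fst \<tau> 9" for \<tau> :: state and k'
  have handled_le: "handled i \<le> n" for i
    using card_mono[of "{..<n}" "{e. e < n \<and> hn e \<in> P i}"] by (auto simp: handled_def)
  have bound: "k' \<le> k + (310 * n + 145)" if "inv \<tau> k'" for \<tau> k'
  proof -
    from that obtain A G where "settled (P (fst \<tau> 4)) A G (snd \<tau> 11) (snd \<tau> 12) (snd \<tau> 9) (snd \<tau> 13) (snd \<tau> 14) (snd \<tau> 15) (fst \<tau> 9)"
      unfolding inv_def by blast
    then have "card G + fst \<tau> 9 = 2 * n" unfolding settled_def using reduced_facts(3) by blast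
    then show ?thesis using that handled_le[of "fst \<tau> 4"] len unfolding inv_def by linarith
  qed
  define body where "body = Seq (Seq (Assign 6 (Cell 8 (Reg 4))) (Assign 7 (Cell 3 (Reg 6)))) (Seq merge_edges finish_node)"
  have "wp (While (Less (Reg 4) (Reg 5)) body) Q (R(9 := n, 4 := 1), M) k0" if k0: "k0 \<le> k + 10" for k0
  proof (rule wp_While_cost[where I = inv and d = 4 and B = "k + (310 * n + 145)"])
    have "P 1 = {Suc n}" using od(3,4) by (simp add: P_def take_Suc_conv_app_nth hd_conv_nth take_Suc)
    then show "inv (R(9 := n, 4 := 1), M) k0"
      using settled_init[of "M 11" "M 12" "M 13" "M 14" "M 15"] k0 h M R5 by (auto simp: inv_def header_def)
    show "k' \<le> k + (310 * n + 145)" if "inv \<tau> k'" for \<tau> k' using bound[OF that] .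
    show "wp body inv \<tau> (k1 + 4)" if J: "inv \<tau> k1" "bv (encode I) \<tau> (Less (Reg 4) (Reg 5))" for \<tau> k1
    proof -
      obtain R1 M1 where \<tau>: "\<tau> = (R1, M1)" by (cases \<tau>)
      let ?i = "R1 4"
      let ?d = "ord ! ?i"
      from J have i: "1 \<le> ?i" "?i < R 5" "R1 5 = R 5" and h1: "header R1" and acc: "M1 10 = (\<lambda>_. 0)"
        and fr: "\<And>a. a \<notin> {9..15} \<Longrightarrow> M1 a = M a"
        and t: "k1 + 110 * n \<le> k + 20 + 60 * ?i + 140 * handled ?i + 110 * R1 9"
        by (auto simp: inv_def \<tau>)
      from J obtain A G where s: "settled (P ?i) A G (M1 11) (M1 12) (M1 9) (M1 13) (M1 14) (M1 15) (R1 9)" by (auto simp: inv_def \<tau>)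
      have io: "?i < length ord" using i ord(2) by simp
      have PS: "P (Suc ?i) = insert ?d (P ?i)" using io by (simp add: P_def take_Suc_conv_app_nth)
      have dP: "?d \<notin> P ?i"
        using od(1) io by (simp add: P_def in_set_conv_nth nth_eq_iff_index_eq)
      have dG: "?d \<in> nodes G0" using io od(2) nth_mem by blast
      then have dn: "?d < n + 2" using nG0 by auto
      \<comment> \<open>The sink comes last: every node is an ancestor of it, and an initial segment
        of a topological order is closed under predecessors.\<close>
      have nP: "n \<notin> P ?i"
      proof
        assume "n \<in> P ?i"
        then have "nodes G0 \<subseteq> P ?i"
          by (rule ttsp_ancestors[OF ttsp_G0]) (use topological_tails(2)[OF ord(1) io] in \<open>auto simp: P_def\<close>)
        then show False using dG dP by auto
      qed
      have "Suc n \<in> P ?i" using od(3,4) i(1) io by (auto simp: P_def in_set_conv_nth intro!: exI[of _ 0])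
      then have ds: "?d \<noteq> Suc n" using dP by auto
      let ?es = "bucket hn n ?d"
      have ne: "?es \<noteq> []"
      proof -
        obtain a e where "(a, e, ?d) \<in> G0" using ttsp_ex_in[OF ttsp_G0 dG ds] by blast
        then have "e \<in> set ?es" by simp
        then show ?thesis by force
      qed
      have wk0: "work (P ?i) A ?d {e. e < n \<and> hn e = ?d} {} G (M1 11) (M1 12) (\<lambda>_. 0) (M1 9) (M1 13) (M1 14) (M1 15) (R1 9)"
        by (rule settled_work[OF s dP dn]) (use topological_tails(1)[OF ord(1) io] in \<open>auto simp: P_def\<close>)
      have dn_eq: "handled (Suc ?i) = handled ?i + length ?es"
      proof -
        have "{e. e < n \<and> hn e \<in> P (Suc ?i)} = {e. e < n \<and> hn e \<in> P ?i} \<union> {e. e < n \<and> hn e = ?d}"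
          using PS by auto
        moreover have "{e. e < n \<and> hn e \<in> P ?i} \<inter> {e. e < n \<and> hn e = ?d} = {}" using dP by (intro equals0I) (metis (mono_tags, lifting) IntD1 IntD2 mem_Collect_eq)
        ultimately show ?thesis unfolding handled_def length_bucket by (simp add: card_Un_disjoint)
      qed
      let ?R = "R1(6 := ?d, 7 := M 3 ?d)"
      have wk: "working (P ?i) A ?d (set ?es) {} ?R M1"
        unfolding working_def using wk0 h1 acc by (auto simp: header_def)
      have m: "M1 2 = tn" "M1 4 = M 4" "M1 3 = M 3" "M1 8 = M 8" using fr M by simp_all
      have "wp (Seq merge_edges finish_node) inv (?R, M1) k2" if k2: "k2 \<le> k1 + 14" for k2
      proof (rule wp_Seq, rule wp_merge_edges[OF wk _ _ distinct_bucket m(1) ne])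
        show "eager (M1 10) (M1 9)" by (simp add: eager_def acc)
        show "linked (M1 4) (?R 7) ?es" using M(2) by (simp add: m)
        fix R3 M3 k3 A3
        assume 3: "working (P ?i) A3 ?d {} {} R3 M3" "eager (M3 10) (M3 9)" "M3 10 (R3 8) \<noteq> 0"
          "\<forall>a. a \<notin> {9..15} \<longrightarrow> M3 a = M1 a" "\<forall>r. r \<notin> {7..11} \<longrightarrow> R3 r = ?R r"
          "k3 + 110 * ?R 9 \<le> k2 + 4 + 140 * length ?es + 110 * R3 9"
        from 3(1) obtain G3 where g3: "work (P ?i) A3 ?d {} {} G3 (M3 11) (M3 12) (M3 10) (M3 9) (M3 13) (M3 14) (M3 15) (R3 9)"
          and h3: "header R3" by (auto simp: working_def)
        note f = work_settled[OF g3 3(2,3)]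
        have r: "R3 6 = ?d" "R3 4 = ?i" "R3 5 = R 5" using 3(5) i(3) by simp_all
        let ?\<tau> = "(R3(4 := Suc ?i), M3(11 := (M3 11)(?d := R3 8), 12 := (M3 12)(?d := M3 10 (R3 8) - 1),
          10 := (M3 10)(R3 8 := 0), 9 := (M3 9)(R3 8 := M3 9 (R3 8) + 1)))"
        have a0: "(M3 10)(R3 8 := 0) = (\<lambda>_. 0)" by (subst f(1)) (auto simp: fun_eq_iff)
        have a1: "n \<in> P (Suc ?i) \<longrightarrow> G3 = {(Suc n, ((M3 12)(?d := M3 10 (R3 8) - 1)) n, n)}"
          using f(4) nP unfolding PS by auto
        have a2: "\<forall>a. a \<notin> {9..15} \<longrightarrow> M3 a = M a" using 3(4) fr by auto
        have a3: "k' + 110 * n \<le> k + 20 + 60 * Suc ?i + 140 * handled (Suc ?i) + 110 * R3 9" if "k' \<le> k3 + 30" for k'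
          using that 3(6) t k2 unfolding dn_eq by simp
        have "inv ?\<tau> k'" if "k' \<le> k3 + 30" for k'
          unfolding inv_def
        proof (intro conjI exI)
          show "settled (P (fst ?\<tau> 4)) (insert ?d A3) G3 (snd ?\<tau> 11) (snd ?\<tau> 12) (snd ?\<tau> 9) (snd ?\<tau> 13) (snd ?\<tau> 14) (snd ?\<tau> 15) (fst ?\<tau> 9)"
            using f(3) by (simp add: PS)
          show "n \<in> P (fst ?\<tau> 4) \<longrightarrow> G3 = {(Suc n, snd ?\<tau> 12 n, n)}" using a1 by simp
          show "k' + 110 * n \<le> k + 20 + 60 * fst ?\<tau> 4 + 140 * handled (fst ?\<tau> 4) + 110 * fst ?\<tau> 9"
            using a3[OF that] by simp
        qed (use a0 a2 h3 r i in \<open>simp_all add: header_def\<close>)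
        moreover have "card G3 \<le> 2 * n" using reduced_facts(3)[OF workD(1)[OF g3]] by simp
        moreover have "M3 9 (R3 8) + 1 \<le> W" using f(5) calculation(2) by (intro le_W2) linarith
        moreover have "?d < S" "R3 8 < S" using S_ge(2)[OF dn] S_ge(2)[OF f(2)] .
        moreover have "R 5 \<le> W" using len by (intro le_W2) linarith
        ultimately show "wp finish_node inv (R3, M3) (k3 + 1)"
          unfolding finish_node_def using r i by (intro vc_wp) (auto simp: le_W2)
      qed
      moreover have "?i < S" using i(2) len S_ge(2)[of ?i] by simp
      moreover have "?d < S" using S_ge(2)[OF dn] .
      ultimately show ?thesis unfolding body_def \<tau> using m i(2) by (intro wp_Seq_vc) (auto simp: nth)
    qed
    show "Q \<tau> (k1 + 4)" if J: "inv \<tau> k1" "\<not> bv (encode I) \<tau> (Less (Reg 4) (Reg 5))" for \<tau> k1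
    proof -
      obtain R1 M1 where \<tau>: "\<tau> = (R1, M1)" by (cases \<tau>)
      have "R1 4 = R 5" using J by (auto simp: inv_def \<tau>)
      then have "n \<in> P (R1 4)" using nt ord(2) by (simp add: P_def)
      then show ?thesis using J bound[OF J(1)] unfolding \<tau>
        by (intro Q) (auto simp: inv_def settled_def)
    qed
  qed simp_all
  then show ?thesis unfolding reduce_graph_def body_def[symmetric]
    by (intro wp_Seq_vc) (use h in \<open>simp add: header_def\<close>)
qed

end

section \<open>Dynamic programming over the decomposition tree\<close>

definition "cell_addr y w = Add (Mul y (Reg 13)) w"

definition fill_leaf :: com where
  "fill_leaf = Seq (Store 17 (Reg 3) (Input (Add (Reg 3) (Const 3))))
    (Seq (Store 16 (cell_addr (Reg 3) (Const 0)) (Const 1))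
         (If (Less (Reg 2) (Cell 17 (Reg 3))) Skip (Store 16 (cell_addr (Reg 3) (Cell 17 (Reg 3))) (Const 1))))"

definition leaf_tables :: com where
  "leaf_tables = For 3 0
    fill_leaf"

definition join_test :: bexp where
  "join_test = And (Less (Add (Reg 7) (Reg 8)) (Reg 13))
    (And (Less (Const 0) (Cell 16 (cell_addr (Reg 5) (Reg 7))))
    (And (Less (Const 0) (Cell 16 (cell_addr (Reg 6) (Reg 8))))
         (Not (And (Less (Const 0) (Cell 13 (Reg 4)))
              (And (Less (Const 0) (Reg 7)) (Not (Equal (Reg 8) (Cell 17 (Reg 6)))))))))"

text \<open>The entry \<open>i + 1\<close> for the size \<open>i + j\<close> is at once a mark of
  attainability, being non-zero, and a record of the left share \<open>i\<close>.\<close>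

definition join_pair :: com where
  "join_pair = If join_test (Store 16 (cell_addr (Reg 4) (Add (Reg 7) (Reg 8))) (Add (Reg 7) (Const 1))) Skip"

definition fill_node :: com where
  "fill_node = Seq (Seq (Assign 4 (Add (Reg 0) (Reg 3)))
      (Seq (Assign 5 (Cell 14 (Reg 4)))
      (Seq (Assign 6 (Cell 15 (Reg 4)))
           (Store 17 (Reg 4) (Add (Cell 17 (Reg 5)) (Cell 17 (Reg 6)))))))
    (For 7 13 (For 8 13 join_pair))"

definition node_tables :: com where
  "node_tables = For 3 12
    fill_node"

section \<open>Correctness of the tables\<close>

locale decomposition = msp_instance +
  fixes z :: nat and K L R :: "nat \<Rightarrow> nat" and tr :: "nat \<Rightarrow> sptree" and r :: nat
  assumes tree: "tree_arrays n z K L R tr" and root: "tree_root n z L R r"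
    and leaves_root: "leaves (tr r) = {..<n}"
    and z_bounds: "n \<le> z" "z \<le> 2 * n"
begin

abbreviation "weight \<equiv> total_size I"

lemma Leaf_tr: "y < n \<Longrightarrow> tr y = Leaf y"
  using tree by (simp add: tree_arrays_def)

lemma Node_tr:
  assumes "n \<le> y" "y < z"
  shows "tr y = Node (K y \<noteq> 0) (tr (L y)) (tr (R y))" "L y < y" "R y < y" "L y \<noteq> R y"
    "leaves (tr (L y)) \<inter> leaves (tr (R y)) = {}"
proof -
  have *: "tr y = Node (K y \<noteq> 0) (tr (L y)) (tr (R y)) \<and> L y < y \<and> R y < y \<and> L y \<noteq> R y"
    "disjoint_tree (tr y)"
    using tree assms unfolding tree_arrays_def by blast+
  then show "tr y = Node (K y \<noteq> 0) (tr (L y)) (tr (R y))" "L y < y" "R y < y" "L y \<noteq> R y" by simp_all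
  then show "leaves (tr (L y)) \<inter> leaves (tr (R y)) = {}" using *(2) by simp
qed

lemma children_disjoint: "n \<le> y \<Longrightarrow> y < y' \<Longrightarrow> y' < z \<Longrightarrow> {L y, R y} \<inter> {L y', R y'} = {}"
  using tree by (simp add: tree_arrays_def)

lemma leaves_less: "y < z \<Longrightarrow> leaves (tr y) \<subseteq> {..<n}"
proof (induction y rule: less_induct)
  case (less y)
  show ?case
  proof (cases "y < n")
    case True
    then show ?thesis by (simp add: Leaf_tr)
  next
    case False
    then show ?thesis using Node_tr[of y] less by (auto simp: less_trans)
  qed
qed

lemma weight_Un: "A \<inter> B = {} \<Longrightarrow> finite A \<Longrightarrow> finite B \<Longrightarrow> weight (A \<union> B) = weight A + weight B"
  by (simp add: total_size_def sum.union_disjoint)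

lemma weight_zero:
  assumes "X \<subseteq> {..<n}" "weight X = 0"
  shows "X = {}"
proof -
  have "finite X" using assms(1) finite_subset by blast
  then have "\<forall>j \<in> X. wt j = 0" using assms(2) by (simp add: total_size_def)
  then show ?thesis using size_pos assms(1) by fastforce
qed

lemma weight_full:
  assumes "X \<subseteq> Y" "Y \<subseteq> {..<n}" "weight X = weight Y"
  shows "X = Y"
proof -
  have f: "finite Y" using assms(2) finite_subset by blast
  have "weight (X \<union> (Y - X)) = weight X + weight (Y - X)"
    using f assms(1) finite_subset by (intro weight_Un) auto
  moreover have "X \<union> (Y - X) = Y" using assms(1) by blast
  ultimately have "weight (Y - X) = 0" using assms(3) by simp
  then have "Y - X = {}" using assms(2) by (intro weight_zero) auto
  then show ?thesis using assms(1) by blast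
qed

text \<open>Total sizes of components may exceed \<open>c\<close>, yet they have to fit into words
  because the series test compares with them.\<close>

lemma weight_le:
  assumes "X \<subseteq> {..<n}"
  shows "weight X \<le> wbase * wbase"
proof -
  have "wt j \<le> wbase" if "j < n" for j
    using encode_le[of "j + 3"] encode_size[OF that] length_encode that by simp
  then have "weight X \<le> (\<Sum>j\<in>X. wbase)" unfolding total_size_def using assms by (intro sum_mono) auto
  also have "\<dots> = card X * wbase" by simp
  also have "\<dots> \<le> wbase * wbase" using card_mono[OF _ assms] header_le(1) by (intro mult_le_mono1) simp
  finally show ?thesis .
qed

definition cell :: "(nat \<Rightarrow> nat) \<Rightarrow> nat \<Rightarrow> nat \<Rightarrow> nat" where
  "cell T y w = T (y * Suc c + w)"

text \<open>\<open>i\<close> and \<open>j\<close> are sizes of feasible parts of the two components of \<open>y\<close>. Since sizes are positive,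
  only the empty part has size 0, and only the complete one the total size.\<close>

definition joins :: "(nat \<Rightarrow> nat) \<Rightarrow> nat \<Rightarrow> nat \<Rightarrow> nat \<Rightarrow> bool" where
  "joins T y i j \<longleftrightarrow> i + j \<le> c \<and> cell T (L y) i \<noteq> 0 \<and> cell T (R y) j \<noteq> 0 \<and>
    (K y \<noteq> 0 \<longrightarrow> i = 0 \<or> j = weight (leaves (tr (R y))))"

text \<open>A row is related only to the rows of the two children, so rows can be filled in the
  order of the numbering. Leaf entries are merely tested for zero.\<close>

definition row :: "(nat \<Rightarrow> nat) \<Rightarrow> nat \<Rightarrow> bool" where
  "row T y \<longleftrightarrow> (if y < n then \<forall>w \<le> c. cell T y w \<noteq> 0 \<longleftrightarrow> w = 0 \<or> w = wt y
    else (\<forall>w \<le> c. cell T y w \<noteq> 0 \<longrightarrow> cell T y w - 1 \<le> w \<and> joins T y (cell T y w - 1) (w - (cell T y w - 1))) \<and>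
      (\<forall>i j. joins T y i j \<longrightarrow> cell T y (i + j) \<noteq> 0))"

text \<open>Induction along the numbering, children coming first. Disjointness of the leaves makes
  the weights of the two parts add up to \<open>w\<close>.\<close>

lemma row_correct:
  assumes "\<And>y. y < z \<Longrightarrow> row T y" "y < z" "w \<le> c"
  shows "cell T y w \<noteq> 0 \<longleftrightarrow> (\<exists>X \<in> fam (tr y). weight X = w)"
  using assms(2,3)
proof (induction y arbitrary: w rule: less_induct)
  case (less y)
  note row = assms(1)[OF less.prems(1)]
  show ?case
  proof (cases "y < n")
    case True
    then show ?thesis using row less.prems by (auto simp: row_def Leaf_tr total_size_def)
  next
    case False
    note nt = Node_tr[OF _ less.prems(1)]
    have y: "n \<le> y" using False by simp
    have lz: "L y < z" "R y < z" using nt(2,3)[OF y] less.prems by simp_all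
    note IH = less.IH[OF nt(2)[OF y] lz(1)] less.IH[OF nt(3)[OF y] lz(2)]
    have sub: "X \<subseteq> {..<n}" if "X \<in> fam (tr (L y)) \<or> X \<in> fam (tr (R y))" for X
      using that fam_subset leaves_less[OF lz(1)] leaves_less[OF lz(2)] by blast
    have wU: "weight (A \<union> B) = weight A + weight B" if "A \<in> fam (tr (L y))" "B \<in> fam (tr (R y))" for A B
    proof (rule weight_Un)
      show "A \<inter> B = {}" using fam_subset[OF that(1)] fam_subset[OF that(2)] nt(5)[OF y] by blast
      show "finite A" "finite B" using sub that finite_subset by blast+
    qed
    have fy: "fam (tr y) = {A \<union> B |A B. A \<in> fam (tr (L y)) \<and> B \<in> fam (tr (R y)) \<and> (K y \<noteq> 0 \<longrightarrow> A = {} \<or> B = leaves (tr (R y)))}"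
      by (subst nt(1)[OF y]) simp
    show ?thesis
    proof
      assume c0: "cell T y w \<noteq> 0"
      define i where "i = cell T y w - 1"
      have i: "i \<le> w" "joins T y i (w - i)" using row c0 less.prems False by (auto simp: row_def i_def)
      have "\<exists>A \<in> fam (tr (L y)). weight A = i" "\<exists>B \<in> fam (tr (R y)). weight B = w - i"
        using IH(1)[of i] IH(2)[of "w - i"] less.prems i by (simp_all add: joins_def)
      then obtain A B where AB: "A \<in> fam (tr (L y))" "weight A = i" "B \<in> fam (tr (R y))" "weight B = w - i"
        by blast
      have "K y \<noteq> 0 \<longrightarrow> A = {} \<or> B = leaves (tr (R y))"
        using i(2) AB sub weight_zero[of A] weight_full[OF fam_subset[OF AB(3)] leaves_less[OF lz(2)]]
        by (auto simp: joins_def)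
      then have "A \<union> B \<in> fam (tr y)" using AB unfolding fy by blast
      moreover have "weight (A \<union> B) = w" using wU AB i by simp
      ultimately show "\<exists>X \<in> fam (tr y). weight X = w" by blast
    next
      assume "\<exists>X \<in> fam (tr y). weight X = w"
      then obtain A B where AB: "A \<in> fam (tr (L y))" "B \<in> fam (tr (R y))" "weight (A \<union> B) = w"
        "K y \<noteq> 0 \<longrightarrow> A = {} \<or> B = leaves (tr (R y))"
        unfolding fy by blast
      have w: "w = weight A + weight B" using wU AB by simp
      have "joins T y (weight A) (weight B)" unfolding joins_def
        using IH(1)[of "weight A"] IH(2)[of "weight B"] AB w less.prems by (auto simp: total_size_def)
      then show "cell T y w \<noteq> 0" using row False w by (auto simp: row_def)
    qed
  qed
qed

text \<open>The zeros beyond the filled rows make a new row start out empty.\<close>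

definition tables :: "nat \<Rightarrow> (nat \<Rightarrow> nat) \<Rightarrow> (nat \<Rightarrow> nat) \<Rightarrow> bool" where
  "tables Y T tot \<longleftrightarrow> (\<forall>y<Y. row T y) \<and> (\<forall>a \<ge> Y * Suc c. T a = 0) \<and> (\<forall>y<Y. tot y = weight (leaves (tr y)))"

lemma cell_eqI:
  assumes "\<And>a. a < Y * Suc c \<Longrightarrow> T a = T' a" "y < Y" "w \<le> c"
  shows "cell T y w = cell T' y w"
proof -
  have "y * Suc c + w < Suc y * Suc c" using assms(3) by simp
  also have "\<dots> \<le> Y * Suc c" using assms(2) by (intro mult_le_mono1) simp
  finally show ?thesis using assms(1) by (simp add: cell_def)
qed

lemma row_cong:
  assumes "\<And>a. a < Y * Suc c \<Longrightarrow> T a = T' a" "y < Y" "y < z"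
  shows "row T y = row T' y"
proof (cases "y < n")
  case True
  then show ?thesis using cell_eqI[OF assms(1,2)] by (simp add: row_def)
next
  case False
  then have lr: "L y < Y" "R y < Y" using Node_tr[of y] assms by auto
  have j: "joins T y i j \<longleftrightarrow> joins T' y i j" for i j
  proof (cases "i + j \<le> c")
    case True
    then show ?thesis using cell_eqI[OF assms(1) lr(1), where w = i] cell_eqI[OF assms(1) lr(2), where w = j] by (simp add: joins_def)
  qed (simp add: joins_def)
  have cy: "cell T y w = cell T' y w" if "w \<le> c" for w using cell_eqI[OF assms(1,2) that] .
  have le: "i + j \<le> c" if "joins T' y i j" for i j using that by (simp add: joins_def)
  show ?thesis using False cy le unfolding row_def j by auto
qed

lemma addr_less:
  assumes "y < 2 * n" "w \<le> c"
  shows "y * Suc c + w < S" "y * Suc c \<le> W" "y * Suc c + w \<le> W" "y * Suc c + w < 4 * n * c"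
proof -
  have "y * Suc c + w < Suc y * Suc c" using assms(2) by simp
  also have "\<dots> \<le> (2 * n) * (2 * c)" using assms(1) c_pos by (intro mult_le_mono) auto
  finally show s: "y * Suc c + w < S" "y * Suc c + w < 4 * n * c" by (simp_all add: S_def)
  have "n * c \<le> wbase * wbase" using header_le by (intro mult_le_mono)
  then have "4 * n * c \<le> W" using W_ge by linarith
  then show "y * Suc c + w \<le> W" "y * Suc c \<le> W" using s(2) by linarith+
qed

text \<open>As columns are at most \<open>c\<close>, quotient and remainder by \<open>c + 1\<close>
  recover row and column from an address.\<close>

lemma cell_upd:
  assumes "w \<le> c" "w' \<le> c"
  shows "cell (T(y * Suc c + w := v)) y' w' = (if y' = y \<and> w' = w then v else cell T y' w')"
proof -
  have "y' = y \<and> w' = w" if "y' * Suc c + w' = y * Suc c + w"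
  proof -
    have "(w' + y' * Suc c) div Suc c = (w + y * Suc c) div Suc c" using that by (simp add: add.commute)
    then have "y' = y" using assms by (simp del: mult_Suc_right)
    then show ?thesis using that by simp
  qed
  then show ?thesis by (auto simp: cell_def)
qed

lemma tables_leaf:
  assumes t: "tables i T tot" and i: "i < n"
    and T': "T' = (if wt i \<le> c then T(i * Suc c + 0 := 1, i * Suc c + wt i := 1) else T(i * Suc c + 0 := 1))"
  shows "tables (Suc i) T' (tot(i := wt i))"
proof -
  have out: "T' a = T a" if "a < i * Suc c \<or> a \<ge> Suc i * Suc c" for a
    using that unfolding T' by auto
  have z0: "cell T i w = 0" for w using t by (simp add: tables_def cell_def)
  have "cell T' i w \<noteq> 0 \<longleftrightarrow> w = 0 \<or> w = wt i" if "w \<le> c" for w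
    using that cell_upd[of 0 w T i 1 i] cell_upd[of "wt i" w "T(i * Suc c + 0 := 1)" i 1 i] z0
    unfolding T' by (auto simp del: mult_Suc_right)
  then have "row T' i" using i by (simp add: row_def)
  moreover have "row T' y" if "y < i" for y
    using row_cong[of i T T' y] out t that i z_bounds by (simp add: tables_def)
  ultimately have "row T' y" if "y < Suc i" for y using that by (auto simp: less_Suc_eq)
  moreover have "T' a = 0" if "a \<ge> Suc i * Suc c" for a
  proof -
    have "a \<ge> i * Suc c" using that by simp
    then show ?thesis using out[of a] that t unfolding tables_def by metis
  qed
  moreover have "(tot(i := wt i)) y = weight (leaves (tr y))" if "y < Suc i" for y
    using that t i by (auto simp: tables_def less_Suc_eq Leaf_tr total_size_def)
  ultimately show ?thesis unfolding tables_def by blast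
qed

text \<open>\<open>joins\<close> refers to the table \<open>T0\<close> from before row
  \<open>y\<close> was begun; the children have smaller numbers, so their rows stay as they
  were.\<close>

definition partial_row where
  "partial_row y D T0 T \<longleftrightarrow> (\<forall>a. a < y * Suc c \<or> a \<ge> Suc y * Suc c \<longrightarrow> T a = T0 a) \<and>
    (\<forall>w \<le> c. cell T y w \<noteq> 0 \<longrightarrow> cell T y w - 1 \<le> w \<and> joins T0 y (cell T y w - 1) (w - (cell T y w - 1))) \<and>
    (\<forall>(i, j) \<in> D. joins T0 y i j \<longrightarrow> cell T y (i + j) \<noteq> 0)"

lemma partial_row_init:
  assumes "tables y T tot"
  shows "partial_row y {} T T"
  using assms by (simp add: partial_row_def tables_def cell_def)

lemma partial_row_skip:
  "partial_row y D T0 T \<Longrightarrow> \<not> joins T0 y i j \<Longrightarrow> partial_row y (insert (i, j) D) T0 T"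
  by (auto simp: partial_row_def)

text \<open>An earlier entry for the same sum may be overwritten: any valid pair serves as a
  witness.\<close>

lemma partial_row_step:
  assumes p: "partial_row y D T0 T" and j: "joins T0 y i j"
  shows "partial_row y (insert (i, j) D) T0 (T(y * Suc c + (i + j) := Suc i))"
proof -
  have ij: "i + j \<le> c" using j by (simp add: joins_def)
  note cu = cell_upd[OF ij, of _ T y "Suc i" y]
  let ?T = "T(y * Suc c + (i + j) := Suc i)"
  have "?T a = T0 a" if "a < y * Suc c \<or> a \<ge> Suc y * Suc c" for a
    using that p ij by (auto simp: partial_row_def)
  moreover have "cell ?T y w - 1 \<le> w \<and> joins T0 y (cell ?T y w - 1) (w - (cell ?T y w - 1))"
    if "w \<le> c" "cell ?T y w \<noteq> 0" for w
    using cu[OF that(1)] that p j by (cases "w = i + j") (auto simp: partial_row_def)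
  moreover have "cell ?T y (i' + j') \<noteq> 0" if "(i', j') \<in> insert (i, j) D" "joins T0 y i' j'" for i' j'
  proof -
    have "i' + j' \<le> c" using that(2) by (simp add: joins_def)
    then show ?thesis using cu[of "i' + j'"] that p by (auto simp: partial_row_def)
  qed
  ultimately show ?thesis unfolding partial_row_def by blast
qed

lemma partial_row_final:
  assumes t: "tables y T0 tot" and y: "n \<le> y" "y < z" and p: "partial_row y ({..c} \<times> {..c}) T0 T"
  shows "tables (Suc y) T (tot(y := tot (L y) + tot (R y)))"
proof -
  note nt = Node_tr[OF y]
  have out: "T a = T0 a" if "a < y * Suc c \<or> a \<ge> Suc y * Suc c" for a
    using that p unfolding partial_row_def by blast
  have lr: "cell T (L y) w = cell T0 (L y) w" "cell T (R y) w = cell T0 (R y) w" if "w \<le> c" for w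
    using cell_eqI[of y T T0 _ w] out nt(2,3) that by simp_all
  have joins: "joins T y i j \<longleftrightarrow> joins T0 y i j" for i j
    using lr[of i] lr[of j] by (auto simp: joins_def)
  have "row T y" using p y unfolding row_def joins partial_row_def by (auto simp: joins_def)
  moreover have "row T y'" if "y' < y" for y'
    using row_cong[of y T0 T y'] out t that y by (simp add: tables_def)
  ultimately have "row T y'" if "y' < Suc y" for y' using that by (auto simp: less_Suc_eq)
  moreover have "T a = 0" if "a \<ge> Suc y * Suc c" for a
  proof -
    have "a \<ge> y * Suc c" using that by simp
    then show ?thesis using out[of a] that t unfolding tables_def by metis
  qed
  moreover have "(tot(y := tot (L y) + tot (R y))) y' = weight (leaves (tr y'))" if "y' < Suc y" for y'
  proof (cases "y' = y")
    case True
    have "weight (leaves (tr y)) = weight (leaves (tr (L y))) + weight (leaves (tr (R y)))"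
      by (subst nt(1)) (simp add: weight_Un nt(5))
    then show ?thesis using True t nt by (simp add: tables_def)
  next
    case False
    then show ?thesis using that t by (simp add: tables_def)
  qed
  ultimately show ?thesis unfolding tables_def by blast
qed

section \<open>Programs that fill the tables\<close>

definition dp_header :: "(nat \<Rightarrow> nat) \<Rightarrow> bool" where
  "dp_header Q \<longleftrightarrow> header Q \<and> Q 9 = z \<and> Q 12 = z - n \<and> Q 13 = Suc c"

lemma small_W: "k \<le> 2 * n + c + 50 \<Longrightarrow> k \<le> W"
  using header_le W_ge wbase_le by linarith

lemma weight_le_W: "X \<subseteq> {..<n} \<Longrightarrow> weight X \<le> W"
  using weight_le[of X] W_ge by linarith

lemma wp_leaf_tables:
  assumes h: "dp_header R0" and t: "M0 16 = (\<lambda>_. 0)"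
    and Q: "\<And>R' M' k'. dp_header R' \<Longrightarrow> tables n (M' 16) (M' 17) \<Longrightarrow>
      \<forall>a. a \<notin> {16, 17} \<longrightarrow> M' a = M0 a \<Longrightarrow> k' \<le> k + (n * 69 + 7) \<Longrightarrow> Q (R', M') k'"
  shows "wp leaf_tables Q (R0, M0) k"
  unfolding leaf_tables_def
proof (rule wp_For[where T = 60 and N = n and
    I = "\<lambda>i R' M'. dp_header R' \<and> tables i (M' 16) (M' 17) \<and> (\<forall>a. a \<notin> {16, 17} \<longrightarrow> M' a = M0 a)"])
  show "dp_header (R0(3 := 0)) \<and> tables 0 (M0 16) (M0 17) \<and> (\<forall>a. a \<notin> {16, 17} \<longrightarrow> M0 a = M0 a)"
    using h t by (simp add: dp_header_def header_def tables_def)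
  fix i R' M' k'
  assume I: "dp_header R' \<and> tables i (M' 16) (M' 17) \<and> (\<forall>a. a \<notin> {16, 17} \<longrightarrow> M' a = M0 a)" "R' 3 = i" "i < n"
  have in_len: "i + 3 < length (encode I)" using I(3) length_encode by simp
  have sz: "encode I ! (i + 3) = wt i" "wt i \<le> W" using encode_size[OF I(3)] encode_le_W[OF in_len] by simp_all
  have i2: "i < 2 * n" "i < S" using I(3) by (auto intro: S_ge)
  note a0 = addr_less[OF i2(1) le0, unfolded add_0_right] and aw = addr_less[OF i2(1), of "wt i"]
  have R: "R' 0 = n" "R' 1 = m" "R' 2 = c" "R' 9 = z" "R' 12 = z - n" "R' 13 = Suc c"
    using I(1) by (simp_all add: dp_header_def header_def)
  have b: "i + 3 \<le> W" "1 \<le> W" "3 \<le> W" using I(3) by (auto intro!: small_W)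
  note tl = tables_leaf[OF _ I(3) refl, of "M' 16" "M' 17"]
  show "wp fill_leaf
    (\<lambda>\<tau> k2. (dp_header ((fst \<tau>)(3 := Suc i)) \<and> tables (Suc i) (snd \<tau> 16) (snd \<tau> 17) \<and> (\<forall>a. a \<notin> {16, 17} \<longrightarrow> snd \<tau> a = M0 a)) \<and>
      fst \<tau> 3 = i \<and> fst \<tau> 0 = n \<and> k2 \<le> k' + 60) (R', M') k'"
  proof (rule vc_wp, cases "wt i \<le> c")
    case True
    show "vc fill_leaf
    (\<lambda>\<tau> k2. (dp_header ((fst \<tau>)(3 := Suc i)) \<and> tables (Suc i) (snd \<tau> 16) (snd \<tau> 17) \<and> (\<forall>a. a \<notin> {16, 17} \<longrightarrow> snd \<tau> a = M0 a)) \<and>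
      fst \<tau> 3 = i \<and> fst \<tau> 0 = n \<and> k2 \<le> k' + 60) (R', M') k'"
      using I(1) tl True aw(1-3)[OF True]
      by (simp add: fill_leaf_def cell_addr_def dp_header_def header_def R I(2) sz in_len b i2 a0 del: mult_Suc_right)
  next
    case False
    show "vc fill_leaf
    (\<lambda>\<tau> k2. (dp_header ((fst \<tau>)(3 := Suc i)) \<and> tables (Suc i) (snd \<tau> 16) (snd \<tau> 17) \<and> (\<forall>a. a \<notin> {16, 17} \<longrightarrow> snd \<tau> a = M0 a)) \<and>
      fst \<tau> 3 = i \<and> fst \<tau> 0 = n \<and> k2 \<le> k' + 60) (R', M') k'"
      using I(1) tl False
      by (simp add: fill_leaf_def cell_addr_def dp_header_def header_def R I(2) sz in_len b i2 a0 del: mult_Suc_right)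
  qed
qed (use assms in \<open>auto simp: dp_header_def header_def intro: small_W\<close>)

lemma wp_join_pair:
  assumes R: "R1 2 = c" "R1 4 = y" "R1 5 = L y" "R1 6 = R y" "R1 7 = i" "R1 8 = j" "R1 13 = Suc c"
    and M: "M1 13 = K" "M1 17 (R y) = weight (leaves (tr (R y)))"
    and y: "n \<le> y" "y < z" and ij: "i \<le> c" "j \<le> c"
    and p: "partial_row y D T0 (M1 16)"
    and Q: "\<And>T k'. partial_row y (insert (i, j) D) T0 T \<Longrightarrow> k' \<le> k + 60 \<Longrightarrow> Q (R1, M1(16 := T)) k'"
  shows "wp join_pair Q (R1, M1) k"
proof -
  note nt = Node_tr[OF y]
  have y2: "y < 2 * n" "L y < 2 * n" "R y < 2 * n" using nt(2,3) y z_bounds by simp_all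
  have yS: "y < S" "R y < S" using y2 by (auto intro: S_ge)
  note al = addr_less[OF y2(2) ij(1)] and ar = addr_less[OF y2(3) ij(2)]
  have cl: "cell (M1 16) (L y) i = cell T0 (L y) i" "cell (M1 16) (R y) j = cell T0 (R y) j"
    using cell_eqI[of y "M1 16" T0 _ i] cell_eqI[of y "M1 16" T0 _ j] p nt(2,3) ij unfolding partial_row_def by metis+
  have b: "i + j \<le> W" "i + 1 \<le> W" "1 \<le> W" "0 \<le> W"
  proof -
    have "i + j \<le> 2 * wbase + 100" using ij header_le by linarith
    then show "i + j \<le> W" by simp
  qed (use ij in \<open>auto intro!: small_W\<close>)
  have bs: "bsafe (R1, M1) join_test"
    unfolding join_test_def cell_addr_def using al ar b yS by (simp add: R M del: mult_Suc_right)
  have bv: "bv (encode I) (R1, M1) join_test \<longleftrightarrow> joins T0 y i j"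
    unfolding join_test_def cell_addr_def joins_def cl[symmetric]
    by (auto simp: R M cell_def simp del: mult_Suc_right)
  have cost: "bcost join_test \<le> 45" by (simp add: join_test_def cell_addr_def)
  show ?thesis
  proof (cases "joins T0 y i j")
    case True
    then have "i + j \<le> c" by (simp add: joins_def)
    note ay = addr_less[OF y2(1) this]
    show ?thesis unfolding join_pair_def
      by (rule vc_wp, simp add: bs bv True, simp add: cell_addr_def R ay[simplified] b[simplified])
        (use ay b cost in \<open>auto intro!: Q[OF partial_row_step[OF p True, simplified]]\<close>)
  next
    case False
    have "Q (R1, M1) k'" if "k' \<le> k + 60" for k'
      using Q[OF partial_row_skip[OF p False] that] by simp
    then show ?thesis unfolding join_pair_def
      using cost by (intro vc_wp) (simp add: bs bv False)
  qed
qed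

lemma wp_node_tables:
  assumes h: "dp_header R0" and t: "tables n (M0 16) (M0 17)" and M: "M0 13 = K" "M0 14 = L" "M0 15 = R"
    and Q: "\<And>R' M' k'. dp_header R' \<Longrightarrow> tables z (M' 16) (M' 17) \<Longrightarrow>
      \<forall>a. a \<notin> {16, 17} \<longrightarrow> M' a = M0 a \<Longrightarrow> k' \<le> k + (n * (Suc c * (Suc c * 69 + 16) + 56) + 7) \<Longrightarrow> Q (R', M') k'"
  shows "wp node_tables Q (R0, M0) k"
  unfolding node_tables_def
proof (rule wp_For[where T = "Suc c * (Suc c * 69 + 16) + 47" and N = "z - n" and
    I = "\<lambda>i R' M'. dp_header R' \<and> tables (n + i) (M' 16) (M' 17) \<and> (\<forall>a. a \<notin> {16, 17} \<longrightarrow> M' a = M0 a)"])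
  show "dp_header (R0(3 := 0)) \<and> tables (n + 0) (M0 16) (M0 17) \<and> (\<forall>a. a \<notin> {16, 17} \<longrightarrow> M0 a = M0 a)"
    using h t by (simp add: dp_header_def header_def)
  fix e R' M' k'
  assume I: "dp_header R' \<and> tables (n + e) (M' 16) (M' 17) \<and> (\<forall>a. a \<notin> {16, 17} \<longrightarrow> M' a = M0 a)" "R' 3 = e" "e < z - n"
  define y where "y = n + e"
  have y: "n \<le> y" "y < z" using I(3) by (auto simp: y_def)
  note nt = Node_tr[OF y]
  have y2: "y < S" "L y < S" "R y < S" using nt(2,3) y z_bounds by (auto intro!: S_ge)
  have R': "R' 0 = n" "R' 1 = m" "R' 2 = c" "R' 9 = z" "R' 12 = z - n" "R' 13 = Suc c" "R' 3 = e"
    using I(1,2) by (simp_all add: dp_header_def header_def)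
  have M': "M' 13 = K" "M' 14 = L" "M' 15 = R" using I(1) M by simp_all
  have ty: "tables y (M' 16) (M' 17)" using I(1) by (simp add: y_def)
  have tot: "M' 17 (L y) = weight (leaves (tr (L y)))" "M' 17 (R y) = weight (leaves (tr (R y)))"
    using ty nt(2,3) by (simp_all add: tables_def)
  \<comment> \<open>The sum is the total size of a set of items, namely the leaves of
    \<open>y\<close>, and therefore fits into a word.\<close>
  have tot_sum: "M' 17 (L y) + M' 17 (R y) \<le> W"
  proof -
    have "weight (leaves (tr y)) = M' 17 (L y) + M' 17 (R y)"
      unfolding tot by (subst nt(1)) (simp add: weight_Un nt(5))
    then show ?thesis using weight_le_W[OF leaves_less[OF y(2)]] by simp
  qed
  let ?R = "R'(4 := y, 5 := L y, 6 := R y)"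
  let ?M = "M'(17 := (M' 17)(y := M' 17 (L y) + M' 17 (R y)))"
  define post where "post \<tau> k2 \<longleftrightarrow> (dp_header ((fst \<tau>)(3 := Suc e)) \<and> tables (n + Suc e) (snd \<tau> 16) (snd \<tau> 17) \<and>
      (\<forall>a. a \<notin> {16, 17} \<longrightarrow> snd \<tau> a = M0 a)) \<and>
      fst \<tau> 3 = e \<and> fst \<tau> 12 = z - n \<and> k2 \<le> k' + (Suc c * (Suc c * 69 + 16) + 47)" for \<tau> :: state and k2
  define frame where "frame R1 M1 \<longleftrightarrow> (\<forall>q. q \<notin> {7, 8} \<longrightarrow> R1 q = ?R q) \<and> (\<forall>a. a \<noteq> 16 \<longrightarrow> M1 a = ?M a)"
    for R1 :: "nat \<Rightarrow> nat" and M1 :: "nat \<Rightarrow> nat \<Rightarrow> nat"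
  \<comment> \<open>The pairs tried so far grow lexicographically: all \<open>j\<close> for smaller
    \<open>i\<close>, and an initial segment for the current \<open>i\<close>.\<close>
  have loops: "wp (For 7 13 (For 8 13 join_pair)) post (?R, ?M) k1" if k1: "k1 \<le> k' + 30" for k1
  proof (rule wp_For[where T = "Suc c * 69 + 7" and N = "Suc c" and
      I = "\<lambda>i R1 M1. frame R1 M1 \<and> partial_row y ({..<i} \<times> {..c}) (M' 16) (M1 16)"])
    show "frame (?R(7 := 0)) ?M \<and> partial_row y ({..<0} \<times> {..c}) (M' 16) (?M 16)"
      using partial_row_init[OF ty] by (simp add: frame_def)
    show "?R 13 = Suc c" using R' by simp
    show "1 \<le> W" by (rule small_W) simp
    show "post (R1, M1) k2" if 1: "frame R1 M1 \<and> partial_row y ({..<Suc c} \<times> {..c}) (M' 16) (M1 16)"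
      "R1 7 = Suc c" "R1 13 = Suc c" "k2 \<le> k1 + (Suc c * (Suc c * 69 + 7 + 9) + 7)" for R1 M1 k2
    proof -
      have "tables (Suc y) (M1 16) (?M 17)"
        using partial_row_final[OF ty y, of "M1 16"] 1(1) by (simp add: lessThan_Suc_atMost)
      moreover have "M1 17 = ?M 17" "\<forall>a. a \<notin> {16, 17} \<longrightarrow> M1 a = M0 a" using 1(1) I(1) by (auto simp: frame_def)
      moreover have "dp_header (R1(3 := Suc e))" "R1 3 = e" "R1 12 = z - n"
        using 1(1) R' unfolding frame_def dp_header_def header_def by simp_all
      ultimately show ?thesis using 1(4) k1 by (simp add: post_def y_def)
    qed
    fix i R1 M1 k2
    assume 1: "frame R1 M1 \<and> partial_row y ({..<i} \<times> {..c}) (M' 16) (M1 16)" "R1 7 = i" "i < Suc c" "R1 13 = Suc c"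
    show "wp (For 8 13 join_pair) (\<lambda>\<tau> k3. (frame ((fst \<tau>)(7 := Suc i)) (snd \<tau>) \<and>
        partial_row y ({..<Suc i} \<times> {..c}) (M' 16) (snd \<tau> 16)) \<and>
        fst \<tau> 7 = i \<and> fst \<tau> 13 = Suc c \<and> k3 \<le> k2 + (Suc c * 69 + 7)) (R1, M1) k2"
    proof (rule wp_For[where T = 60 and N = "Suc c" and
        I = "\<lambda>j R2 M2. frame R2 M2 \<and> R2 7 = i \<and> partial_row y ({..<i} \<times> {..c} \<union> {i} \<times> {..<j}) (M' 16) (M2 16)"])
      show "frame (R1(8 := 0)) M1 \<and> (R1(8 := 0)) 7 = i \<and> partial_row y ({..<i} \<times> {..c} \<union> {i} \<times> {..<0}) (M' 16) (M1 16)"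
        using 1 by (simp add: frame_def)
      show "1 \<le> W" by (rule small_W) simp
      fix j R2 M2 k3
      assume 2: "frame R2 M2 \<and> R2 7 = i \<and> partial_row y ({..<i} \<times> {..c} \<union> {i} \<times> {..<j}) (M' 16) (M2 16)"
        "R2 8 = j" "j < Suc c" "R2 13 = Suc c"
      show "wp join_pair (\<lambda>\<tau> k4. (frame ((fst \<tau>)(8 := Suc j)) (snd \<tau>) \<and> ((fst \<tau>)(8 := Suc j)) 7 = i \<and>
          partial_row y ({..<i} \<times> {..c} \<union> {i} \<times> {..<Suc j}) (M' 16) (snd \<tau> 16)) \<and>
          fst \<tau> 8 = j \<and> fst \<tau> 13 = Suc c \<and> k4 \<le> k3 + 60) (R2, M2) k3"
      proof (rule wp_join_pair[of R2 y i j M2])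
        show "partial_row y ({..<i} \<times> {..c} \<union> {i} \<times> {..<j}) (M' 16) (M2 16)" using 2(1) by simp
        show "R2 2 = c" "R2 4 = y" "R2 5 = L y" "R2 6 = R y" "R2 7 = i" "R2 8 = j" "R2 13 = Suc c"
          using 2 R' unfolding frame_def by simp_all
        show "M2 13 = K" "M2 17 (R y) = weight (leaves (tr (R y)))"
          using 2(1) M' tot(2) nt(3) unfolding frame_def by simp_all
        fix T k4
        assume 3: "partial_row y (insert (i, j) ({..<i} \<times> {..c} \<union> {i} \<times> {..<j})) (M' 16) T" "k4 \<le> k3 + 60"
        have "insert (i, j) ({..<i} \<times> {..c} \<union> {i} \<times> {..<j}) = {..<i} \<times> {..c} \<union> {i} \<times> {..<Suc j}" by auto
        then show "(frame ((fst (R2, M2(16 := T)))(8 := Suc j)) (snd (R2, M2(16 := T))) \<and> ((fst (R2, M2(16 := T)))(8 := Suc j)) 7 = i \<and>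
          partial_row y ({..<i} \<times> {..c} \<union> {i} \<times> {..<Suc j}) (M' 16) (snd (R2, M2(16 := T)) 16)) \<and>
          fst (R2, M2(16 := T)) 8 = j \<and> fst (R2, M2(16 := T)) 13 = Suc c \<and> k4 \<le> k3 + 60"
          using 3 2 by (simp add: frame_def)
      qed (use y 1(3) 2(3) in simp_all)
    next
      fix R2 M2 k3
      assume 2: "frame R2 M2 \<and> R2 7 = i \<and> partial_row y ({..<i} \<times> {..c} \<union> {i} \<times> {..<Suc c}) (M' 16) (M2 16)"
        "R2 8 = Suc c" "R2 13 = Suc c" "k3 \<le> k2 + (Suc c * (60 + 9) + 7)"
      have "{..<i} \<times> {..c} \<union> {i} \<times> {..<Suc c} = {..<Suc i} \<times> {..c}" by auto
      then show "(frame ((fst (R2, M2))(7 := Suc i)) (snd (R2, M2)) \<and>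
        partial_row y ({..<Suc i} \<times> {..c}) (M' 16) (snd (R2, M2) 16)) \<and>
        fst (R2, M2) 7 = i \<and> fst (R2, M2) 13 = Suc c \<and> k3 \<le> k2 + (Suc c * 69 + 7)"
        using 2 by (simp add: frame_def)
    qed (use 1 in simp_all)
  qed simp_all
  have b: "n + e \<le> W" using y z_bounds by (intro small_W) (simp add: y_def)
  show "wp fill_node
   (\<lambda>\<tau> k2. (dp_header ((fst \<tau>)(3 := Suc e)) \<and> tables (n + Suc e) (snd \<tau> 16) (snd \<tau> 17) \<and>
      (\<forall>a. a \<notin> {16, 17} \<longrightarrow> snd \<tau> a = M0 a)) \<and>
      fst \<tau> 3 = e \<and> fst \<tau> 12 = z - n \<and> k2 \<le> k' + (Suc c * (Suc c * 69 + 16) + 47)) (R', M') k'"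
    unfolding post_def[symmetric] fill_node_def
    by (rule wp_Seq_vc) (simp add: R' M' b[folded y_def] y2 tot_sum loops y_def[symmetric])
next
  fix R' M' k'
  assume 1: "dp_header R' \<and> tables (n + (z - n)) (M' 16) (M' 17) \<and> (\<forall>a. a \<notin> {16, 17} \<longrightarrow> M' a = M0 a)"
    "k' \<le> k + ((z - n) * (Suc c * (Suc c * 69 + 16) + 47 + 9) + 7)"
  \<comment> \<open>The bound \<open>z \<le> 2 * n\<close> leaves at most \<open>n\<close> composite
    components.\<close>
  have "(z - n) * (Suc c * (Suc c * 69 + 16) + 47 + 9) \<le> n * (Suc c * (Suc c * 69 + 16) + 56)"
    using z_bounds by (intro mult_le_mono) auto
  with 1(2) have "k' \<le> k + (n * (Suc c * (Suc c * 69 + 16) + 56) + 7)" by linarith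
  then show "Q (R', M') k'" using 1(1) z_bounds by (intro Q) auto
qed (use assms in \<open>auto simp: dp_header_def intro: small_W\<close>)

end

section \<open>Reading off an optimal solution\<close>

text \<open>The one remaining edge enters the sink \<open>n\<close>, so its component stands in cell
  \<open>n\<close> of array 12. Sizes are scanned upwards, so the last attainable one found is the
  largest.\<close>

definition choose_best :: com where
  "choose_best = Seq (Seq (Assign 10 (Cell 12 (Reg 0))) (Assign 11 (Const 0)))
    (Seq (For 7 13 (If (Less (Const 0) (Cell 16 (cell_addr (Reg 10) (Reg 7)))) (Assign 11 (Reg 7)) Skip))
         (Store 0 (Reg 10) (Reg 11)))"

text \<open>Children have smaller numbers than their parent, so running downwards through the
  components splits a parent before its children.\<close>

definition push_node :: com where
  "push_node = Seq (Assign 4 (Sub (Sub (Reg 9) (Const 1)) (Reg 3)))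
    (Seq (Assign 5 (Cell 0 (Reg 4)))
    (Seq (Assign 6 (Sub (Cell 16 (cell_addr (Reg 4) (Reg 5))) (Const 1)))
    (Seq (Store 0 (Cell 14 (Reg 4)) (Reg 6))
         (Store 0 (Cell 15 (Reg 4)) (Sub (Reg 5) (Reg 6))))))"

definition push_down :: com where
  "push_down = For 3 12
    push_node"

definition mark_items :: com where
  "mark_items = For 3 0 (If (Less (Const 0) (Cell 0 (Reg 3))) (Store 0 (Reg 3) (Const 1)) Skip)"

lemma empty_mem_fam: "{} \<in> fam T"
  by (induction T) auto

context decomposition
begin

lemma root_less: "r < z" and root_not_child: "n \<le> y \<Longrightarrow> y < z \<Longrightarrow> r \<noteq> L y \<and> r \<noteq> R y"
  using root by (simp_all add: tree_root_def)

text \<open>Components not reached yet carry the size 0, which is attainable everywhere through the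
  empty part; so the first condition can hold for all components throughout.\<close>

definition chosen where
  "chosen Y b T wa \<longleftrightarrow> (\<forall>y<z. wa y \<le> c \<and> cell T y (wa y) \<noteq> 0) \<and> wa r = b \<and>
    (\<forall>y. Y \<le> y \<longrightarrow> n \<le> y \<longrightarrow> y < z \<longrightarrow> wa (L y) + wa (R y) = wa y \<and> joins T y (wa (L y)) (wa (R y)))"

lemma tables_row: "tables z T tot \<Longrightarrow> y < z \<Longrightarrow> row T y"
  by (simp add: tables_def)

lemma cell_zero: "tables z T tot \<Longrightarrow> y < z \<Longrightarrow> cell T y 0 \<noteq> 0"
  using row_correct[of T y 0] tables_row[of T tot] empty_mem_fam[of "tr y"] by (force simp: total_size_def)

lemma chosen_init:
  assumes "tables z T tot" "b \<le> c" "cell T r b \<noteq> 0"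
  shows "chosen z b T ((\<lambda>_. 0)(r := b))"
  using assms cell_zero by (auto simp: chosen_def)

lemma chosen_split:
  assumes t: "tables z T tot" and ch: "chosen (Suc y) b T wa" and y: "n \<le> y" "y < z"
  shows "cell T y (wa y) - 1 \<le> wa y" "joins T y (cell T y (wa y) - 1) (wa y - (cell T y (wa y) - 1))" "wa y \<le> c"
  using tables_row[OF t y(2)] ch y by (auto simp: row_def chosen_def)

text \<open>A component is a child of at most one other, so the new entries do not disturb the
  splits already made; nor do they hit the root, which is a child of none.\<close>

lemma chosen_step:
  assumes t: "tables z T tot" and ch: "chosen (Suc y) b T wa" and y: "n \<le> y" "y < z"
    and i: "i = cell T y (wa y) - 1"
  shows "chosen y b T (wa(L y := i, R y := wa y - i))"
proof -
  note nt = Node_tr[OF y]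
  note s = chosen_split[OF t ch y, folded i]
  let ?wa = "wa(L y := i, R y := wa y - i)"
  have "?wa y' \<le> c \<and> cell T y' (?wa y') \<noteq> 0" if "y' < z" for y'
    using that s ch nt(4) by (auto simp: joins_def chosen_def)
  moreover have "?wa r = b" using root_not_child[OF y] ch by (auto simp: chosen_def)
  moreover have "?wa (L y') + ?wa (R y') = ?wa y' \<and> joins T y' (?wa (L y')) (?wa (R y'))"
    if y': "y \<le> y'" "n \<le> y'" "y' < z" for y'
  proof (cases "y' = y")
    case True
    then show ?thesis using s nt(2-4) by auto
  next
    case False
    then have "y < y'" using y' by simp
    then have "L y' \<noteq> L y" "L y' \<noteq> R y" "R y' \<noteq> L y" "R y' \<noteq> R y" "y' \<noteq> L y" "y' \<noteq> R y"
      using children_disjoint[of y y'] y y' nt(2,3) by auto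
    then show ?thesis using ch y' \<open>y < y'\<close> by (simp add: chosen_def)
  qed
  ultimately show ?thesis unfolding chosen_def by blast
qed

text \<open>At an item the only attainable sizes are 0 and its own, so a non-zero entry means that
  the item is taken. Further up, the sizes in \<open>joins\<close> translate back into empty and
  complete parts because sizes are positive.\<close>

lemma chosen_final:
  assumes t: "tables z T tot" and ch: "chosen n b T wa" and X: "X = {j. j < n \<and> wa j \<noteq> 0}"
  shows "y < z \<Longrightarrow> X \<inter> leaves (tr y) \<in> fam (tr y) \<and> weight (X \<inter> leaves (tr y)) = wa y"
proof (induction y rule: less_induct)
  case (less y)
  show ?case
  proof (cases "y < n")
    case True
    have "wa y \<le> c" "cell T y (wa y) \<noteq> 0" using ch less.prems by (simp_all add: chosen_def)
    then have "wa y = 0 \<or> wa y = wt y" using tables_row[OF t less.prems] True by (simp add: row_def)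
    moreover have "X \<inter> {y} = (if wa y \<noteq> 0 then {y} else {})" using True X by auto
    ultimately show ?thesis using True by (auto simp: Leaf_tr total_size_def)
  next
    case False
    then have y: "n \<le> y" "y < z" using less.prems by auto
    note nt = Node_tr[OF y]
    have lz: "L y < z" "R y < z" using nt(2,3) y by simp_all
    note IL = less.IH[OF nt(2) lz(1)] and IR = less.IH[OF nt(3) lz(2)]
    have j: "wa (L y) + wa (R y) = wa y" "joins T y (wa (L y)) (wa (R y))"
      using ch y unfolding chosen_def by blast+
    let ?A = "X \<inter> leaves (tr (L y))" and ?B = "X \<inter> leaves (tr (R y))"
    have ly: "leaves (tr y) = leaves (tr (L y)) \<union> leaves (tr (R y))" by (subst nt(1)) simp
    have "K y \<noteq> 0 \<longrightarrow> ?A = {} \<or> leaves (tr (R y)) \<subseteq> X"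
    proof
      assume "K y \<noteq> 0"
      then have "wa (L y) = 0 \<or> wa (R y) = weight (leaves (tr (R y)))" using j(2) by (simp add: joins_def)
      then show "?A = {} \<or> leaves (tr (R y)) \<subseteq> X"
      proof
        assume "wa (L y) = 0"
        then show ?thesis using IL X weight_zero[of ?A] by auto
      next
        assume "wa (R y) = weight (leaves (tr (R y)))"
        then have "?B = leaves (tr (R y))" using IR leaves_less[OF lz(2)] by (intro weight_full) auto
        then show ?thesis by blast
      qed
    qed
    then have "X \<inter> leaves (tr y) \<in> fam (tr y)"
      using mem_fam_Node_iff[OF nt(5), of X "K y \<noteq> 0", folded nt(1)] IL IR by blast
    moreover have "weight (X \<inter> leaves (tr y)) = weight ?A + weight ?B"
      unfolding ly Int_Un_distrib by (rule weight_Un) (use nt(5) in auto)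
    ultimately show ?thesis using IL IR j(1) by simp
  qed
qed

lemma chosen_optimal:
  assumes t: "tables z T tot" and ch: "chosen n b T wa"
    and best: "\<And>w. w \<le> c \<Longrightarrow> cell T r w \<noteq> 0 \<Longrightarrow> w \<le> b"
    and X: "X = {j. j < n \<and> wa j \<noteq> 0}"
  shows "X \<in> fam (tr r)" "weight X \<le> c" "\<And>Y. Y \<in> fam (tr r) \<Longrightarrow> weight Y \<le> c \<Longrightarrow> weight Y \<le> weight X"
proof -
  have "X \<inter> leaves (tr r) = X" using leaves_root X by auto
  then have "X \<in> fam (tr r) \<and> weight X = wa r" using chosen_final[OF t ch X root_less] by simp
  moreover have "wa r = b" "wa r \<le> c" using ch root_less unfolding chosen_def by blast+
  ultimately have f: "X \<in> fam (tr r)" "weight X = b" "b \<le> c" by simp_all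
  then show "X \<in> fam (tr r)" "weight X \<le> c" by simp_all
  show "weight Y \<le> weight X" if "Y \<in> fam (tr r)" "weight Y \<le> c" for Y
  proof -
    have "cell T r (weight Y) \<noteq> 0"
      using row_correct[of T r "weight Y"] tables_row[OF t] root_less that by blast
    then show ?thesis using best that f by simp
  qed
qed

lemma wp_choose_best:
  assumes h: "dp_header R0" and t: "tables z (M0 16) (M0 17)" and M: "M0 12 n = r" "M0 0 = (\<lambda>_. 0)"
    and Q: "\<And>R' M' k' b. dp_header R' \<Longrightarrow> chosen z b (M0 16) (M' 0) \<Longrightarrow>
      (\<And>w. w \<le> c \<Longrightarrow> cell (M0 16) r w \<noteq> 0 \<Longrightarrow> w \<le> b) \<Longrightarrow>
      \<forall>a. a \<noteq> 0 \<longrightarrow> M' a = M0 a \<Longrightarrow> k' \<le> k + (Suc c * 39 + 30) \<Longrightarrow> Q (R', M') k'"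
  shows "wp choose_best Q (R0, M0) k"
proof -
  have r2: "r < 2 * n" "r < S" "n < S" using root_less z_bounds n_pos by (auto intro!: S_ge)
  have c0: "cell (M0 16) r 0 \<noteq> 0" using cell_zero[OF t root_less] .
  have R0: "R0 0 = n" "R0 2 = c" "R0 9 = z" "R0 13 = Suc c" using h by (simp_all add: dp_header_def header_def)
  have W: "1 \<le> W" "0 \<le> W" by (auto intro: small_W)
  let ?R = "R0(10 := r, 11 := 0)"
  let ?best = "\<lambda>i R1. R1 11 \<le> c \<and> cell (M0 16) r (R1 11) \<noteq> 0 \<and> (\<forall>w<i. w \<le> c \<longrightarrow> cell (M0 16) r w \<noteq> 0 \<longrightarrow> w \<le> R1 11)"
  have "wp (Seq (For 7 13 (If (Less (Const 0) (Cell 16 (cell_addr (Reg 10) (Reg 7)))) (Assign 11 (Reg 7)) Skip))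
         (Store 0 (Reg 10) (Reg 11))) Q (?R, M0) k1" if k1: "k1 \<le> k + 15" for k1
  proof (rule wp_Seq, rule wp_For[where T = 30 and N = "Suc c" and
      I = "\<lambda>i R1 M1. M1 = M0 \<and> R1 10 = r \<and> (\<forall>q. q \<notin> {7, 11} \<longrightarrow> R1 q = ?R q) \<and> ?best i R1"])
    fix i R1 M1 k2
    assume 1: "M1 = M0 \<and> R1 10 = r \<and> (\<forall>q. q \<notin> {7, 11} \<longrightarrow> R1 q = ?R q) \<and> ?best i R1" "R1 7 = i" "i < Suc c" "R1 13 = Suc c"
    have ic: "i \<le> c" using 1(3) by simp
    note a = addr_less[OF r2(1) ic]
    have cl: "M0 16 (r * Suc c + i) = cell (M0 16) r i" by (simp add: cell_def)
    show "wp (If (Less (Const 0) (Cell 16 (cell_addr (Reg 10) (Reg 7)))) (Assign 11 (Reg 7)) Skip)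
      (\<lambda>\<tau> k3. (snd \<tau> = M0 \<and> ((fst \<tau>)(7 := Suc i)) 10 = r \<and> (\<forall>q. q \<notin> {7, 11} \<longrightarrow> ((fst \<tau>)(7 := Suc i)) q = ?R q) \<and>
        ?best (Suc i) ((fst \<tau>)(7 := Suc i))) \<and> fst \<tau> 7 = i \<and> fst \<tau> 13 = Suc c \<and> k3 \<le> k2 + 30) (R1, M1) k2"
    proof (cases "cell (M0 16) r i = 0")
      case True
      then have "w \<le> R1 11" if "w < Suc i" "w \<le> c" "cell (M0 16) r w \<noteq> 0" for w
        using 1(1) that by (cases "w = i") auto
      then show ?thesis unfolding cell_addr_def using True 1 a cl W
        by (intro vc_wp) (simp del: mult_Suc_right)
    next
      case False
      then show ?thesis unfolding cell_addr_def using 1 a cl ic W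
        by (intro vc_wp) (simp del: mult_Suc_right add: less_Suc_eq_le)
    qed
  next
    fix R1 M1 k2
    assume 1: "M1 = M0 \<and> R1 10 = r \<and> (\<forall>q. q \<notin> {7, 11} \<longrightarrow> R1 q = ?R q) \<and> ?best (Suc c) R1" "R1 7 = Suc c" "R1 13 = Suc c"
      "k2 \<le> k1 + (Suc c * (30 + 9) + 7)"
    have R1: "M1 = M0" "R1 10 = r" "\<And>q. q \<notin> {7, 11} \<Longrightarrow> R1 q = ?R q" "R1 11 \<le> c" "cell (M0 16) r (R1 11) \<noteq> 0"
      "\<And>w. w \<le> c \<Longrightarrow> cell (M0 16) r w \<noteq> 0 \<Longrightarrow> w \<le> R1 11" using 1(1) by auto
    have "Q (R1, M0(0 := (M0 0)(r := R1 11))) k3" if "k3 \<le> k2 + 6" for k3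
    proof (rule Q)
      show "dp_header R1" using R1(3) h by (simp add: dp_header_def header_def)
      show "chosen z (R1 11) (M0 16) ((M0(0 := (M0 0)(r := R1 11))) 0)"
        using chosen_init[OF t R1(4,5)] by (simp add: M(2))
      show "k3 \<le> k + (Suc c * 39 + 30)" using that 1(4) k1 by simp
    qed (use R1(6) in auto)
    then show "wp (Store 0 (Reg 10) (Reg 11)) Q (R1, M1) (k2 + 1)"
      using r2(2) by (intro vc_wp) (simp add: R1(1,2))
  qed (use c0 R0 W in simp_all)
  then show ?thesis unfolding choose_best_def by (intro wp_Seq_vc) (simp add: R0 M r2 W)
qed

lemma wp_push_down:
  assumes h: "dp_header R0" and t: "tables z (M0 16) (M0 17)" and M: "M0 14 = L" "M0 15 = R"
    and ch: "chosen z b (M0 16) (M0 0)"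
    and Q: "\<And>R' M' k'. dp_header R' \<Longrightarrow> chosen n b (M0 16) (M' 0) \<Longrightarrow>
      k' \<le> k + (n * 59 + 7) \<Longrightarrow> Q (R', M') k'"
  shows "wp push_down Q (R0, M0) k"
  unfolding push_down_def
proof (rule wp_For[where T = 50 and N = "z - n" and
    I = "\<lambda>e R1 M1. dp_header R1 \<and> chosen (z - e) b (M0 16) (M1 0) \<and> (\<forall>a. a \<noteq> 0 \<longrightarrow> M1 a = M0 a)"])
  fix e R1 M1 k1
  assume 1: "dp_header R1 \<and> chosen (z - e) b (M0 16) (M1 0) \<and> (\<forall>a. a \<noteq> 0 \<longrightarrow> M1 a = M0 a)" "R1 3 = e" "e < z - n"
  define y where "y = z - 1 - e"
  have y: "n \<le> y" "y < z" "Suc y = z - e" "z - Suc e = y" using 1(3) by (auto simp: y_def)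
  have ch1: "chosen (Suc y) b (M0 16) (M1 0)" using 1(1) y(3) by simp
  note s = chosen_split[OF t ch1 y(1,2)]
  note st = chosen_step[OF t ch1 y(1,2) refl]
  note nt = Node_tr[OF y(1,2)]
  have y2: "y < 2 * n" "y < S" "L y < S" "R y < S" using nt(2,3) y z_bounds by (auto intro!: S_ge)
  note a = addr_less[OF y2(1) s(3)]
  have cl: "M0 16 (y * Suc c + M1 0 y) = cell (M0 16) y (M1 0 y)" by (simp add: cell_def)
  have R1: "R1 0 = n" "R1 1 = m" "R1 2 = c" "R1 3 = e" "R1 9 = z" "R1 12 = z - n" "R1 13 = Suc c"
    using 1 by (simp_all add: dp_header_def header_def)
  have M1: "M1 14 = L" "M1 15 = R" "M1 16 = M0 16" using 1(1) M by simp_all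
  have W: "1 \<le> W" by (auto intro: small_W)
  show "wp push_node
    (\<lambda>\<tau> k2. (dp_header ((fst \<tau>)(3 := Suc e)) \<and> chosen (z - Suc e) b (M0 16) (snd \<tau> 0) \<and> (\<forall>a. a \<noteq> 0 \<longrightarrow> snd \<tau> a = M0 a)) \<and>
      fst \<tau> 3 = e \<and> fst \<tau> 12 = z - n \<and> k2 \<le> k1 + 50) (R1, M1) k1"
    unfolding y(4) push_node_def cell_addr_def
    by (rule vc_wp) (use 1(1) st a y2 W in
      \<open>simp add: R1 M1 cl y_def[symmetric, simplified] dp_header_def header_def del: mult_Suc_right\<close>)
next
  fix R1 M1 k1
  assume 1: "dp_header R1 \<and> chosen (z - (z - n)) b (M0 16) (M1 0) \<and> (\<forall>a. a \<noteq> 0 \<longrightarrow> M1 a = M0 a)"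
    "k1 \<le> k + ((z - n) * (50 + 9) + 7)"
  have "(z - n) * (50 + 9) \<le> n * 59" using z_bounds by simp
  then show "Q (R1, M1) k1" using 1 z_bounds by (intro Q) auto
qed (use assms in \<open>auto simp: dp_header_def header_def intro: small_W\<close>)

lemma wp_mark_items:
  assumes h: "dp_header R0"
    and Q: "\<And>R' M' k'. \<forall>j<n. M' 0 j = (if M0 0 j \<noteq> 0 then 1 else 0) \<Longrightarrow>
      k' \<le> k + (n * 29 + 7) \<Longrightarrow> Q (R', M') k'"
  shows "wp mark_items Q (R0, M0) k"
  unfolding mark_items_def
proof (rule wp_For[where T = 20 and N = n and
    I = "\<lambda>i R1 M1. (\<forall>j<n. M1 0 j = (if j < i then (if M0 0 j \<noteq> 0 then 1 else 0) else M0 0 j))"])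
  fix i k1 and R1 :: "nat \<Rightarrow> nat" and M1 :: "nat \<Rightarrow> nat \<Rightarrow> nat"
  assume "\<forall>j<n. M1 0 j = (if j < i then (if M0 0 j \<noteq> 0 then 1 else 0) else M0 0 j)" "R1 3 = i" "i < n" "R1 0 = n"
  moreover have "i < S" "1 \<le> W" using \<open>i < n\<close> by (auto intro: S_ge small_W)
  ultimately show "wp (If (Less (Const 0) (Cell 0 (Reg 3))) (Store 0 (Reg 3) (Const 1)) Skip)
    (\<lambda>\<tau> k2. (\<forall>j<n. snd \<tau> 0 j = (if j < Suc i then (if M0 0 j \<noteq> 0 then 1 else 0) else M0 0 j)) \<and>
      fst \<tau> 3 = i \<and> fst \<tau> 0 = n \<and> k2 \<le> k1 + 20) (R1, M1) k1"
    by (intro vc_wp) (auto simp: less_Suc_eq)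
qed (use assms in \<open>auto simp: dp_header_def header_def intro: small_W\<close>)

end

section \<open>The complete algorithm and its resource bounds\<close>

definition solve_tree :: com where
  "solve_tree = Seq (Seq (Assign 12 (Sub (Reg 9) (Reg 0))) (Assign 13 (Add (Reg 2) (Const 1))))
    (Seq leaf_tables (Seq node_tables (Seq choose_best (Seq push_down mark_items))))"

definition decompose :: com where
  "decompose = Seq (build_list 1 3 4 7) (Seq (build_list 2 5 6 9) (Seq topo_order reduce_graph))"

definition solver :: com where
  "solver = Seq build_graph (Seq decompose solve_tree)"

lemma (in decomposition) wp_solve_tree:
  assumes h: "header R0" "R0 9 = z"
    and M: "M0 13 = K" "M0 14 = L" "M0 15 = R" "M0 12 n = r" "M0 16 = (\<lambda>_. 0)" "M0 0 = (\<lambda>_. 0)"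
    and Q: "\<And>R' M' X k'. X \<in> fam (tr r) \<Longrightarrow> weight X \<le> c \<Longrightarrow>
      (\<And>Y. Y \<in> fam (tr r) \<Longrightarrow> weight Y \<le> c \<Longrightarrow> weight Y \<le> weight X) \<Longrightarrow>
      \<forall>j<n. M' 0 j = (if j \<in> X then 1 else 0) \<Longrightarrow>
      k' \<le> k + (n * (Suc c * (Suc c * 69 + 16) + 250) + Suc c * 39 + 100) \<Longrightarrow> Q (R', M') k'"
  shows "wp solve_tree Q (R0, M0) k"
proof -
  let ?R = "R0(12 := z - n, 13 := Suc c)"
  have h': "dp_header ?R" using h by (simp add: dp_header_def header_def)
  have "wp (Seq leaf_tables (Seq node_tables (Seq choose_best (Seq push_down mark_items)))) Q (?R, M0) k0"
    if k0: "k0 \<le> k + 15" for k0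
  proof (rule wp_Seq, rule wp_leaf_tables[where ?M0.0 = M0, OF h' M(5)])
    fix R1 k1 and M1 :: "nat \<Rightarrow> nat \<Rightarrow> nat"
    assume 1: "dp_header R1" "tables n (M1 16) (M1 17)" "\<forall>a. a \<notin> {16, 17} \<longrightarrow> M1 a = M0 a" "k1 \<le> k0 + (n * 69 + 7)"
    show "wp (Seq node_tables (Seq choose_best (Seq push_down mark_items))) Q (R1, M1) (k1 + 1)"
    proof (rule wp_Seq, rule wp_node_tables[OF 1(1,2)])
      show "M1 13 = K" "M1 14 = L" "M1 15 = R" using 1(3) M by simp_all
      fix R2 k2 and M2 :: "nat \<Rightarrow> nat \<Rightarrow> nat"
      assume 2: "dp_header R2" "tables z (M2 16) (M2 17)" "\<forall>a. a \<notin> {16, 17} \<longrightarrow> M2 a = M1 a"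
        "k2 \<le> k1 + 1 + (n * (Suc c * (Suc c * 69 + 16) + 56) + 7)"
      show "wp (Seq choose_best (Seq push_down mark_items)) Q (R2, M2) (k2 + 1)"
      proof (rule wp_Seq, rule wp_choose_best[OF 2(1,2)])
        show "M2 12 n = r" "M2 0 = (\<lambda>_. 0)" using 1(3) 2(3) M by simp_all
        fix R3 k3 b and M3 :: "nat \<Rightarrow> nat \<Rightarrow> nat"
        assume 3: "dp_header R3" "chosen z b (M2 16) (M3 0)"
          "\<And>w. w \<le> c \<Longrightarrow> cell (M2 16) r w \<noteq> 0 \<Longrightarrow> w \<le> b" "\<forall>a. a \<noteq> 0 \<longrightarrow> M3 a = M2 a"
          "k3 \<le> k2 + 1 + (Suc c * 39 + 30)"
        have M3: "M3 16 = M2 16" "M3 17 = M2 17" "M3 14 = L" "M3 15 = R" using 3(4) 2(3) 1(3) M by simp_all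
        show "wp (Seq push_down mark_items) Q (R3, M3) (k3 + 1)"
        proof (rule wp_Seq, rule wp_push_down[OF 3(1)])
          show "tables z (M3 16) (M3 17)" "chosen z b (M3 16) (M3 0)" "M3 14 = L" "M3 15 = R"
            using 2(2) 3(2) M3 by simp_all
          fix R4 k4 and M4 :: "nat \<Rightarrow> nat \<Rightarrow> nat"
          assume 4: "dp_header R4" "chosen n b (M3 16) (M4 0)" "k4 \<le> k3 + 1 + (n * 59 + 7)"
          define X where "X = {j. j < n \<and> M4 0 j \<noteq> 0}"
          note opt = chosen_optimal[OF 2(2) 4(2)[unfolded M3] 3(3) X_def]
          show "wp mark_items Q (R4, M4) (k4 + 1)"
          proof (rule wp_mark_items[OF 4(1)])
            fix R5 k5 and M5 :: "nat \<Rightarrow> nat \<Rightarrow> nat"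
            assume 5: "\<forall>j<n. M5 0 j = (if M4 0 j \<noteq> 0 then 1 else 0)" "k5 \<le> k4 + 1 + (n * 29 + 7)"
            show "Q (R5, M5) k5"
            proof (rule Q[OF opt])
              show "\<forall>j<n. M5 0 j = (if j \<in> X then 1 else 0)" using 5(1) by (auto simp: X_def)
              have "n * (Suc c * (Suc c * 69 + 16) + 250) = n * (Suc c * (Suc c * 69 + 16) + 56) + n * 194"
                by (simp add: algebra_simps)
              then show "k5 \<le> k + (n * (Suc c * (Suc c * 69 + 16) + 250) + Suc c * 39 + 100)"
                using k0 1(4) 2(4) 3(5) 4(3) 5(2) by linarith
            qed auto
          qed
        qed
      qed
    qed
  qed
  moreover have "c + 1 \<le> W" by (rule small_W) simp
  moreover have "1 \<le> W" by (rule small_W) simp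
  ultimately show ?thesis unfolding solve_tree_def
    using h by (intro wp_Seq_vc) (simp add: header_def)
qed

lemma (in multigraph) wp_decompose:
  assumes h: "header R0" and M: "M0 1 = hn" "M0 2 = tn" "\<forall>a \<ge> 3. M0 a = (\<lambda>_. 0)"
    and Q: "\<And>R' M' k'. header R' \<Longrightarrow>
      reduced closed n (Suc n) n {(Suc n, M' 12 n, n)} (M' 13) (M' 14) (M' 15) (R' 9) \<Longrightarrow>
      M' 0 = M0 0 \<Longrightarrow> M' 16 = (\<lambda>_. 0) \<Longrightarrow> k' \<le> k + (n * 470 + 350) \<Longrightarrow> Q (R', M') k'"
  shows "wp decompose Q (R0, M0) k"
  unfolding decompose_def
proof (rule wp_Seq, rule wp_build_list[where M = M0 and key = 1, OF _ h M(1)])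
  show "distinct [1, 3, 4, 7 :: nat]" "\<And>e. e < n \<Longrightarrow> hn e < S" "M0 3 = (\<lambda>_. 0)" "M0 7 = (\<lambda>_. 0)"
    using M by simp_all
  fix R1 k1 and M1 :: "nat \<Rightarrow> nat \<Rightarrow> nat"
  assume 1: "header R1" "\<forall>b. linked (M1 4) (M1 3 b) (bucket hn n b)" "M1 7 = (\<lambda>b. length (bucket hn n b))"
    "\<forall>a. a \<notin> {3, 4, 7} \<longrightarrow> M1 a = M0 a" "k1 \<le> k + (n * 39 + 7)"
  show "wp (Seq (build_list 2 5 6 9) (Seq topo_order reduce_graph)) Q (R1, M1) (k1 + 1)"
  proof (rule wp_Seq, rule wp_build_list[OF _ 1(1)])
    show "distinct [2, 5, 6, 9 :: nat]" "M1 2 = tn" "\<And>e. e < n \<Longrightarrow> tn e < S" "M1 5 = (\<lambda>_. 0)" "M1 9 = (\<lambda>_. 0)"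
      using 1(4) M by simp_all
    fix R2 k2 and M2 :: "nat \<Rightarrow> nat \<Rightarrow> nat"
    assume 2: "header R2" "\<forall>b. linked (M2 6) (M2 5 b) (bucket tn n b)" "M2 9 = (\<lambda>b. length (bucket tn n b))"
      "\<forall>a. a \<notin> {5, 6, 9} \<longrightarrow> M2 a = M1 a" "k2 \<le> k1 + 1 + (n * 39 + 7)"
    show "wp (Seq topo_order reduce_graph) Q (R2, M2) (k2 + 1)"
    proof (rule wp_Seq, rule wp_topo_order[OF 2(1)])
      show "M2 1 = hn" "M2 2 = tn" "\<And>b. linked (M2 6) (M2 5 b) (bucket tn n b)"
        "M2 7 = (\<lambda>b. length (bucket hn n b))" using 1 2 M by simp_all
      fix R3 k3 and M3 :: "nat \<Rightarrow> nat \<Rightarrow> nat"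
      assume 3: "header R3" "topological (map (M3 8) [0..<R3 5])" "\<forall>a. a \<noteq> 7 \<longrightarrow> a \<noteq> 8 \<longrightarrow> M3 a = M2 a"
        "k3 \<le> k2 + 1 + (n * 80 + 150)"
      show "wp reduce_graph Q (R3, M3) (k3 + 1)"
      proof (rule wp_reduce_graph[where M = M3, OF 3(1) _ _ _ _ 3(2)])
        show "M3 2 = tn" "\<And>b. linked (M3 4) (M3 3 b) (bucket hn n b)"
          "M3 9 = (\<lambda>b. length (bucket tn n b))" "M3 10 = (\<lambda>_. 0)" using 1 2 3 M by simp_all
        fix R4 k4 and M4 :: "nat \<Rightarrow> nat \<Rightarrow> nat"
        assume 4: "header R4" "reduced closed n (Suc n) n {(Suc n, M4 12 n, n)} (M4 13) (M4 14) (M4 15) (R4 9)"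
          "\<forall>a. a \<notin> {9..15} \<longrightarrow> M4 a = M3 a" "k4 \<le> k3 + 1 + (310 * n + 160)"
        have "M4 0 = M0 0" "M4 16 = (\<lambda>_. 0)" using 1(4) 2(4) 3(3) 4(3) M(3) by simp_all
        then show "Q (R4, M4) k4" using 1(5) 2(5) 3(4) 4 by (intro Q) simp_all
      qed
    qed
  qed
qed

context msp_instance
begin

lemma wp_solver:
  "wp solver (\<lambda>\<tau> t. \<exists>X. outputs I \<tau> X \<and> ssg_optimal I X \<and> t \<le> 2000 * (n * c\<^sup>2 + m)) init_state 0"
  unfolding solver_def init_state_def
proof (rule wp_Seq, rule wp_build_graph)
  fix R1 k1 and M1 :: "nat \<Rightarrow> nat \<Rightarrow> nat"
  assume 1: "header R1" "line_graph (M1 1) (M1 2)" "\<forall>a. a \<noteq> 1 \<longrightarrow> a \<noteq> 2 \<longrightarrow> M1 a = (\<lambda>_. 0)"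
    "k1 \<le> 0 + (30 * n + 118 * m + 50)"
  interpret multigraph I "M1 1" "M1 2" by unfold_locales (rule 1(2))
  let ?post = "\<lambda>\<tau> t. \<exists>X. outputs I \<tau> X \<and> ssg_optimal I X \<and> t \<le> 2000 * (n * c\<^sup>2 + m)"
  have feas: "ssg_feasible I X \<longleftrightarrow> X \<subseteq> {..<n} \<and> total_size I X \<le> c \<and> closed X" for X
  proof -
    have "(\<forall>y<n. in_nbrs (ssg_graph I) y \<inter> X \<noteq> {} \<longrightarrow> y \<in> X) \<longleftrightarrow> closed X"
      using arcs_less unfolding closed_def in_nbrs_def ssg_graph_def by fastforce
    then show ?thesis unfolding ssg_feasible_def by simp
  qed
  show "wp (Seq decompose solve_tree) ?post (R1, M1) (k1 + 1)"
  proof (rule wp_Seq, rule wp_decompose[OF 1(1) refl refl])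
    show "\<forall>a \<ge> 3. M1 a = (\<lambda>_. 0)" using 1(3) by simp
    fix R2 k2 and M2 :: "nat \<Rightarrow> nat \<Rightarrow> nat"
    assume 2: "header R2" "reduced closed n (Suc n) n {(Suc n, M2 12 n, n)} (M2 13) (M2 14) (M2 15) (R2 9)"
      "M2 0 = M1 0" "M2 16 = (\<lambda>_. 0)" "k2 \<le> k1 + 1 + (n * 470 + 350)"
    obtain tr where tr: "tree_arrays n (R2 9) (M2 13) (M2 14) (M2 15) tr" "tree_root n (R2 9) (M2 14) (M2 15) (M2 12 n)"
      "leaves (tr (M2 12 n)) = {..<n}" "\<And>X. X \<subseteq> {..<n} \<Longrightarrow> closed X \<longleftrightarrow> X \<in> fam (tr (M2 12 n))"
      using reduced_single[OF 2(2)] by metis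
    interpret d: decomposition I "R2 9" "M2 13" "M2 14" "M2 15" tr "M2 12 n"
      by unfold_locales (use tr reduced_facts(3,4)[OF 2(2)] in auto)
    show "wp solve_tree ?post (R2, M2) (k2 + 1)"
    proof (rule d.wp_solve_tree[OF 2(1)])
      show "M2 0 = (\<lambda>_. 0)" using 2(3) 1(3) by simp
      fix R3 X k3 and M3 :: "nat \<Rightarrow> nat \<Rightarrow> nat"
      assume 3: "X \<in> fam (tr (M2 12 n))" "total_size I X \<le> c"
        "\<And>Y. Y \<in> fam (tr (M2 12 n)) \<Longrightarrow> total_size I Y \<le> c \<Longrightarrow> total_size I Y \<le> total_size I X"
        "\<forall>j<n. M3 0 j = (if j \<in> X then 1 else 0)"
        "k3 \<le> k2 + 1 + (n * (Suc c * (Suc c * 69 + 16) + 250) + Suc c * 39 + 100)"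
      have Xn: "X \<subseteq> {..<n}" using fam_subset[OF 3(1)] tr(3) by simp
      have "outputs I (R3, M3) X" using Xn 3(4) by (simp add: outputs_def)
      moreover have "ssg_optimal I X" unfolding ssg_optimal_def feas using Xn 3(1-3) tr(4) by blast
      moreover have "k3 \<le> 2000 * (n * c\<^sup>2 + m)"
      proof -
        \<comment> \<open>Positivity of \<open>c\<close> and \<open>n\<close> lets
          \<open>n * c\<^sup>2\<close> absorb all terms of lower order.\<close>
        have c2: "Suc c \<le> 2 * c" using c_pos by simp
        have "Suc c * Suc c \<le> (2 * c) * (2 * c)" using c2 by (intro mult_le_mono)
        then have cc: "Suc c * Suc c \<le> 4 * c\<^sup>2" by (simp add: power2_eq_square)
        have c1: "c \<le> c\<^sup>2" by (simp add: power2_eq_square)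
        have c0: "1 \<le> c\<^sup>2" using c_pos by simp
        have "Suc c * (Suc c * 69 + 16) + 250 = 69 * (Suc c * Suc c) + 16 * Suc c + 250" by (simp add: algebra_simps)
        also have "\<dots> \<le> 69 * (4 * c\<^sup>2) + 16 * (2 * c) + 250" using cc c2 by (intro add_mono mult_le_mono2) simp_all
        also have "\<dots> \<le> 600 * c\<^sup>2" using c1 c0 by linarith
        finally have "n * (Suc c * (Suc c * 69 + 16) + 250) \<le> n * (600 * c\<^sup>2)" by (rule mult_le_mono2)
        moreover have "Suc c \<le> 2 * (n * c\<^sup>2)"
        proof -
          have "c\<^sup>2 \<le> n * c\<^sup>2" using n_pos by simp
          then show ?thesis using c1 c2 by linarith
        qed
        moreover have "n \<le> n * c\<^sup>2" using c_pos by simp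
        moreover have "1 \<le> n * c\<^sup>2" using n_pos c_pos by simp
        \<comment> \<open>The products are named so that the final estimate is linear.\<close>
        moreover define N D where "N = n * c\<^sup>2" and "D = n * (Suc c * (Suc c * 69 + 16) + 250)"
        ultimately have "D \<le> 600 * N" "c < 2 * N" "n \<le> N" "1 \<le> N" by simp_all
        moreover have "k3 \<le> k2 + (D + 39 * c + 140)" using 3(5) unfolding D_def[symmetric] by simp
        ultimately have "k3 \<le> 2000 * N + 118 * m" using 1(4) 2(5) by linarith
        then show ?thesis unfolding N_def[symmetric] by simp
      qed
      ultimately show "?post (R3, M3) k3" by blast
    qed (use 2 in auto)
  qed
qed

end

theorem theorem5:
  shows "\<exists>(p :: com) (k :: nat) (K :: nat). \<forall>I :: ssg.
    ssg_instance I \<longrightarrow> msp_digraph (ssg_graph I) \<longrightarrow>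
    (\<exists>S t \<tau> X.
       exec (word_bound k (encode I)) S (encode I) p init_state t \<tau> \<and>
       outputs I \<tau> X \<and> ssg_optimal I X \<and>
       t \<le> K * (num_items I * (capacity I)\<^sup>2 + num_arcs I) \<and>
       work_space p S \<le> K * (num_items I * capacity I))"
proof (rule exI[of _ solver], rule exI[of _ 4],
    rule exI[of _ "2000 + card (com_regs solver) + 4 * card (com_arrays solver)"], intro allI impI)
  fix I :: ssg
  assume "ssg_instance I" "msp_digraph (ssg_graph I)"
  then interpret msp_instance I by unfold_locales
  \<comment> \<open>2000 covers the time; the number of registers is absorbed because
    \<open>n * c\<close> is positive; the factor 4 of the number of arrays comes from the array
    length \<open>4 * n * c\<close>.\<close>
  define K where "K = 2000 + card (com_regs solver) + 4 * card (com_arrays solver)"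
  have "good W init_state" by (simp add: good_def init_state_def)
  with wp_solver obtain t \<tau> X where *: "exec W S (encode I) solver init_state t \<tau>"
    "outputs I \<tau> X" "ssg_optimal I X" "t \<le> 2000 * (n * c\<^sup>2 + m)"
    unfolding wp_def by auto
  have "t \<le> K * (n * c\<^sup>2 + m)"
    using *(4) mult_le_mono1[of 2000 K "n * c\<^sup>2 + m"] by (simp add: K_def)
  moreover have "work_space solver S \<le> K * (n * c)"
  proof -
    have "card (com_regs solver) * 1 \<le> card (com_regs solver) * (n * c)"
      using n_pos c_pos by (intro mult_le_mono2) simp
    moreover have "card (com_arrays solver) * S = 4 * card (com_arrays solver) * (n * c)" by (simp add: S_def)
    moreover have "K * (n * c) = 2000 * (n * c) + card (com_regs solver) * (n * c) + 4 * card (com_arrays solver) * (n * c)"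
      by (simp add: K_def add_mult_distrib)
    ultimately show ?thesis unfolding work_space_def by linarith
  qed
  ultimately show "\<exists>S t \<tau> X.
       exec (word_bound 4 (encode I)) S (encode I) solver init_state t \<tau> \<and>
       outputs I \<tau> X \<and> ssg_optimal I X \<and>
       t \<le> (2000 + card (com_regs solver) + 4 * card (com_arrays solver)) * (num_items I * (capacity I)\<^sup>2 + num_arcs I) \<and>
       work_space solver S \<le> (2000 + card (com_regs solver) + 4 * card (com_arrays solver)) * (num_items I * capacity I)"
    using * unfolding K_def W_def by blast
qed

end
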